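(* For every $\epsilon\in(0,1/2)$, $$nC-\sqrt{nV}\,Q^{-1}(2\epsilon)+\mathcal O(n^{1/3}\log n)\ \le\ \log M^*_{\mathrm f}(n,\epsilon)\ \le\ nC+\mathcal O(\sqrt n)\qquad(n\to\infty),$$ i.e., there exist constants $K_1,K_2,n_0$ such that for all $n\ge n_0$: $\log M^*_{\mathrm f}(n,\epsilon)\ge nC-\sqrt{nV}Q^{-1}(2\epsilon)-K_1n^{1/3}\log n$ and $\log M^*_{\mathrm f}(n,\epsilon)\le nC+K_2\sqrt n$.
   Context: Setting (CM-DMBC): finite alphabets $\mathcal X=\{1,\dots,N\}$, $\mathcal Y$; transition matrices $W_1,W_2$; given input $x$ the outputs are $(y_1,y_2)$ with probability $W_1(y_1|x)W_2(y_2|x)$, memoryless. For a distribution $P$ on $\mathcal X$: $PW_k(y)=\sum_xP(x)W_k(y|x)$, $\imath_{P,W_k}(x;y)=\log\frac{W_k(y|x)}{PW_k(y)}$ (natural log), $I_k(P)=\sum_xP(x)D(W_k(\cdot|x)\|PW_k)$, $V_k(P)=\sum_xP(x)\mathrm{Var}[\imath_{P,W_k}(x;Y_k)]$ with $Y_k\sim W_k(\cdot|x)$. $C=\max_P\min_kI_k(P)$, $C_k=\max_PI_k(P)$. Standing assumptions: the maximizer $P^*$ of $\min_kI_k$ is unique, $P^*(x)>0$ for all $x$, $V_k:=V_k(P^* )>0$ and $C_k>C$ for $k=1,2$. $P^*_{Y_k}=P^*W_k$; for $\mathbf v\in\mathbb R^N$ with entries summing to zero, $\mathrm dI_k(\mathbf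 v)=\sum_xv_xD(W_k(\cdot|x)\|P^*_{Y_k})$; $\eta\in(0,1)$ is the unique constant with $\eta\,\mathrm dI_1(\mathbf v)+(1-\eta)\mathrm dI_2(\mathbf v)=0$ for all such $\mathbf v$. $V=\eta^2V_1+(1-\eta)^2V_2$. $Q(t)=\int_t^\infty\frac1{\sqrt{2\pi}}e^{-u^2/2}du$. An $(n,M,\epsilon)$-FLF code: encoders $f_i:\{1,\dots,M\}\times\mathcal Y^{i-1}\times\mathcal Y^{i-1}\to\mathcal X$ (possibly randomized), $X_i=f_i(J,Y_1^{i-1},Y_2^{i-1})$ with $J$ uniform on $\{1,\dots,M\}$; decoders $g_k:\mathcal Y^n\to\{1,\dots,M\}$ with $\mathbb P[g_k(Y_k^n)\ne J]\le\epsilon$, $k=1,2$. $M^*_{\mathrm f}(n,\epsilon)$ is the largest $M$ for which an $(n,M,\epsilon)$-FLF code exists. *)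

theory Defs
  imports "HOL-Analysis.Analysis"
begin

definition prob_simplex :: "('a::finite \<Rightarrow> real) set" where
  "prob_simplex = {P. (\<forall>x. 0 \<le> P x) \<and> sum P UNIV = 1}"

definition stochastic :: "('x::finite \<Rightarrow> 'y::finite \<Rightarrow> real) \<Rightarrow> bool" where
  "stochastic W \<longleftrightarrow> (\<forall>x y. 0 \<le> W x y) \<and> (\<forall>x. (\<Sum>y\<in>UNIV. W x y) = 1)"

definition outdist :: "('x::finite \<Rightarrow> real) \<Rightarrow> ('x \<Rightarrow> 'y \<Rightarrow> real) \<Rightarrow> 'y \<Rightarrow> real" where
  "outdist P W y = (\<Sum>x\<in>UNIV. P x * W x y)"

text \<open>D(W(.|x) || Q), natural log, with the convention 0 ln 0 = 0.\<close>
definition kl_row :: "('x \<Rightarrow> 'y::finite \<Rightarrow> real) \<Rightarrow> 'x \<Rightarrow> ('y \<Rightarrow> real) \<Rightarrow> real" where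
  "kl_row W x Q = (\<Sum>y | W x y \<noteq> 0. W x y * ln (W x y / Q y))"

definition info_dens :: "('x::finite \<Rightarrow> real) \<Rightarrow> ('x \<Rightarrow> 'y \<Rightarrow> real) \<Rightarrow> 'x \<Rightarrow> 'y \<Rightarrow> real" where
  "info_dens P W x y = ln (W x y / outdist P W y)"

definition mutinf :: "('x::finite \<Rightarrow> real) \<Rightarrow> ('x \<Rightarrow> 'y::finite \<Rightarrow> real) \<Rightarrow> real" where
  "mutinf P W = (\<Sum>x\<in>UNIV. P x * kl_row W x (outdist P W))"

text \<open>V(P) = sum_x P(x) Var[i(x;Y)], Y ~ W(.|x); the mean of i(x;Y) is D(W(.|x)||PW).\<close>
definition dispersion :: "('x::finite \<Rightarrow> real) \<Rightarrow> ('x \<Rightarrow> 'y::finite \<Rightarrow> real) \<Rightarrow> real" where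
  "dispersion P W = (\<Sum>x\<in>UNIV. P x *
      (\<Sum>y | W x y \<noteq> 0. W x y * (info_dens P W x y - kl_row W x (outdist P W))\<^sup>2))"

definition capacity :: "('x::finite \<Rightarrow> 'y::finite \<Rightarrow> real) \<Rightarrow> real" where
  "capacity W = (SUP P\<in>prob_simplex. mutinf P W)"

definition common_cap :: "('x::finite \<Rightarrow> 'y::finite \<Rightarrow> real) \<Rightarrow> ('x \<Rightarrow> 'y \<Rightarrow> real) \<Rightarrow> real" where
  "common_cap W1 W2 = (SUP P\<in>prob_simplex. min (mutinf P W1) (mutinf P W2))"

definition opt_input :: "('x::finite \<Rightarrow> 'y::finite \<Rightarrow> real) \<Rightarrow> ('x \<Rightarrow> 'y \<Rightarrow> real) \<Rightarrow> 'x \<Rightarrow> real" where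
  "opt_input W1 W2 = (THE P. P \<in> prob_simplex \<and> min (mutinf P W1) (mutinf P W2) = common_cap W1 W2)"

definition dI :: "('x::finite \<Rightarrow> 'y::finite \<Rightarrow> real) \<Rightarrow> ('x \<Rightarrow> real) \<Rightarrow> ('x \<Rightarrow> real) \<Rightarrow> real" where
  "dI W P v = (\<Sum>x\<in>UNIV. v x * kl_row W x (outdist P W))"

definition eta_cond :: "('x::finite \<Rightarrow> 'y::finite \<Rightarrow> real) \<Rightarrow> ('x \<Rightarrow> 'y \<Rightarrow> real) \<Rightarrow> real \<Rightarrow> bool" where
  "eta_cond W1 W2 \<eta> \<longleftrightarrow> 0 < \<eta> \<and> \<eta> < 1 \<and>
     (\<forall>v::'x \<Rightarrow> real. sum v UNIV = 0 \<longrightarrow>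
        \<eta> * dI W1 (opt_input W1 W2) v + (1 - \<eta>) * dI W2 (opt_input W1 W2) v = 0)"

definition eta :: "('x::finite \<Rightarrow> 'y::finite \<Rightarrow> real) \<Rightarrow> ('x \<Rightarrow> 'y \<Rightarrow> real) \<Rightarrow> real" where
  "eta W1 W2 = (THE \<eta>. eta_cond W1 W2 \<eta>)"

definition Vdisp :: "('x::finite \<Rightarrow> 'y::finite \<Rightarrow> real) \<Rightarrow> ('x \<Rightarrow> 'y \<Rightarrow> real) \<Rightarrow> real" where
  "Vdisp W1 W2 = (eta W1 W2)\<^sup>2 * dispersion (opt_input W1 W2) W1
                 + (1 - eta W1 W2)\<^sup>2 * dispersion (opt_input W1 W2) W2"

definition Qfun :: "real \<Rightarrow> real" where
  "Qfun t = integral {t..} (\<lambda>u. exp (- (u\<^sup>2) / 2) / sqrt (2 * pi))"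

definition Qinv :: "real \<Rightarrow> real" where
  "Qinv p = (THE t. Qfun t = p)"

text \<open>FLF codes. Encoder: f i j a b x = probability that X_(i+1) = x given message j and
  past outputs a = Y_1^i, b = Y_2^i (time index i = 0..n-1, randomized encoder).
  Decoders are deterministic maps from Y^n.\<close>
definition joint_prob ::
  "('x::finite \<Rightarrow> 'y::finite \<Rightarrow> real) \<Rightarrow> ('x \<Rightarrow> 'y \<Rightarrow> real) \<Rightarrow> nat \<Rightarrow>
   (nat \<Rightarrow> nat \<Rightarrow> 'y list \<Rightarrow> 'y list \<Rightarrow> 'x \<Rightarrow> real) \<Rightarrow> nat \<Rightarrow> 'y list \<Rightarrow> 'y list \<Rightarrow> real" where
  "joint_prob W1 W2 n f j a b =
     (\<Prod>i<n. \<Sum>x\<in>UNIV. f i j (take i a) (take i b) x * W1 x (a ! i) * W2 x (b ! i))"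

definition err_prob ::
  "('x::finite \<Rightarrow> 'y::finite \<Rightarrow> real) \<Rightarrow> ('x \<Rightarrow> 'y \<Rightarrow> real) \<Rightarrow> nat \<Rightarrow> nat \<Rightarrow>
   (nat \<Rightarrow> nat \<Rightarrow> 'y list \<Rightarrow> 'y list \<Rightarrow> 'x \<Rightarrow> real) \<Rightarrow> ('y list \<Rightarrow> 'y list \<Rightarrow> nat) \<Rightarrow> real" where
  "err_prob W1 W2 n M f g =
     (1 / real M) * (\<Sum>j\<in>{1..M}. \<Sum>a\<in>{a. length a = n}. \<Sum>b\<in>{b. length b = n}.
        (if g a b \<noteq> j then joint_prob W1 W2 n f j a b else 0))"

definition is_flf_code ::
  "('x::finite \<Rightarrow> 'y::finite \<Rightarrow> real) \<Rightarrow> ('x \<Rightarrow> 'y \<Rightarrow> real) \<Rightarrow> nat \<Rightarrow> nat \<Rightarrow> real \<Rightarrow>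
   (nat \<Rightarrow> nat \<Rightarrow> 'y list \<Rightarrow> 'y list \<Rightarrow> 'x \<Rightarrow> real) \<Rightarrow> ('y list \<Rightarrow> nat) \<Rightarrow> ('y list \<Rightarrow> nat) \<Rightarrow> bool" where
  "is_flf_code W1 W2 n M \<epsilon> f g1 g2 \<longleftrightarrow>
     1 \<le> M \<and>
     (\<forall>i<n. \<forall>j\<in>{1..M}. \<forall>a b. length a = i \<longrightarrow> length b = i \<longrightarrow>
         (\<forall>x. 0 \<le> f i j a b x) \<and> (\<Sum>x\<in>UNIV. f i j a b x) = 1) \<and>
     err_prob W1 W2 n M f (\<lambda>a b. g1 a) \<le> \<epsilon> \<and>
     err_prob W1 W2 n M f (\<lambda>a b. g2 b) \<le> \<epsilon>"

definition Mstar_f ::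
  "('x::finite \<Rightarrow> 'y::finite \<Rightarrow> real) \<Rightarrow> ('x \<Rightarrow> 'y \<Rightarrow> real) \<Rightarrow> nat \<Rightarrow> real \<Rightarrow> nat" where
  "Mstar_f W1 W2 n \<epsilon> = (GREATEST M. \<exists>f g1 g2. is_flf_code W1 W2 n M \<epsilon> f g1 g2)"

end

theory Submission
  imports Defs "HOL-Probability.Distributions" "HOL-Real_Asymp.Real_Asymp"
begin

text \<open>
  Write \<open>D\<^sub>k(x)\<close> for the divergence of row \<open>x\<close> of \<open>W\<^sub>k\<close> from the optimal output law.  The defining property
  of \<open>\<eta>\<close> says that \<open>\<eta> D\<^sub>1(x) + (1 - \<eta>) D\<^sub>2(x)\<close> is the same number \<open>C\<close> for every input \<open>x\<close>.  Hence, for any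
  feedback code, the mixed information density \<open>\<eta> i\<^sub>1 + (1 - \<eta>) i\<^sub>2 - n C\<close> is a martingale with bounded
  increments.

  Converse: by a change of measure, a user that decodes \<open>M\<close> messages has information density at least
  \<open>ln M - O(1)\<close>, up to a small probability.  Both users succeed together with probability at least
  \<open>1 - 2\<epsilon> > 0\<close>, and then the martingale exceeds \<open>ln M - n C - O(1)\<close>; Chebyshev's inequality bounds \<open>ln M\<close>.

  Achievability: the first \<open>n - n\<^bsup>2/3\<^esup>\<close> symbols are drawn from the optimal input \<open>P\<close>.  The encoder then
  knows both deviations, which are of order \<open>\<surd>n\<close> up to logarithms, and draws the remaining symbols from
  \<open>P + r v\<close> with \<open>r\<close> of order \<open>n\<^bsup>-1/6\<^esup>\<close>.  This moves the two densities in opposite directions by the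
  required amount, at a second-order cost \<open>n\<^bsup>2/3\<^esup> r\<^sup>2\<close> of order \<open>n\<^bsup>1/3\<^esup>\<close>.  If the mixed density is large
  enough, both users are brought to its value; otherwise, an event of probability about \<open>2\<epsilon>\<close>, a fair
  coin decides which of the two users is served, so each user fails with probability about \<open>\<epsilon>\<close>.  The
  decoders try all polynomially many values of \<open>r\<close>, which costs \<open>O(ln n)\<close>.
\<close>

section \<open>The Gaussian tail function\<close>

text \<open>The exponent \<open>2/3\<close> comes from a trade-off. In a steering phase of length
  \<open>m\<close>, tilting away a deviation of order \<open>sqrt n\<close> costs about
  \<open>n / m\<close> nats through the curvature of mutual information, while the phase itself adds
  fluctuations of order \<open>sqrt m\<close> that can no longer be corrected. Up to logarithms both
  equal \<open>n^(1/3)\<close> at \<open>m = n^(2/3)\<close>. All other losses only have to stay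
  below this order. In particular the central limit theorem may have error \<open>n^(-1/6)\<close>:
  a threshold shift of \<open>sqrt n * n^(-1/6) = n^(1/3)\<close> pays for it, so a smoothing
  argument suffices in place of a Berry-Esseen bound. Each user alone could exceed the rate
  \<open>C\<close>, since each single-user capacity is larger; hence the converse must look at the
  event that both succeed. Feedback makes the input law depend on the past, so probabilities are
  nested finite sums along a tree of histories rather than product measures. The mixed density is
  centred for every input letter separately, so no encoder can spoil the martingale.\<close>

abbreviation "gauss \<equiv> std_normal_density"

lemma Qfun_eq_lebesgue: "Qfun t = (\<integral>x. indicator {t..} x * gauss x \<partial>lborel)"
proof -
  have "set_integrable lborel {t..} gauss"
    unfolding set_integrable_def
    by (rule integrable_mult_indicator) auto
  from set_borel_integral_eq_integral(2)[OF this]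
  have "integral {t..} gauss = (LBINT x:{t..}. gauss x)" by simp
  moreover have "gauss = (\<lambda>u. exp (- (u\<^sup>2) / 2) / sqrt (2 * pi))"
    by (auto simp: std_normal_density_def)
  ultimately show ?thesis
    by (simp add: Qfun_def set_lebesgue_integral_def)
qed

lemma integrable_indicator_std_normal:
  "A \<in> sets lborel \<Longrightarrow> integrable lborel (\<lambda>x. indicator A x * gauss x)"
  using integrable_mult_indicator[of A lborel gauss] by simp

lemma Qfun_nonneg: "0 \<le> Qfun t"
  unfolding Qfun_eq_lebesgue by (intro integral_nonneg_AE) auto

lemma Qfun_diff:
  assumes "s \<le> t" shows "Qfun s = integral {s..t} gauss + Qfun t"
proof -
  have si: "set_integrable lborel {s..t} gauss"
    unfolding set_integrable_def by (rule integrable_mult_indicator) auto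
  have i: "integral {s..t} gauss = (\<integral>x. indicator {s..t} x * gauss x \<partial>lborel)"
    using set_borel_integral_eq_integral(2)[OF si] by (simp add: set_lebesgue_integral_def)
  have "Qfun s = (\<integral>x. indicator {s..t} x * gauss x + indicator {t..} x * gauss x \<partial>lborel)"
    unfolding Qfun_eq_lebesgue
  proof (rule integral_cong_AE)
    show "AE x in lborel. indicator {s..} x * gauss x =
        indicator {s..t} x * gauss x + indicator {t..} x * gauss x"
      using AE_lborel_singleton[of t] by eventually_elim (use assms in \<open>auto simp: indicator_def\<close>)
  qed auto
  also have "\<dots> = integral {s..t} gauss + Qfun t"
    unfolding i Qfun_eq_lebesgue
    by (rule Bochner_Integration.integral_add) (auto intro!: integrable_indicator_std_normal)
  finally show ?thesis .
qed

lemma Qfun_has_derivative: "(Qfun has_real_derivative - gauss t) (at t)"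
proof -
  have c: "continuous_on {t-1..t+1} gauss"
    unfolding std_normal_density_def by (intro continuous_intros) auto
  have "((\<lambda>u. integral {t-1..u} gauss) has_real_derivative gauss t) (at t within {t-1..t+1})"
    by (rule integral_has_real_derivative[OF c]) auto
  then have "((\<lambda>u. Qfun (t-1) - integral {t-1..u} gauss) has_real_derivative 0 - gauss t) (at t within {t-1..t+1})"
    by (intro DERIV_diff) auto
  then have "(Qfun has_real_derivative 0 - gauss t) (at t within {t-1..t+1})"
    by (rule has_field_derivative_transform_within[where d = 1])
       (use Qfun_diff[of "t-1"] in \<open>auto simp: algebra_simps\<close>)
  moreover have "at t within {t-1..t+1} = at t"
    by (rule at_within_interior) auto
  ultimately show ?thesis by simp
qed

lemma DERIV_Qfun [derivative_intros]:
  "(g has_real_derivative d) (at x within A) \<Longrightarrow>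
   ((\<lambda>x. Qfun (g x)) has_real_derivative - gauss (g x) * d) (at x within A)"
  using DERIV_chain2[OF Qfun_has_derivative] by blast

lemma DERIV_std_normal_density [derivative_intros]:
  assumes "(g has_real_derivative d) (at x within A)"
  shows "((\<lambda>x. gauss (g x)) has_real_derivative - g x * gauss (g x) * d) (at x within A)"
  unfolding std_normal_density_def
  by (rule derivative_eq_intros assms refl | simp)+

lemma Qfun_antimono: "s \<le> t \<Longrightarrow> Qfun t \<le> Qfun s"
proof -
  assume "s \<le> t"
  moreover have "gauss integrable_on {s..t}" unfolding std_normal_density_def
    by (intro integrable_continuous_interval continuous_intros) auto
  ultimately show ?thesis
    using Qfun_diff[of s t] integral_nonneg[of gauss "{s..t}"] by simp
qed

text \<open>Chebyshev: on \<open>{t..}\<close> the factor \<open>x^2 / t^2\<close> is at least 1,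
  and the second moment is 1. This polynomial tail is enough both for inverting \<open>Qfun\<close>
  and for the smoothing argument.\<close>

lemma Qfun_le_inverse_square:
  assumes "t > 0" shows "Qfun t \<le> 1 / t\<^sup>2"
proof -
  have m2: "has_bochner_integral lborel (\<lambda>x. gauss x * x^2) 1"
    using std_normal_moment_even[of 1] by (simp add: fact_numeral)
  have "Qfun t \<le> (\<integral>x. (gauss x * x^2) * (1/t\<^sup>2) \<partial>lborel)"
    unfolding Qfun_eq_lebesgue
  proof (rule integral_mono)
    show "integrable lborel (\<lambda>x. indicator {t..} x * gauss x)"
      by (rule integrable_indicator_std_normal) auto
    show "integrable lborel (\<lambda>x. (gauss x * x^2) * (1/t\<^sup>2))"
      using m2 by (intro integrable_mult_left) (auto simp: has_bochner_integral_iff)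
    fix x :: real
    show "indicator {t..} x * gauss x \<le> (gauss x * x^2) * (1/t\<^sup>2)"
    proof (cases "t \<le> x")
      case True
      then have "1 \<le> x^2 * (1/t\<^sup>2)" using assms by (simp add: field_simps power_mono)
      then have "gauss x * 1 \<le> gauss x * (x^2 * (1/t\<^sup>2))"
        by (intro mult_left_mono) auto
      then show ?thesis using True by (simp add: mult.assoc)
    qed auto
  qed
  also have "\<dots> = 1/t\<^sup>2"
    using m2 by (simp add: has_bochner_integral_iff)
  finally show ?thesis .
qed

lemma Qfun_minus: "Qfun (- t) = 1 - Qfun t"
proof -
  have "Qfun (- t) = (\<integral>x. indicator {-t..} (0 + (-1) * x) * gauss (0 + (-1) * x) \<partial>lborel)"
    unfolding Qfun_eq_lebesgue
    using lborel_integral_real_affine[of "-1" "\<lambda>x. indicator {-t..} x * gauss x" 0] by simp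
  also have "\<dots> = (\<integral>x. indicator {..t} x * gauss x \<partial>lborel)"
    by (intro Bochner_Integration.integral_cong) (auto simp: indicator_def std_normal_density_def)
  finally have a: "Qfun (- t) = (\<integral>x. indicator {..t} x * gauss x \<partial>lborel)" .
  have "(\<integral>x. gauss x \<partial>lborel) =
     (\<integral>x. indicator {..t} x * gauss x + indicator {t..} x * gauss x \<partial>lborel)"
  proof (rule integral_cong_AE)
    show "AE x in lborel. gauss x =
        indicator {..t} x * gauss x + indicator {t..} x * gauss x"
      using AE_lborel_singleton[of t] by eventually_elim (auto simp: indicator_def)
  qed auto
  also have "\<dots> = Qfun (- t) + Qfun t"
    unfolding a Qfun_eq_lebesgue[of t]
    by (rule Bochner_Integration.integral_add) (auto intro!: integrable_indicator_std_normal)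
  finally show ?thesis by simp
qed

lemma Qfun_strict_antimono:
  assumes "s < t" shows "Qfun t < Qfun s"
proof -
  obtain z where "Qfun t - Qfun s = (t - s) * (- gauss z)"
    using MVT2[OF assms, of Qfun "\<lambda>x. - gauss x"] Qfun_has_derivative by blast
  moreover have "0 < (t - s) * gauss z"
    using assms normal_density_pos[of 1 0 z] by (intro mult_pos_pos) auto
  ultimately show ?thesis by simp
qed

lemma Qfun_Qinv:
  assumes "0 < p" "p < 1" shows "Qfun (Qinv p) = p"
proof -
  \<comment> \<open>Large enough that the Chebyshev bound \<open>1 / t^2\<close> is below both
    \<open>p\<close> and \<open>1 - p\<close>; then \<open>p\<close> lies between
    \<open>Qfun t\<close> and \<open>Qfun (-t)\<close>.\<close>
  define t where "t = 1 / sqrt p + 1 / sqrt (1 - p)"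
  have p: "0 < 1 - p" using assms by simp
  have tp: "t > 0" using assms p by (auto simp: t_def intro!: add_pos_pos)
  have "1 / sqrt p \<le> t" "1 / sqrt (1-p) \<le> t" using assms p by (auto simp: t_def)
  then have "(1 / sqrt p)\<^sup>2 \<le> t\<^sup>2" "(1 / sqrt (1-p))\<^sup>2 \<le> t\<^sup>2"
    using assms p by (auto intro!: power_mono)
  then have "1/p \<le> t\<^sup>2" "1/(1-p) \<le> t\<^sup>2" using assms p by (auto simp: power_divide)
  then have "1/t\<^sup>2 \<le> p" "1/t\<^sup>2 \<le> 1-p" using assms p tp by (auto simp: field_simps)
  then have b: "Qfun t \<le> p" "p \<le> Qfun (-t)"
    using Qfun_le_inverse_square[OF tp] Qfun_minus[of t] by auto
  have "\<exists>x\<ge>-t. x \<le> t \<and> Qfun x = p"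
  proof (rule IVT2[where f = Qfun, OF b])
    show "-t \<le> t" using tp by simp
    show "\<forall>x. -t \<le> x \<and> x \<le> t \<longrightarrow> isCont Qfun x"
      using Qfun_has_derivative DERIV_isCont by blast
  qed
  then obtain x where x: "Qfun x = p" by blast
  have "Qinv p = x" unfolding Qinv_def
    using x Qfun_strict_antimono by (intro the_equality) (auto, metis less_irrefl linorder_neqE_linordered_idom)
  then show ?thesis using x by simp
qed

lemma std_normal_density_le_1: "gauss x \<le> 1"
proof -
  have "1 / sqrt (2 * pi) \<le> 1" using pi_ge_two by (simp add: field_simps real_le_rsqrt)
  moreover have "exp (- x\<^sup>2 / 2) \<le> 1" by simp
  ultimately show ?thesis unfolding std_normal_density_def
    by (metis exp_ge_zero mult_le_one)
qed

lemma Qfun_lipschitz: "\<bar>Qfun s - Qfun t\<bar> \<le> \<bar>s - t\<bar>"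
proof -
  have "norm (Qfun s - Qfun t) \<le> 1 * norm (s - t)"
    by (rule field_differentiable_bound[of UNIV Qfun "\<lambda>x. - gauss x"])
       (auto intro: Qfun_has_derivative simp: std_normal_density_le_1)
  then show ?thesis by simp
qed

text \<open>\<open>exp (x^2 / 2)\<close> dominates its quadratic Taylor polynomial, which in turn
  dominates each power up to a constant. The constants are not sharp; they only control Taylor
  remainders of \<open>Qfun\<close>.\<close>

lemma std_normal_density_moment_bounds:
  "x\<^sup>2 * gauss x \<le> 2" "\<bar>x\<bar> * gauss x \<le> 2" "\<bar>x\<bar>^3 * gauss x \<le> 8"
proof -
  have e: "1 + x\<^sup>2/2 + (x\<^sup>2/2)\<^sup>2/2 \<le> exp (x\<^sup>2/2)"
    by (rule exp_lower_Taylor_quadratic) simp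
  have d: "gauss x \<le> exp (- (x\<^sup>2/2))"
  proof -
    have "1 / sqrt (2 * pi) \<le> 1" using pi_ge_two by (simp add: field_simps real_le_rsqrt)
    then show ?thesis unfolding std_normal_density_def
      using mult_right_mono[of "1 / sqrt (2 * pi)" 1 "exp (- (x\<^sup>2/2))"] by simp
  qed
  have *: "y * gauss x \<le> c" if "0 \<le> y" "y \<le> c * (1 + x\<^sup>2/2 + (x\<^sup>2/2)\<^sup>2/2)" "0 \<le> c" for y c
  proof -
    have "y * gauss x \<le> (c * exp (x\<^sup>2/2)) * exp (- (x\<^sup>2/2))"
      using that e d by (intro mult_mono) (auto intro: order_trans mult_left_mono)
    then show ?thesis by (simp add: exp_minus field_simps)
  qed
  show "x\<^sup>2 * gauss x \<le> 2" by (rule *) auto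
  have "0 \<le> (\<bar>x\<bar> - 1)\<^sup>2" by simp
  then have h: "2 * \<bar>x\<bar> \<le> 1 + x\<^sup>2" by (simp add: power2_diff)
  have "\<bar>x\<bar> \<le> 2 * (1 + x\<^sup>2/2 + (x\<^sup>2/2)\<^sup>2/2)"
  proof -
    have "2 * a \<le> 1 + b \<Longrightarrow> 0 \<le> b \<Longrightarrow> 0 \<le> q \<Longrightarrow> a \<le> 2 * (1 + b/2 + q/2)" for a b q :: real
      by (simp add: field_simps)
    from this[OF h] show ?thesis by simp
  qed
  then show "\<bar>x\<bar> * gauss x \<le> 2" by (intro *) auto
  have "\<bar>x\<bar>^3 = \<bar>x\<bar> * x\<^sup>2" by (simp add: power3_eq_cube power2_eq_square)
  also have "2 * \<dots> \<le> (1 + x\<^sup>2) * x\<^sup>2" using h mult_right_mono[of "2 * \<bar>x\<bar>" "1 + x\<^sup>2" "x\<^sup>2"] by simp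
  finally have c: "2 * \<bar>x\<bar>^3 \<le> (1 + x\<^sup>2) * x\<^sup>2" .
  have "a \<le> 8 * (1 + b/2 + (b/2)\<^sup>2/2)" if "2 * a \<le> (1 + b) * b" "0 \<le> b" for a b :: real
  proof -
    have "8 * (1 + b/2 + (b/2)\<^sup>2/2) = 8 + 4 * b + b * b" by (simp add: field_simps power2_eq_square)
    moreover have "2 * a \<le> b + b * b" using that by (simp add: algebra_simps)
    moreover have "0 \<le> b * b" by simp
    ultimately show ?thesis using that(2) by linarith
  qed
  from this[OF c] have "\<bar>x\<bar>^3 \<le> 8 * (1 + x\<^sup>2/2 + (x\<^sup>2/2)\<^sup>2/2)" by simp
  then show "\<bar>x\<bar>^3 * gauss x \<le> 8" by (intro *) auto
qed

section \<open>Tree expectations and a quantitative central limit theorem\<close>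

text \<open>Expectation over a random history whose next letter has law \<open>\<kappa> l\<close>
  given the past \<open>l\<close>. The recursion integrates out the last letter first, because the
  kernel sees the whole prefix. Laws are assumed nonnegative and normalised only for histories
  shorter than \<open>n\<close>, since encoders are constrained only there.\<close>

primrec texp :: "('w::finite list \<Rightarrow> 'w \<Rightarrow> real) \<Rightarrow> nat \<Rightarrow> ('w list \<Rightarrow> real) \<Rightarrow> real" where
  "texp \<kappa> 0 F = F []"
| "texp \<kappa> (Suc n) F = texp \<kappa> n (\<lambda>l. \<Sum>om\<in>UNIV. \<kappa> l om * F (l @ [om]))"

abbreviation "iid p \<equiv> texp (\<lambda>_. p)"

lemma texp_cong:
  "(\<And>l. length l = n \<Longrightarrow> F l = G l) \<Longrightarrow> texp \<kappa> n F = texp \<kappa> n G"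
proof (induction n arbitrary: F G)
  case (Suc n)
  show ?case by (simp, rule Suc.IH) (simp add: Suc.prems)
qed simp

text \<open>The comparison is required only on histories of positive probability. This is what later
  allows logarithms of likelihood ratios to be taken.\<close>

lemma texp_mono_support:
  assumes "\<And>l om. length l < n \<Longrightarrow> 0 \<le> \<kappa> l om"
    and "\<And>l. length l = n \<Longrightarrow> (\<And>i. i < n \<Longrightarrow> 0 < \<kappa> (take i l) (l ! i)) \<Longrightarrow> F l \<le> G l"
  shows "texp \<kappa> n F \<le> texp \<kappa> n G"
  using assms
proof (induction n arbitrary: F G)
  case (Suc n)
  show ?case
  proof (simp, rule Suc.IH)
    fix l :: "'a list" assume l: "length l = n" "\<And>i. i < n \<Longrightarrow> 0 < \<kappa> (take i l) (l ! i)"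
    show "(\<Sum>om\<in>UNIV. \<kappa> l om * F (l @ [om])) \<le> (\<Sum>om\<in>UNIV. \<kappa> l om * G (l @ [om]))"
    proof (rule sum_mono)
      fix om
      show "\<kappa> l om * F (l @ [om]) \<le> \<kappa> l om * G (l @ [om])"
      proof (cases "\<kappa> l om = 0")
        case False
        then have k: "0 < \<kappa> l om" using Suc.prems(1)[of l om] l(1) by simp
        have "F (l @ [om]) \<le> G (l @ [om])"
        proof (rule Suc.prems(2))
          fix i assume "i < Suc n"
          then show "0 < \<kappa> (take i (l @ [om])) ((l @ [om]) ! i)"
            using l k by (cases "i = n") (auto simp: nth_append)
        qed (use l in simp)
        then show ?thesis using k by simp
      qed simp
    qed
  qed (use Suc.prems(1) in auto)
qed simp

lemma texp_mono:
  assumes "\<And>l om. length l < n \<Longrightarrow> 0 \<le> \<kappa> l om" "\<And>l. length l = n \<Longrightarrow> F l \<le> G l"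
  shows "texp \<kappa> n F \<le> texp \<kappa> n G"
  by (rule texp_mono_support) (use assms in auto)

lemma texp_add: "texp \<kappa> n (\<lambda>l. F l + G l) = texp \<kappa> n F + texp \<kappa> n G"
  by (induction n arbitrary: F G) (simp_all add: distrib_left sum.distrib)

lemma texp_cmult: "texp \<kappa> n (\<lambda>l. c * F l) = c * texp \<kappa> n F"
proof (induction n arbitrary: F)
  case (Suc n)
  have "(\<lambda>l. \<Sum>om\<in>UNIV. \<kappa> l om * (c * F (l @ [om]))) = (\<lambda>l. c * (\<Sum>om\<in>UNIV. \<kappa> l om * F (l @ [om])))"
    by (simp add: sum_distrib_left mult_ac)
  then show ?case using Suc by simp
qed simp

lemma texp_const:
  assumes "\<And>l. length l < n \<Longrightarrow> (\<Sum>om\<in>UNIV. \<kappa> l om) = 1"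
  shows "texp \<kappa> n (\<lambda>l. c) = c"
  using assms
proof (induction n)
  case (Suc n)
  have "texp \<kappa> (Suc n) (\<lambda>l. c) = texp \<kappa> n (\<lambda>l. c)"
    by (simp, rule texp_cong) (simp add: Suc.prems flip: sum_distrib_right)
  then show ?case using Suc by simp
qed simp

lemma texp_le_const:
  assumes "\<And>l om. length l < n \<Longrightarrow> 0 \<le> \<kappa> l om" "\<And>l. length l < n \<Longrightarrow> (\<Sum>om\<in>UNIV. \<kappa> l om) = 1"
    "\<And>l. length l = n \<Longrightarrow> F l \<le> c"
  shows "texp \<kappa> n F \<le> c"
  using texp_mono[of n \<kappa> F "\<lambda>_. c"] texp_const[of n \<kappa> c] assms by auto

text \<open>Orthogonality of martingale increments: the conditional mean zero removes the cross
  term, so conditional variances add up although the kernel depends on the past.\<close>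

lemma texp_square_le:
  assumes "\<And>l om. length l < n \<Longrightarrow> 0 \<le> \<kappa> l om" "\<And>l. length l < n \<Longrightarrow> (\<Sum>om\<in>UNIV. \<kappa> l om) = 1"
    "\<And>l. length l < n \<Longrightarrow> (\<Sum>om\<in>UNIV. \<kappa> l om * g om) = 0"
    "\<And>l. length l < n \<Longrightarrow> (\<Sum>om\<in>UNIV. \<kappa> l om * (g om)\<^sup>2) \<le> B"
  shows "texp \<kappa> n (\<lambda>l. (sum_list (map g l))\<^sup>2) \<le> real n * B"
  using assms
proof (induction n)
  case (Suc n)
  have "texp \<kappa> (Suc n) (\<lambda>l. (sum_list (map g l))\<^sup>2) \<le> texp \<kappa> n (\<lambda>l. (sum_list (map g l))\<^sup>2 + B)"
  proof (simp, rule texp_mono)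
    fix l :: "'a list" assume l: "length l = n"
    let ?z = "sum_list (map g l)"
    have "(\<Sum>om\<in>UNIV. \<kappa> l om * (?z + g om)\<^sup>2)
        = (\<Sum>om\<in>UNIV. ?z\<^sup>2 * \<kappa> l om + 2 * ?z * (\<kappa> l om * g om) + \<kappa> l om * (g om)\<^sup>2)"
      by (intro sum.cong) (auto simp: power2_eq_square algebra_simps)
    also have "\<dots> = ?z\<^sup>2 + (\<Sum>om\<in>UNIV. \<kappa> l om * (g om)\<^sup>2)"
      using Suc.prems(2,3)[of l] l by (simp add: sum.distrib flip: sum_distrib_left)
    finally show "(\<Sum>om\<in>UNIV. \<kappa> l om * (?z + g om)\<^sup>2) \<le> ?z\<^sup>2 + B"
      using Suc.prems(4)[of l] l by simp
  qed (use Suc.prems in auto)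
  also have "\<dots> = texp \<kappa> n (\<lambda>l. (sum_list (map g l))\<^sup>2) + B"
    unfolding texp_add using texp_const[of n \<kappa> B] Suc.prems by simp
  finally show ?case using Suc by (simp add: algebra_simps)
qed simp

section \<open>Exponential tail bounds for i.i.d. sums\<close>

lemma exp_le_quadratic:
  assumes "\<bar>y\<bar> \<le> 1" shows "exp y \<le> 1 + y + 2 * (y::real)\<^sup>2"
proof -
  obtain t where t: "\<bar>t\<bar> \<le> \<bar>y\<bar>" "exp y = (\<Sum>m<2. y^m / fact m) + exp t / fact 2 * y^2"
    using Maclaurin_exp_le[of y 2] by blast
  have "exp t \<le> 3" using exp_le t assms exp_le_cancel_iff[of t 1] by linarith
  then have "exp t / 2 * y^2 \<le> 2 * y^2" by (intro mult_right_mono) auto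
  then show ?thesis using t(2) by (simp add: numeral_2_eq_2)
qed

lemma texp_iid_exp_le:
  assumes "\<And>om. 0 \<le> p om" "(\<Sum>om\<in>UNIV. p om * exp (g om)) \<le> exp c"
  shows "iid p n (\<lambda>l. exp (sum_list (map g l))) \<le> exp (real n * c)"
proof (induction n)
  case (Suc n)
  have "iid p (Suc n) (\<lambda>l. exp (sum_list (map g l))) \<le> iid p n (\<lambda>l. exp c * exp (sum_list (map g l)))"
  proof (simp, rule texp_mono)
    fix l :: "'a list"
    have "(\<Sum>om\<in>UNIV. p om * exp (sum_list (map g l) + g om))
       = (\<Sum>om\<in>UNIV. p om * exp (g om)) * exp (sum_list (map g l))"
      unfolding sum_distrib_right by (intro sum.cong) (auto simp: exp_add)
    also have "\<dots> \<le> exp c * exp (sum_list (map g l))"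
      using assms by (intro mult_right_mono) auto
    finally show "(\<Sum>om\<in>UNIV. p om * exp (sum_list (map g l) + g om)) \<le> exp c * exp (sum_list (map g l))" .
  qed (use assms in auto)
  also have "\<dots> \<le> exp c * exp (real n * c)"
    unfolding texp_cmult using Suc by simp
  finally show ?case by (simp add: exp_add algebra_simps)
qed simp

lemma iid_lower_tail:
  assumes p: "\<And>om. 0 \<le> p om" "sum p UNIV = 1"
    and m: "(\<Sum>om\<in>UNIV. p om * g om) = m"
    and R: "\<And>om. 0 < p om \<Longrightarrow> \<bar>g om - m\<bar> \<le> R" "0 < R"
    and t: "0 \<le> t" "t \<le> 4 * real n * R" and n: "0 < n"
  shows "iid p n (\<lambda>l. of_bool (sum_list (map g l) \<le> real n * m - t)) \<le> exp (- t\<^sup>2 / (8 * real n * R\<^sup>2))"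
proof -
  \<comment> \<open>The Chernoff parameter that minimises
    \<open>- c * t + 2 * n * (c * R)^2\<close>. The upper limit on \<open>t\<close> is exactly
    \<open>c * R \<le> 1\<close>, which \<open>exp_le_quadratic\<close> needs.\<close>
  define c where "c = t / (4 * real n * R\<^sup>2)"
  have c: "0 \<le> c" "c * R \<le> 1" using t R n by (auto simp: c_def field_simps power2_eq_square)
  define h where "h om = c * (m - g om)" for om
  have hs: "sum_list (map h l) = c * (real (length l) * m - sum_list (map g l))" for l
    by (induction l) (auto simp: h_def algebra_simps)
  have "(\<Sum>om\<in>UNIV. p om * exp (h om)) \<le> (\<Sum>om\<in>UNIV. p om * (1 + h om + 2 * (c*R)\<^sup>2))"
  proof (rule sum_mono)
    fix om
    show "p om * exp (h om) \<le> p om * (1 + h om + 2 * (c*R)\<^sup>2)"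
    proof (cases "p om = 0")
      case False
      then have "\<bar>g om - m\<bar> \<le> R" using R(1)[of om] p(1)[of om] by linarith
      then have hb: "\<bar>h om\<bar> \<le> c * R" using c(1) unfolding h_def
        by (simp add: abs_mult abs_minus_commute mult_left_mono)
      have "exp (h om) \<le> 1 + h om + 2 * (h om)\<^sup>2" by (rule exp_le_quadratic) (use hb c in linarith)
      also have "(h om)\<^sup>2 \<le> (c*R)\<^sup>2" using hb by (metis abs_le_square_iff abs_of_nonneg abs_ge_zero order_trans)
      finally have "exp (h om) \<le> 1 + h om + 2 * (c*R)\<^sup>2" by simp
      then show ?thesis using p(1) by (intro mult_left_mono) auto
    qed simp
  qed
  also have "\<dots> = (\<Sum>om\<in>UNIV. p om * (1 + c * m + 2 * (c*R)\<^sup>2) - c * (p om * g om))"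
    by (intro sum.cong) (auto simp: h_def algebra_simps)
  also have "\<dots> = 1 + 2 * (c*R)\<^sup>2"
    using p(2) m by (simp add: sum_subtractf flip: sum_distrib_left sum_distrib_right)
  also have "\<dots> \<le> exp (2 * (c*R)\<^sup>2)" by (rule exp_ge_add_one_self)
  finally have E: "iid p n (\<lambda>l. exp (sum_list (map h l))) \<le> exp (real n * (2 * (c*R)\<^sup>2))"
    using p by (intro texp_iid_exp_le) auto
  have "iid p n (\<lambda>l. of_bool (sum_list (map g l) \<le> real n * m - t))
      \<le> iid p n (\<lambda>l. exp (- c * t) * exp (sum_list (map h l)))"
  proof (rule texp_mono)
    fix l :: "'a list" assume l: "length l = n"
    have "0 \<le> - c * t + sum_list (map h l)" if "sum_list (map g l) \<le> real n * m - t"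
    proof -
      have "c * t \<le> c * (real n * m - sum_list (map g l))"
        using that c by (intro mult_left_mono) auto
      then show ?thesis using hs[of l] l by simp
    qed
    then show "of_bool (sum_list (map g l) \<le> real n * m - t) \<le> exp (- c * t) * exp (sum_list (map h l))"
      by (auto simp: exp_add[symmetric])
  qed (use p in auto)
  also have "\<dots> \<le> exp (- c * t) * exp (real n * (2 * (c*R)\<^sup>2))"
    unfolding texp_cmult using E by simp
  also have "\<dots> = exp (- c * t + real n * (2 * (c*R)\<^sup>2))" by (rule exp_add[symmetric])
  also have "- c * t + real n * (2 * (c*R)\<^sup>2) = - t\<^sup>2 / (8 * real n * R\<^sup>2)"
    using n R(2) by (simp add: c_def field_simps power2_eq_square)
  finally show ?thesis .
qed

section \<open>Lindeberg replacement and a central limit theorem with an explicit rate\<close>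

lemma Qfun_taylor:
  "Qfun (v + h) \<le> Qfun v - gauss v * h + v * gauss v * h\<^sup>2 / 2 + \<bar>h\<bar>^3"
proof -
  \<comment> \<open>\<open>d m\<close> is the \<open>m\<close>-th derivative of
    \<open>Qfun (v + x)\<close> in \<open>x\<close>, for \<open>m\<close> up to 3. The third one is
    \<open>1 - y^2\<close> times the density at \<open>y = v + x\<close>, hence bounded by
    3.\<close>
  define d :: "nat \<Rightarrow> real \<Rightarrow> real" where "d m x = (if m = 0 then Qfun (v+x) else if m = 1 then - gauss (v+x)
     else if m = 2 then (v+x) * gauss (v+x) else (1 - (v+x)\<^sup>2) * gauss (v+x))" for m x
  have "\<exists>t. \<bar>t\<bar> \<le> \<bar>h\<bar> \<and> Qfun (v + h) = (\<Sum>m<3. d m 0 / fact m * h ^ m) + d 3 t / fact 3 * h ^ 3"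
  proof (rule Maclaurin_bi_le)
    show "d 0 = (\<lambda>x. Qfun (v + x))" by (auto simp: d_def)
    show "\<forall>m t. m < 3 \<and> \<bar>t\<bar> \<le> \<bar>h\<bar> \<longrightarrow> (d m has_real_derivative d (Suc m) t) (at t)"
    proof (intro allI impI)
      fix m t assume "m < (3::nat) \<and> \<bar>t\<bar> \<le> \<bar>h\<bar>"
      then consider "m = 0" | "m = 1" | "m = 2" by linarith
      then show "(d m has_real_derivative d (Suc m) t) (at t)"
        by cases (auto simp: d_def[abs_def] power2_eq_square algebra_simps intro!: derivative_eq_intros)
    qed
  qed
  then obtain t where t: "Qfun (v + h) = (\<Sum>m<3. d m 0 / fact m * h ^ m) + d 3 t / fact 3 * h ^ 3" by blast
  have "\<bar>d 3 t\<bar> \<le> \<bar>1 - (v+t)\<^sup>2\<bar> * gauss (v+t)"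
    by (simp add: d_def abs_mult)
  also have "\<dots> \<le> (1 + (v+t)\<^sup>2) * gauss (v+t)"
    by (intro mult_right_mono) (auto simp: abs_le_iff)
  also have "\<dots> \<le> 1 + 2" unfolding distrib_right
    by (intro add_mono) (use std_normal_density_le_1 std_normal_density_moment_bounds(1) in auto)
  finally have "\<bar>d 3 t\<bar> / 6 * \<bar>h\<bar>^3 \<le> 3 / 6 * \<bar>h\<bar>^3"
    by (intro mult_right_mono divide_right_mono) auto
  then have "\<bar>d 3 t / fact 3 * h^3\<bar> \<le> 3 / 6 * \<bar>h\<bar>^3"
    by (simp add: abs_mult power_abs fact_numeral)
  then have "d 3 t / fact 3 * h^3 \<le> \<bar>h\<bar>^3" using zero_le_power_abs[of h 3] by linarith
  then show ?thesis unfolding t by (simp add: eval_nat_numeral d_def)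
qed

text \<open>First-order expansion in the variance parameter: the second term on the left is
  \<open>V\<close> times the derivative of \<open>Qfun (u / sqrt s)\<close> in \<open>s\<close>,
  which is half its second derivative in \<open>u\<close>. The remainder is the second
  \<open>s\<close>-derivative, of size \<open>1 / s^2\<close> by the moment bounds.\<close>

lemma Qfun_heat:
  fixes s V u :: real
  assumes "s > 0" "V > 0"
  defines "w \<equiv> u / sqrt s"
  shows "Qfun w + w * gauss w * (V / s) / 2 \<le> Qfun (u / sqrt (s + V)) + 2 * V\<^sup>2 / s\<^sup>2"
proof -
  let ?w = "\<lambda>h. u / sqrt (s + h)"
  define d :: "nat \<Rightarrow> real \<Rightarrow> real" where "d m h = (if m = 0 then Qfun (?w h)
     else if m = 1 then ?w h * gauss (?w h) / (2 * (s + h))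
     else ((?w h)^3 - 3 * ?w h) * gauss (?w h) / (4 * (s + h)\<^sup>2))" for m h
  have w': "(?w has_real_derivative - ?w h / (2 * (s + h))) (at h)" if "h \<ge> 0" for h
    using that assms by (auto intro!: derivative_eq_intros simp: field_simps)
  have "\<exists>t>0. t < V \<and> Qfun (?w V) = (\<Sum>m<2. d m 0 / fact m * V ^ m) + d 2 t / fact 2 * V ^ 2"
  proof (rule Maclaurin)
    show "d 0 = (\<lambda>h. Qfun (?w h))" by (auto simp: d_def)
    show "\<forall>m t. m < 2 \<and> 0 \<le> t \<and> t \<le> V \<longrightarrow> (d m has_real_derivative d (Suc m) t) (at t)"
    proof (intro allI impI)
      fix m t assume mt: "m < (2::nat) \<and> 0 \<le> t \<and> t \<le> V"
      then have st: "s + t > 0" using assms by simp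
      have t0: "0 \<le> t" using mt by simp
      consider "m = 0" | "m = 1" using mt by linarith
      then show "(d m has_real_derivative d (Suc m) t) (at t)"
      proof cases
        case 1
        then show ?thesis unfolding d_def[abs_def]
          using st by (auto intro!: derivative_eq_intros w'[OF t0] simp: field_simps)
      next
        case 2
        have "((\<lambda>h. ?w h * gauss (?w h) / (2 * (s + h))) has_real_derivative
            ((?w t)^3 - 3 * ?w t) * gauss (?w t) / (4 * (s + t)\<^sup>2)) (at t)"
        proof -
          define a where "a = ?w t"
          define b where "b = gauss a"
          define r where "r = s + t"
          have r: "r > 0" using st r_def by simp
          have eq: "((- a / (2*r)) * b + (- a * b * (- a / (2*r))) * a) * (2*r) - (a * b) * 2 = (a^3 - 3*a) * b"
            using r by (simp add: field_simps power3_eq_cube)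
          have n: "((\<lambda>h. ?w h * gauss (?w h)) has_real_derivative
             (- a / (2*r)) * b + (- a * b * (- a / (2*r))) * a) (at t)"
            using DERIV_mult[OF w'[OF t0] DERIV_std_normal_density[OF w'[OF t0]]]
            unfolding a_def b_def r_def .
          have m: "((\<lambda>h. 2 * (s + h)) has_real_derivative 2) (at t)"
            by (auto intro!: derivative_eq_intros)
          have "((\<lambda>h. ?w h * gauss (?w h) / (2 * (s + h))) has_real_derivative
             (((- a / (2*r)) * b + (- a * b * (- a / (2*r))) * a) * (2*r) - (a * b) * 2) / ((2*r) * (2*r))) (at t)"
            using DERIV_divide[OF n m] st unfolding a_def b_def r_def by simp
          then have "((\<lambda>h. ?w h * gauss (?w h) / (2 * (s + h))) has_real_derivative
             (a^3 - 3*a) * b / ((2*r) * (2*r))) (at t)" unfolding eq .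
          moreover have "(2*r) * (2*r) = 4 * r\<^sup>2" by (simp add: power2_eq_square)
          ultimately show ?thesis unfolding a_def b_def r_def by simp
        qed
        then show ?thesis using 2 by (simp add: d_def[abs_def])
      qed
    qed
  qed (use assms in auto)
  then obtain t where t: "0 < t" "t < V" "Qfun (?w V) = (\<Sum>m<2. d m 0 / fact m * V ^ m) + d 2 t / fact 2 * V ^ 2"
    by blast
  let ?a = "?w t" and ?b = "gauss (?w t)"
  have "\<bar>(?a^3 - 3 * ?a) * ?b\<bar> \<le> (\<bar>?a\<bar>^3 + 3 * \<bar>?a\<bar>) * ?b"
    using abs_triangle_ineq4[of "?a^3" "3 * ?a"]
    unfolding abs_mult by (intro mult_mono) (auto simp: power_abs abs_mult)
  also have "\<dots> \<le> 8 + 3 * 2" unfolding distrib_right mult.assoc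
    by (intro add_mono mult_left_mono std_normal_density_moment_bounds) auto
  finally have n: "\<bar>(?a^3 - 3 * ?a) * ?b\<bar> \<le> 14" by simp
  have "\<bar>d 2 t\<bar> = \<bar>(?a^3 - 3 * ?a) * ?b\<bar> / (4 * (s + t)\<^sup>2)"
    by (simp add: d_def abs_divide)
  also have "\<dots> \<le> 14 / (4 * s\<^sup>2)"
    using n assms t by (intro frac_le) (auto intro!: power_mono)
  finally have "\<bar>d 2 t\<bar> / 2 * V\<^sup>2 \<le> (14 / (4 * s\<^sup>2)) / 2 * V\<^sup>2"
    by (intro mult_right_mono divide_right_mono) auto
  then have "\<bar>d 2 t / fact 2 * V^2\<bar> \<le> (14 / (4 * s\<^sup>2)) / 2 * V^2"
    by (simp add: abs_mult)
  also have "\<dots> \<le> 2 * V\<^sup>2 / s\<^sup>2" using assms by (simp add: field_simps)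
  finally have "- (2 * V\<^sup>2 / s\<^sup>2) \<le> d 2 t / fact 2 * V^2" by linarith
  moreover have "(\<Sum>m<2. d m 0 / fact m * V ^ m) = Qfun w + w * gauss w * (V / s) / 2"
    by (simp add: eval_nat_numeral d_def w_def)
  ultimately show ?thesis using t(3) by simp
qed

text \<open>\<open>Qfun (u / sqrt s)\<close> solves the heat equation in \<open>(s, u)\<close>, so trading one summand of variance \<open>V\<close> for an
  increase of \<open>s\<close> by \<open>V\<close> leaves only third-order terms; the error is put in telescoping form.\<close>
lemma gaussian_replacement_step:
  assumes p: "\<And>om. 0 \<le> p om" "sum p UNIV = 1"
    and g: "(\<Sum>om\<in>UNIV. p om * g om) = 0" "(\<Sum>om\<in>UNIV. p om * (g om)\<^sup>2) = V" "0 < V"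
    and R: "\<And>om. 0 < p om \<Longrightarrow> \<bar>g om\<bar> \<le> R" "0 \<le> R"
    and s: "1 \<le> s"
  shows "(\<Sum>om\<in>UNIV. p om * Qfun ((u + g om) / sqrt s)) \<le> Qfun (u / sqrt (s + V))
     + ((R^3 + 2 * V\<^sup>2) * (2 * (1 + V) / V)) * (1 / sqrt s - 1 / sqrt (s + V))"
proof -
  define w where "w = u / sqrt s"
  let ?d = "gauss w"
  have r: "sqrt s \<ge> 1" "sqrt s > 0" "sqrt s * sqrt s = s" using s by (auto simp: real_sqrt_ge_one)
  have "(\<Sum>om\<in>UNIV. p om * Qfun ((u + g om) / sqrt s))
     \<le> (\<Sum>om\<in>UNIV. p om * (Qfun w - ?d * (g om / sqrt s) + w * ?d * (g om)\<^sup>2 / s / 2 + R^3 / (s * sqrt s)))"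
  proof (rule sum_mono)
    fix om
    show "p om * Qfun ((u + g om) / sqrt s)
      \<le> p om * (Qfun w - ?d * (g om / sqrt s) + w * ?d * (g om)\<^sup>2 / s / 2 + R^3 / (s * sqrt s))"
    proof (cases "p om = 0")
      case False
      then have gR: "\<bar>g om\<bar> \<le> R" using R(1)[of om] p(1)[of om] by linarith
      have "\<bar>g om / sqrt s\<bar>^3 = \<bar>g om\<bar>^3 / (s * sqrt s)"
        using r s by (simp add: power_divide power3_eq_cube)
      also have "\<dots> \<le> R^3 / (s * sqrt s)"
        using gR r s by (intro divide_right_mono power_mono) auto
      finally have c: "\<bar>g om / sqrt s\<bar>^3 \<le> R^3 / (s * sqrt s)" .
      have sq: "(g om / sqrt s)\<^sup>2 = (g om)\<^sup>2 / s" using s by (simp add: power_divide)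
      have "Qfun ((u + g om) / sqrt s) \<le> Qfun w - ?d * (g om / sqrt s) + w * ?d * (g om)\<^sup>2 / s / 2 + R^3 / (s * sqrt s)"
        using Qfun_taylor[of w "g om / sqrt s"] c unfolding sq by (simp add: w_def add_divide_distrib)
      then show ?thesis using p(1) by (intro mult_left_mono) auto
    qed simp
  qed
  also have "\<dots> = (\<Sum>om\<in>UNIV. (Qfun w + R^3 / (s * sqrt s)) * p om - (?d / sqrt s) * (p om * g om)
      + (w * ?d / s / 2) * (p om * (g om)\<^sup>2))"
    by (intro sum.cong refl) (simp add: algebra_simps)
  also have "\<dots> = Qfun w + R^3 / (s * sqrt s) + (w * ?d / s / 2) * V"
    unfolding sum.distrib sum_subtractf sum_distrib_left[symmetric] p g by simp
  also have "\<dots> \<le> Qfun (u / sqrt (s + V)) + 2 * V\<^sup>2 / s\<^sup>2 + R^3 / (s * sqrt s)"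
    using Qfun_heat[of s V u] s g(3) by (simp add: w_def)
  also have "2 * V\<^sup>2 / s\<^sup>2 \<le> 2 * V\<^sup>2 / (s * sqrt s)"
  proof (rule divide_left_mono)
    show "s * sqrt s \<le> s\<^sup>2" using s r mult_left_mono[of 1 "sqrt s" "s * sqrt s"]
      by (simp add: power2_eq_square mult.assoc)
  qed (use s in auto)
  also have "Qfun (u / sqrt (s + V)) + 2 * V\<^sup>2 / (s * sqrt s) + R^3 / (s * sqrt s)
     = Qfun (u / sqrt (s + V)) + (R^3 + 2 * V\<^sup>2) * (1 / (s * sqrt s))" by (simp add: add_divide_distrib)
  \<comment> \<open>Over a step \<open>V\<close> the function \<open>1 / sqrt s\<close> drops by an
    amount of order \<open>V / s^(3/2)\<close>. Since \<open>1 \<le> s\<close> gives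
    \<open>s + V \<le> s * (1 + V)\<close>, the factor \<open>2 * (1 + V) / V\<close> suffices.
    Writing the error as a difference lets the errors of successive replacements telescope.\<close>
  also have "1 / (s * sqrt s) \<le> (2 * (1 + V) / V) * (1 / sqrt s - 1 / sqrt (s + V))"
  proof -
    let ?a = "sqrt s" and ?b = "sqrt (s + V)"
    have ab: "?a \<le> ?b" "?b > 0" "?b * ?b = s + V" using s g(3) by auto
    have "V = (?b - ?a) * (?b + ?a)" using ab r by (simp add: algebra_simps)
    also have "\<dots> \<le> (?b - ?a) * (2 * ?b)" using ab by (intro mult_left_mono) auto
    finally have "V / (2 * (?b * ?b) * ?a) \<le> (?b - ?a) * (2 * ?b) / (2 * (?b * ?b) * ?a)"
      using ab r by (intro divide_right_mono) auto
    also have "\<dots> = 1 / ?a - 1 / ?b"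
    proof -
      have "(b - a) * (2 * b) / (2 * (b * b) * a) = 1 / a - 1 / b" if "a > 0" "b > 0" for a b :: real
        using that by (simp add: field_simps)
      then show ?thesis using ab r by blast
    qed
    finally have "V / (2 * (s + V) * ?a) \<le> 1 / ?a - 1 / ?b" unfolding ab .
    then have "(2 * (1 + V) / V) * (V / (2 * (s + V) * ?a)) \<le> (2 * (1 + V) / V) * (1 / ?a - 1 / ?b)"
      using g(3) by (intro mult_left_mono) auto
    moreover have "1 / (s * ?a) \<le> (2 * (1 + V) / V) * (V / (2 * (s + V) * ?a))"
    proof -
      have "1 / (s * ?a) = (1 + V) / ((s * (1 + V)) * ?a)" using g(3) by simp
      also have "\<dots> \<le> (1 + V) / ((s + V) * ?a)"
        using g(3) s r mult_right_mono[of 1 s V]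
        by (intro frac_le mult_right_mono mult_pos_pos) (auto simp: distrib_left)
      also have "\<dots> = (2 * (1 + V) / V) * (V / (2 * (s + V) * ?a))"
      proof -
        have "c / (d * a) = (2 * c / V) * (V / (2 * d * a))" for a c d :: real using g(3) by simp
        then show ?thesis .
      qed
      finally show ?thesis .
    qed
    ultimately show ?thesis by simp
  qed
  finally show ?thesis using R(2) by (simp add: mult_left_mono mult.assoc)
qed

text \<open>Lindeberg's method: the summands are traded one by one for Gaussian variance, which
  raises \<open>s\<close> by \<open>V\<close> each time. The errors telescope, so for
  \<open>A \<ge> 0\<close> their total is at most \<open>A / sqrt s\<close>, whatever
  \<open>N\<close> is.\<close>

lemma iid_gaussian_smoothing:
  assumes p: "\<And>om. 0 \<le> p om" "sum p UNIV = 1"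
    and A: "\<And>s u. 1 \<le> s \<Longrightarrow> (\<Sum>om\<in>UNIV. p om * Qfun ((u + g om) / sqrt s)) \<le> Qfun (u / sqrt (s + V))
      + A * (1 / sqrt s - 1 / sqrt (s + V))"
    and V: "0 \<le> V" and s: "1 \<le> s"
  shows "iid p N (\<lambda>l. Qfun ((u + sum_list (map g l)) / sqrt s)) \<le> Qfun (u / sqrt (s + real N * V))
     + A * (1 / sqrt s - 1 / sqrt (s + real N * V))"
  using s
proof (induction N arbitrary: s)
  case (Suc N)
  have "iid p (Suc N) (\<lambda>l. Qfun ((u + sum_list (map g l)) / sqrt s))
     \<le> iid p N (\<lambda>l. Qfun ((u + sum_list (map g l)) / sqrt (s + V)) + A * (1 / sqrt s - 1 / sqrt (s + V)))"
    by (simp, rule texp_mono) (use p A[OF Suc.prems] in \<open>auto simp: add.assoc[symmetric]\<close>)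
  also have "\<dots> = iid p N (\<lambda>l. Qfun ((u + sum_list (map g l)) / sqrt (s + V))) + A * (1 / sqrt s - 1 / sqrt (s + V))"
    unfolding texp_add by (subst texp_const) (use p in auto)
  also have "\<dots> \<le> Qfun (u / sqrt (s + V + real N * V)) + A * (1 / sqrt (s + V) - 1 / sqrt (s + V + real N * V))
     + A * (1 / sqrt s - 1 / sqrt (s + V))"
    using Suc.IH[of "s + V"] Suc.prems V by simp
  also have "\<dots> = Qfun (u / sqrt (s + V + real N * V)) + A * (1 / sqrt s - 1 / sqrt (s + V + real N * V))"
    by (simp only: right_diff_distrib)
  also have "s + V + real N * V = s + real (Suc N) * V" by (simp add: algebra_simps)
  finally show ?case .
qed simp

text \<open>The indicator is dominated by a Gaussian tail smoothed at variance
  \<open>\<tau>\<close>, to which the replacement argument applies. The rate is weaker than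
  \<open>N^(-1/2)\<close> but shrinks fast enough for a loss of order \<open>n^(1/3)\<close> in the
  code.\<close>

lemma iid_lower_tail_gaussian:
  fixes p g :: "'w::finite \<Rightarrow> real"
  assumes p: "\<And>om. 0 \<le> p om" "sum p UNIV = 1"
    and g: "(\<Sum>om\<in>UNIV. p om * g om) = 0" "(\<Sum>om\<in>UNIV. p om * (g om)\<^sup>2) = V" "0 < V"
    and R: "\<And>om. 0 < p om \<Longrightarrow> \<bar>g om\<bar> \<le> R" "0 \<le> R"
  obtains K where "0 \<le> K"
    "\<And>N y. 1 \<le> N \<Longrightarrow> iid p N (\<lambda>l. of_bool (sum_list (map g l) \<le> - (sqrt (real N * V) * y)))
        \<le> Qfun y + K * (1 + \<bar>y\<bar>) * real N powr (- 1/6)"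
proof -
  define A where "A = (R^3 + 2 * V\<^sup>2) * (2 * (1 + V) / V)"
  have A0: "0 \<le> A" using R g by (auto simp: A_def)
  define K where "K = 1 / V + 1 / sqrt V + A + 1"
  have K0: "0 \<le> K" using A0 g by (auto simp: K_def)
  show thesis
  proof (rule that[OF K0])
    fix N :: nat and y :: real assume N: "1 \<le> N"
    let ?n = "real N"
    have n1: "?n \<ge> 1" using N by simp
    \<comment> \<open>\<open>\<tau>\<close> is the variance of the smoothing noise and
      \<open>t\<close> a safety margin in its standard units. With \<open>\<tau> = N^(1/2)\<close>
      and \<open>t = N^(1/12)\<close>, the noise exceeds the margin with probability at most
      \<open>1 / t^2 = N^(-1/6)\<close>, the replacement error is of order \<open>N^(-1/4)\<close>,
      and the margin displaces the argument by order
      \<open>N^(1/4 + 1/12 - 1/2) = N^(-1/6)\<close>.\<close>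
    define \<tau> where "\<tau> = sqrt ?n"
    define t where "t = ?n powr (1/12)"
    define u where "u = sqrt (?n * V) * y - sqrt \<tau> * t"
    define \<delta> where "\<delta> = ?n powr (- 1/6)"
    have \<tau>: "1 \<le> \<tau>" using n1 by (simp add: \<tau>_def)
    have \<tau>p: "\<tau> = ?n powr (1/2)" using n1 by (simp add: \<tau>_def powr_half_sqrt)
    have s\<tau>: "sqrt \<tau> = ?n powr (1/4)"
      using n1 \<tau> by (simp add: \<tau>p powr_powr flip: powr_half_sqrt)
    have t: "t > 0" using n1 by (simp add: t_def)
    have \<delta>0: "0 \<le> \<delta>" by (simp add: \<delta>_def)
    have t2: "1 / t\<^sup>2 = \<delta>" using n1
      by (simp add: t_def \<delta>_def powr_powr powr_minus field_simps flip: powr_numeral)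
    have pw: "?n powr a \<le> \<delta>" if "a \<le> -1/6" for a using that n1 by (simp add: \<delta>_def powr_mono)
    have "iid p N (\<lambda>l. of_bool (sum_list (map g l) \<le> - (sqrt (?n * V) * y)))
      \<le> iid p N (\<lambda>l. Qfun ((u + sum_list (map g l)) / sqrt \<tau>) + \<delta>)"
    proof (rule texp_mono)
      fix l :: "'w list"
      let ?S = "sum_list (map g l)"
      have "1 - \<delta> \<le> Qfun ((u + ?S) / sqrt \<tau>)" if "?S \<le> - (sqrt (?n * V) * y)"
      proof -
        have "(u + ?S) / sqrt \<tau> \<le> - t" using that \<tau> by (simp add: u_def field_simps)
        then have "Qfun (- t) \<le> Qfun ((u + ?S) / sqrt \<tau>)" by (rule Qfun_antimono)
        then show ?thesis using Qfun_minus[of t] Qfun_le_inverse_square[OF t] t2 by simp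
      qed
      then show "of_bool (?S \<le> - (sqrt (?n * V) * y)) \<le> Qfun ((u + ?S) / sqrt \<tau>) + \<delta>"
        using Qfun_nonneg[of "(u + ?S) / sqrt \<tau>"] \<delta>0 by (auto simp: add_nonneg_nonneg)
    qed (use p in auto)
    also have "\<dots> = iid p N (\<lambda>l. Qfun ((u + sum_list (map g l)) / sqrt \<tau>)) + \<delta>"
      unfolding texp_add by (subst texp_const) (use p in auto)
    also have "iid p N (\<lambda>l. Qfun ((u + sum_list (map g l)) / sqrt \<tau>))
      \<le> Qfun (u / sqrt (\<tau> + ?n * V)) + A * (1 / sqrt \<tau> - 1 / sqrt (\<tau> + ?n * V))"
      by (rule iid_gaussian_smoothing[OF p])
         (use gaussian_replacement_step[OF p g R] \<tau> g(3) in \<open>auto simp: A_def\<close>)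
    also have "1 / sqrt \<tau> - 1 / sqrt (\<tau> + ?n * V) \<le> \<delta>"
    proof -
      have "1 / sqrt \<tau> \<le> \<delta>" unfolding s\<tau> using pw[of "-1/4"] n1 by (simp add: powr_minus field_simps)
      moreover have "0 \<le> 1 / sqrt (\<tau> + ?n * V)" using \<tau> g(3) by simp
      ultimately show ?thesis by linarith
    qed
    also have "Qfun (u / sqrt (\<tau> + ?n * V)) \<le> Qfun y + (\<bar>y\<bar> / V + 1 / sqrt V) * \<delta>"
    proof -
      let ?s = "sqrt (\<tau> + ?n * V)" and ?r = "sqrt (?n * V)"
      have nV: "?n * V > 0" using n1 g(3) by simp
      have sr: "?r \<le> ?s" "?r > 0" "?s > 0" using nV \<tau> by auto
      have e: "u / ?s - y = - y * (1 - ?r / ?s) - sqrt \<tau> * t / ?s"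
        using sr by (simp add: u_def field_simps)
      have "\<bar>u / ?s - y\<bar> \<le> \<bar>- y * (1 - ?r / ?s)\<bar> + \<bar>sqrt \<tau> * t / ?s\<bar>"
        unfolding e by (rule abs_triangle_ineq4)
      also have "\<bar>- y * (1 - ?r / ?s)\<bar> = \<bar>y\<bar> * (1 - ?r / ?s)" using sr by (simp add: abs_mult)
      also have "1 - ?r / ?s \<le> \<delta> / V"
      proof -
        have q: "0 \<le> ?r / ?s" "?r / ?s \<le> 1" using sr by auto
        have "(?r / ?s)\<^sup>2 \<le> ?r / ?s" using q mult_left_mono[of "?r/?s" 1 "?r/?s"] by (simp add: power2_eq_square)
        then have "1 - ?r / ?s \<le> 1 - (?n * V) / (\<tau> + ?n * V)"
          using nV \<tau> by (simp add: power_divide)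
        also have "\<dots> = \<tau> / (\<tau> + ?n * V)" using nV \<tau> by (simp add: field_simps)
        also have "\<dots> \<le> \<tau> / (?n * V)" using nV \<tau> by (intro divide_left_mono) auto
        also have "\<dots> = ?n powr (-1/2) / V"
          using n1 powr_diff[of ?n "1/2" 1] by (simp add: \<tau>p)
        also have "\<dots> \<le> \<delta> / V" using pw[of "-1/2"] g(3) by (simp add: divide_right_mono)
        finally show ?thesis .
      qed
      also have "\<bar>sqrt \<tau> * t / ?s\<bar> \<le> \<delta> / sqrt V"
      proof -
        have "\<bar>sqrt \<tau> * t / ?s\<bar> = sqrt \<tau> * t / ?s" using t \<tau> sr by simp
        also have "\<dots> \<le> sqrt \<tau> * t / ?r" using t \<tau> sr by (intro divide_left_mono) auto
        also have "\<dots> = ?n powr (1/4) * ?n powr (1/12) / ?n powr (1/2) / sqrt V"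
          using n1 by (simp add: s\<tau> t_def real_sqrt_mult powr_half_sqrt)
        also have "\<dots> = \<delta> / sqrt V"
          by (simp add: \<delta>_def flip: powr_add powr_diff)
        finally show ?thesis .
      qed
      finally have "\<bar>u / ?s - y\<bar> \<le> \<bar>y\<bar> * (\<delta> / V) + \<delta> / sqrt V" by (simp add: mult_left_mono)
      then show ?thesis using Qfun_lipschitz[of "u / ?s" y] by (simp add: algebra_simps)
    qed
    finally have "iid p N (\<lambda>l. of_bool (sum_list (map g l) \<le> - (sqrt (?n * V) * y)))
       \<le> Qfun y + (\<bar>y\<bar> / V + 1 / sqrt V) * \<delta> + A * \<delta> + \<delta>" using A0 by (simp add: mult_left_mono)
    also have "\<dots> = Qfun y + (\<bar>y\<bar> / V + 1 / sqrt V + A + 1) * \<delta>" by (simp add: algebra_simps)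
    also have "\<dots> \<le> Qfun y + (K * (1 + \<bar>y\<bar>)) * \<delta>"
    proof -
      have "0 \<le> (1 / sqrt V + A + 1) * \<bar>y\<bar> + 1 / V" using A0 g(3) by simp
      then have "\<bar>y\<bar> / V + 1 / sqrt V + A + 1 \<le> K * (1 + \<bar>y\<bar>)"
        unfolding K_def by (simp add: algebra_simps add_divide_distrib)
      then show ?thesis using \<delta>0 by (simp add: mult_right_mono)
    qed
    finally show "iid p N (\<lambda>l. of_bool (sum_list (map g l) \<le> - (sqrt (?n * V) * y)))
        \<le> Qfun y + K * (1 + \<bar>y\<bar>) * ?n powr (- 1/6)" by (simp add: \<delta>_def)
  qed
qed

section \<open>Projection and change of measure for tree expectations, sums over lists\<close>

lemma texp_sum: "texp \<kappa> n (\<lambda>l. \<Sum>j\<in>J. F j l) = (\<Sum>j\<in>J. texp \<kappa> n (F j))"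
proof (induction n arbitrary: F)
  case (Suc n)
  have "(\<lambda>l. \<Sum>om\<in>UNIV. \<kappa> l om * (\<Sum>j\<in>J. F j (l @ [om])))
      = (\<lambda>l. \<Sum>j\<in>J. \<Sum>om\<in>UNIV. \<kappa> l om * F j (l @ [om]))"
    unfolding sum_distrib_left by (rule ext, rule sum.swap)
  then show ?case using Suc by simp
qed simp

text \<open>If the projected next letter has law \<open>q\<close> whatever the history, the
  projected list is i.i.d. even though the full process is not. Under the changed measure of the
  converse this makes feedback disappear from one user's output.\<close>

lemma texp_map:
  assumes "\<And>l G. length l < n \<Longrightarrow> (\<Sum>om\<in>UNIV. \<kappa> l om * G (\<pi> om)) = (\<Sum>y\<in>UNIV. q y * G y)"
  shows "texp \<kappa> n (\<lambda>l. G (map \<pi> l)) = iid q n G"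
  using assms
proof (induction n arbitrary: G)
  case (Suc n)
  have "texp \<kappa> (Suc n) (\<lambda>l. G (map \<pi> l)) = texp \<kappa> n (\<lambda>l. \<Sum>y\<in>UNIV. q y * G (map \<pi> l @ [y]))"
    by (simp, rule texp_cong) (simp add: Suc.prems[where G = "\<lambda>y. G (map \<pi> _ @ [y])"])
  also have "\<dots> = iid q (Suc n) G"
    using Suc.IH[of "\<lambda>l. \<Sum>y\<in>UNIV. q y * G (l @ [y])"] Suc.prems by simp
  finally show ?case .
qed simp

lemma texp_change_of_measure:
  assumes "\<And>l om. length l < n \<Longrightarrow> \<kappa> l om = \<rho> om * \<kappa>' l om"
  shows "texp \<kappa> n F = texp \<kappa>' n (\<lambda>l. prod_list (map \<rho> l) * F l)"
  using assms
proof (induction n arbitrary: F)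
  case (Suc n)
  have "texp \<kappa> (Suc n) F = texp \<kappa>' n (\<lambda>l. prod_list (map \<rho> l) * (\<Sum>om\<in>UNIV. \<kappa> l om * F (l @ [om])))"
    using Suc by simp
  also have "\<dots> = texp \<kappa>' (Suc n) (\<lambda>l. prod_list (map \<rho> l) * F l)"
    unfolding texp.simps
    by (rule texp_cong) (simp add: Suc.prems sum_distrib_left mult_ac)
  finally show ?case .
qed simp

lemma prod_list_map_pos:
  "(\<And>om. om \<in> set l \<Longrightarrow> (0::real) < \<rho> om) \<Longrightarrow> 0 < prod_list (map \<rho> l)"
  by (induction l) auto

lemma ln_prod_list:
  assumes "\<And>om. om \<in> set l \<Longrightarrow> 0 < \<rho> om"
  shows "ln (prod_list (map \<rho> l)) = (\<Sum>om\<leftarrow>l. ln (\<rho> om :: real))"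
  using assms
proof (induction l)
  case (Cons a l)
  have "0 < \<rho> a" using Cons.prems by simp
  moreover have "0 < prod_list (map \<rho> l)" using Cons.prems by (intro prod_list_map_pos) auto
  ultimately have "ln (\<rho> a * prod_list (map \<rho> l)) = ln (\<rho> a) + ln (prod_list (map \<rho> l))"
    by (rule ln_mult_pos)
  then show ?case using Cons by simp
qed simp

lemma sum_triple: "(\<Sum>om\<in>UNIV. h om) = (\<Sum>x\<in>UNIV. \<Sum>y\<in>UNIV. \<Sum>z\<in>UNIV. h (x::'a::finite, y::'b::finite, z::'c::finite))"
  by (simp add: UNIV_Times_UNIV[symmetric] sum.cartesian_product split_def del: UNIV_Times_UNIV)

lemma finite_lists_length [simp]: "finite {a :: 'a::finite list. length a = n}"
  using finite_lists_length_eq[of "UNIV :: 'a set" n] by simp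

lemma sum_lists_Suc:
  "(\<Sum>a | length a = Suc n. F a) = (\<Sum>a | length a = n. \<Sum>y\<in>UNIV. F (a @ [y :: 'y::finite]))"
proof -
  have "bij_betw (\<lambda>(a, y). a @ [y]) ({a. length a = n} \<times> UNIV) {a :: 'y list. length a = Suc n}"
  proof (rule bij_betwI')
    fix b :: "'y list" assume "b \<in> {a. length a = Suc n}"
    then show "\<exists>p\<in>{a. length a = n} \<times> UNIV. b = (case p of (a, y) \<Rightarrow> a @ [y])"
      by (intro bexI[of _ "(butlast b, last b)"])
         (auto intro: append_butlast_last_id[symmetric])
  qed auto
  from sum.reindex_bij_betw[OF this, of F] show ?thesis
    by (simp add: sum.cartesian_product split_def)
qed

section \<open>Mutual information\<close>

lemma stochasticD: "stochastic W \<Longrightarrow> 0 \<le> W x y" "stochastic W \<Longrightarrow> (\<Sum>y\<in>UNIV. W x y) = 1"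
  by (auto simp: stochastic_def)

lemma kl_row_sum: "kl_row W x Q = (\<Sum>y\<in>UNIV. W x y * ln (W x y / Q y))"
  unfolding kl_row_def by (rule sum.mono_neutral_left) auto

lemma outdist_nonneg: "stochastic W \<Longrightarrow> (\<And>x. 0 \<le> P x) \<Longrightarrow> 0 \<le> outdist P W y"
  unfolding outdist_def by (intro sum_nonneg mult_nonneg_nonneg) (auto simp: stochasticD)

lemma outdist_ge: assumes "stochastic W" "\<And>x. 0 \<le> P x" shows "P x * W x y \<le> outdist P W y"
  unfolding outdist_def using assms(2) stochasticD(1)[OF assms(1)]
  by (intro member_le_sum[of x UNIV "\<lambda>x. P x * W x y"]) (auto intro!: mult_nonneg_nonneg)

lemma outdist_pos: assumes "stochastic W" "\<And>x. 0 \<le> P x" "0 < P x" "0 < W x y" shows "0 < outdist P W y"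
proof -
  have "P x * W x y \<le> outdist P W y" by (rule outdist_ge) (use assms in auto)
  then show ?thesis using mult_pos_pos[OF assms(3,4)] by linarith
qed

lemma outdist_pos_full:
  assumes "stochastic W" "\<And>x. 0 < P x" "0 < W x y" shows "0 < outdist P W y"
  by (rule outdist_pos[where P = P and x = x]) (use assms in \<open>auto intro: less_imp_le\<close>)

lemma sum_outdist: assumes "stochastic W" shows "(\<Sum>y\<in>UNIV. outdist P W y) = sum P UNIV"
  unfolding outdist_def by (subst sum.swap) (simp add: stochasticD(2)[OF assms] flip: sum_distrib_left)

lemma prob_simplexD: "P \<in> prob_simplex \<Longrightarrow> 0 \<le> P x" "P \<in> prob_simplex \<Longrightarrow> sum P UNIV = 1"
  by (auto simp: prob_simplex_def)

text \<open>The compensation identity: measuring against \<open>Q\<close> instead of the true output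
  law costs exactly the divergence between the two. Positivity of \<open>Q\<close> is asked only
  where \<open>P\<close> and \<open>W\<close> both have mass.\<close>

lemma cross_minus_mutinf:
  assumes W: "stochastic W" and P: "\<And>x. 0 \<le> P x" and Q: "\<And>x y. 0 < P x \<Longrightarrow> 0 < W x y \<Longrightarrow> 0 < Q y"
  shows "(\<Sum>x\<in>UNIV. P x * kl_row W x Q) - mutinf P W = (\<Sum>y\<in>UNIV. outdist P W y * ln (outdist P W y / Q y))"
proof -
  let ?O = "outdist P W"
  have "(\<Sum>x\<in>UNIV. P x * kl_row W x Q) - mutinf P W
    = (\<Sum>x\<in>UNIV. \<Sum>y\<in>UNIV. P x * (W x y * ln (W x y / Q y)) - P x * (W x y * ln (W x y / ?O y)))"
    by (simp only: mutinf_def kl_row_sum sum_distrib_left sum_subtractf)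
  also have "\<dots> = (\<Sum>x\<in>UNIV. \<Sum>y\<in>UNIV. P x * W x y * ln (?O y / Q y))"
  proof (rule sum.cong[OF refl], rule sum.cong[OF refl])
    fix x y
    show "P x * (W x y * ln (W x y / Q y)) - P x * (W x y * ln (W x y / ?O y)) = P x * W x y * ln (?O y / Q y)"
    proof (cases "P x * W x y = 0")
      case False
      then have p: "0 < P x" "0 < W x y" using P[of x] stochasticD(1)[OF W, of x y] by (auto simp: less_le)
      have "0 < ?O y" by (rule outdist_pos[where P = P and x = x]) (use W P p in auto)
      then show ?thesis using p Q[OF p] by (simp add: ln_div algebra_simps)
    qed auto
  qed
  also have "\<dots> = (\<Sum>y\<in>UNIV. ?O y * ln (?O y / Q y))"
    by (subst sum.swap) (unfold outdist_def sum_distrib_right, rule refl)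
  finally show ?thesis .
qed

lemma mutinf_le_cross:
  assumes W: "stochastic W" and P: "P \<in> prob_simplex"
    and Q: "\<And>y. 0 \<le> Q y" "sum Q UNIV \<le> 1" "\<And>x y. 0 < P x \<Longrightarrow> 0 < W x y \<Longrightarrow> 0 < Q y"
  shows "mutinf P W \<le> (\<Sum>x\<in>UNIV. P x * kl_row W x Q)"
proof -
  let ?O = "outdist P W"
  have "0 \<le> (\<Sum>y\<in>UNIV. ?O y - Q y)"
    using Q(2) sum_outdist[OF W, of P] prob_simplexD(2)[OF P] by (simp add: sum_subtractf)
  also have "\<dots> \<le> (\<Sum>y\<in>UNIV. ?O y * ln (?O y / Q y))"
  proof (rule sum_mono)
    fix y
    show "?O y - Q y \<le> ?O y * ln (?O y / Q y)"
    proof (cases "?O y = 0")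
      case False
      moreover have "0 \<le> ?O y" by (rule outdist_nonneg) (use W prob_simplexD(1)[OF P] in auto)
      ultimately have O: "0 < ?O y" by simp
      obtain x where "P x * W x y \<noteq> 0"
        using False sum.neutral[of UNIV "\<lambda>x. P x * W x y"] unfolding outdist_def by blast
      then have q: "0 < Q y"
        using prob_simplexD(1)[OF P, of x] stochasticD(1)[OF W, of x y] by (intro Q(3)[of x]) (auto simp: less_le)
      have "?O y * ln (Q y / ?O y) \<le> ?O y * (Q y / ?O y - 1)" using O q by (intro mult_left_mono ln_le_minus_one) auto
      then show ?thesis using O q by (simp add: ln_div algebra_simps)
    qed (use Q(1)[of y] in simp)
  qed
  also have "\<dots> = (\<Sum>x\<in>UNIV. P x * kl_row W x Q) - mutinf P W"
    by (rule cross_minus_mutinf[symmetric]) (use W prob_simplexD(1)[OF P] Q in auto)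
  finally show ?thesis by simp
qed

text \<open>The output law of the mixture serves as common reference: it overestimates the
  information at \<open>P\<close> and \<open>R\<close> and is exact at \<open>S\<close>. With
  \<open>t\<close> strictly inside the unit interval, the supports of \<open>P\<close> and
  \<open>R\<close> are covered by that of \<open>S\<close>.\<close>

lemma mutinf_concave:
  assumes W: "stochastic W" and P: "P \<in> prob_simplex" and R: "R \<in> prob_simplex" and t: "0 < t" "t < 1"
  defines "S \<equiv> \<lambda>x. (1 - t) * P x + t * R x"
  shows "S \<in> prob_simplex" "(1 - t) * mutinf P W + t * mutinf R W \<le> mutinf S W"
proof -
  have S0: "0 \<le> S x" for x using t prob_simplexD(1)[OF P, of x] prob_simplexD(1)[OF R, of x] by (auto simp: S_def)
  have "sum S UNIV = 1" using prob_simplexD(2)[OF P] prob_simplexD(2)[OF R]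
    by (simp add: S_def sum.distrib flip: sum_distrib_left)
  with S0 show S: "S \<in> prob_simplex" by (auto simp: prob_simplex_def)
  have *: "mutinf T W \<le> (\<Sum>x\<in>UNIV. T x * kl_row W x (outdist S W))"
    if T: "T \<in> prob_simplex" "\<And>x. 0 < T x \<Longrightarrow> 0 < S x" for T
  proof (rule mutinf_le_cross[OF W T(1)])
    show "sum (outdist S W) UNIV \<le> 1" using sum_outdist[OF W, of S] prob_simplexD(2)[OF S] by simp
    show "0 < outdist S W y" if "0 < T x" "0 < W x y" for x y
      by (rule outdist_pos[where P = S and x = x]) (use W S0 T that in auto)
    show "0 \<le> outdist S W y" for y by (rule outdist_nonneg) (use W S0 in auto)
  qed
  have P': "0 < P x \<Longrightarrow> 0 < S x" and R': "0 < R x \<Longrightarrow> 0 < S x" for x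
    using t prob_simplexD(1)[OF P, of x] prob_simplexD(1)[OF R, of x]
    by (auto simp: S_def intro: add_pos_nonneg add_nonneg_pos)
  have "(1 - t) * mutinf P W + t * mutinf R W \<le> (1 - t) * (\<Sum>x\<in>UNIV. P x * kl_row W x (outdist S W))
     + t * (\<Sum>x\<in>UNIV. R x * kl_row W x (outdist S W))"
    using *[OF P P'] *[OF R R'] t by (intro add_mono mult_left_mono) auto
  also have "\<dots> = (\<Sum>x\<in>UNIV. S x * kl_row W x (outdist S W))"
    unfolding sum_distrib_left sum.distrib[symmetric]
    by (intro sum.cong refl) (simp add: S_def distrib_right mult.assoc)
  also have "\<dots> = mutinf S W" by (simp add: mutinf_def)
  finally show "(1 - t) * mutinf P W + t * mutinf R W \<le> mutinf S W" .
qed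

text \<open>The gap between the tangent at \<open>P\<close> and the information at the tilted law is
  the divergence of the two output laws. It is at most their chi-square distance, which is
  \<open>K * s^2\<close>; the linear terms vanish because \<open>v\<close> sums to zero.\<close>

lemma mutinf_quadratic:
  assumes W: "stochastic W" and P: "P \<in> prob_simplex" "\<And>x. 0 < P x" and v: "sum v UNIV = 0"
  obtains K where "0 \<le> K" "\<And>s. (\<And>x. 0 < P x + s * v x) \<Longrightarrow>
     mutinf P W + s * dI W P v - K * s\<^sup>2 \<le> mutinf (\<lambda>x. P x + s * v x) W"
proof -
  let ?O = "outdist P W" and ?d = "outdist v W"
  define K where "K = (\<Sum>y\<in>UNIV. (?d y)\<^sup>2 / ?O y)"
  have O0: "0 \<le> ?O y" for y by (rule outdist_nonneg) (use W P in \<open>auto intro: less_imp_le\<close>)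
  show thesis
  proof (rule that)
    show "0 \<le> K" unfolding K_def by (intro sum_nonneg divide_nonneg_nonneg) (auto simp: O0)
    fix s assume s: "\<And>x. 0 < P x + s * v x"
    let ?S = "\<lambda>x. P x + s * v x"
    have od: "outdist ?S W y = ?O y + s * ?d y" for y
      by (simp add: outdist_def sum_distrib_left distrib_right sum.distrib mult.assoc)
    have "mutinf P W + s * dI W P v = (\<Sum>x\<in>UNIV. ?S x * kl_row W x ?O)"
      unfolding mutinf_def dI_def sum_distrib_left sum.distrib[symmetric]
      by (intro sum.cong refl) (simp add: distrib_right mult.assoc)
    then have "mutinf P W + s * dI W P v - mutinf ?S W = (\<Sum>y\<in>UNIV. outdist ?S W y * ln (outdist ?S W y / ?O y))"
      using cross_minus_mutinf[of W ?S ?O, OF W less_imp_le[OF s] outdist_pos_full[OF W P(2)]] by simp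
    also have "\<dots> \<le> (\<Sum>y\<in>UNIV. s * ?d y + s\<^sup>2 * ((?d y)\<^sup>2 / ?O y))"
    proof (rule sum_mono)
      fix y
      show "outdist ?S W y * ln (outdist ?S W y / ?O y) \<le> s * ?d y + s\<^sup>2 * ((?d y)\<^sup>2 / ?O y)"
      proof (cases "\<exists>x. W x y \<noteq> 0")
        case True
        then obtain x where w: "0 < W x y" using stochasticD(1)[OF W] by (metis less_le)
        have o: "0 < ?O y" by (rule outdist_pos_full[OF W P(2) w])
        have o': "0 < outdist ?S W y" by (rule outdist_pos_full[OF W s w])
        have "outdist ?S W y * ln (outdist ?S W y / ?O y) \<le> outdist ?S W y * (outdist ?S W y / ?O y - 1)"
          using o o' by (intro mult_left_mono ln_le_minus_one) auto
        also have "\<dots> = s * ?d y + s\<^sup>2 * ((?d y)\<^sup>2 / ?O y)"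
        proof -
          have "(a + s * b) * ((a + s * b) / a - 1) = s * b + s\<^sup>2 * (b\<^sup>2 / a)" if "0 < a" for a b :: real
            using that by (simp add: field_simps power2_eq_square)
          from this[OF o] show ?thesis unfolding od .
        qed
        finally show ?thesis .
      qed (simp add: outdist_def)
    qed
    also have "\<dots> = s\<^sup>2 * K"
      unfolding sum.distrib sum_distrib_left[symmetric] sum_outdist[OF W] v K_def by simp
    finally show "mutinf P W + s * dI W P v - K * s\<^sup>2 \<le> mutinf ?S W" by (simp add: mult.commute)
  qed
qed

lemma mutinf_bdd_above:
  assumes W: "stochastic W" and P: "P \<in> prob_simplex" "\<And>x. 0 < P x" and R: "R \<in> prob_simplex"
  shows "mutinf R W \<le> (\<Sum>x\<in>UNIV. R x * kl_row W x (outdist P W))"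
proof (rule mutinf_le_cross[OF W R])
  show "sum (outdist P W) UNIV \<le> 1" using sum_outdist[OF W, of P] prob_simplexD(2)[OF P(1)] by simp
  show "0 < outdist P W y" if "0 < W x y" for x y
    by (rule outdist_pos[where P = P and x = x]) (use W P that in \<open>auto intro: less_imp_le\<close>)
  show "0 \<le> outdist P W y" for y by (rule outdist_nonneg) (use W P in \<open>auto intro: less_imp_le\<close>)
qed

lemma sum_weighted_le_Max:
  assumes "R \<in> prob_simplex" shows "(\<Sum>x\<in>UNIV. R x * h x) \<le> Max (range h)"
proof -
  have "(\<Sum>x\<in>UNIV. R x * h x) \<le> (\<Sum>x\<in>UNIV. R x * Max (range h))"
    using prob_simplexD(1)[OF assms] by (intro sum_mono mult_left_mono) auto
  then show ?thesis using prob_simplexD(2)[OF assms] by (simp flip: sum_distrib_right)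
qed

text \<open>\<open>SUP\<close> over the reals bounds its members only if the set is bounded. Here
  the cross information relative to the output law of a fully supported \<open>P\<close> provides
  the bound.\<close>

lemma common_cap_upper:
  fixes P :: "'x::finite \<Rightarrow> real" and W1 W2 :: "'x \<Rightarrow> 'y::finite \<Rightarrow> real"
  assumes W: "stochastic W1" and P: "P \<in> prob_simplex" "\<And>x. 0 < P x" and R: "R \<in> prob_simplex"
  shows "min (mutinf R W1) (mutinf R W2) \<le> common_cap W1 W2"
  unfolding common_cap_def
proof (rule cSUP_upper[OF R])
  show "bdd_above ((\<lambda>P. min (mutinf P W1) (mutinf P W2)) ` prob_simplex)"
  proof (rule bdd_aboveI2)
    fix S :: "'x \<Rightarrow> real" assume S: "S \<in> prob_simplex"
    have "mutinf S W1 \<le> Max (range (\<lambda>x. kl_row W1 x (outdist P W1)))"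
      using mutinf_bdd_above[OF W P S] sum_weighted_le_Max[OF S, of "\<lambda>x. kl_row W1 x (outdist P W1)"] by simp
    then show "min (mutinf S W1) (mutinf S W2) \<le> Max (range (\<lambda>x. kl_row W1 x (outdist P W1)))" by simp
  qed
qed

lemma exceeds_of_capacity_gt:
  fixes P :: "'x::finite \<Rightarrow> real" and W :: "'x \<Rightarrow> 'y::finite \<Rightarrow> real"
  assumes "capacity W > c" and "P \<in> prob_simplex"
  obtains R where "R \<in> prob_simplex" "mutinf R W > c"
proof -
  have "\<exists>R\<in>prob_simplex. \<not> mutinf R W \<le> c"
  proof (rule ccontr)
    assume "\<not> ?thesis"
    then have "capacity W \<le> c" unfolding capacity_def using assms(2) by (intro cSUP_least) auto
    then show False using assms(1) by simp
  qed
  then show thesis using that by fastforce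
qed

lemma common_cap_commute: "common_cap W1 W2 = common_cap W2 W1"
  by (simp add: common_cap_def min.commute)

text \<open>If user 1 had slack at the optimum, moving slightly towards an input that is good for
  user 2 would raise the minimum.\<close>
lemma mutinf_opt_eq:
  assumes W: "stochastic W1" "stochastic W2" and P: "P \<in> prob_simplex" "\<And>x. 0 < P x"
    and m: "min (mutinf P W1) (mutinf P W2) = common_cap W1 W2" and C: "capacity W2 > common_cap W1 W2"
  shows "mutinf P W1 = common_cap W1 W2"
proof (rule ccontr)
  let ?C = "common_cap W1 W2"
  assume ne: "mutinf P W1 \<noteq> ?C"
  then have g: "mutinf P W1 > ?C" "mutinf P W2 = ?C" using m by (auto simp: min_def split: if_splits)
  obtain R where R: "R \<in> prob_simplex" "mutinf R W2 > ?C" by (rule exceeds_of_capacity_gt[OF C P(1)])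
  define b where "b = mutinf P W1 - ?C"
  define r where "r = \<bar>mutinf R W1 - mutinf P W1\<bar>"
  \<comment> \<open>Small enough that user 1 gives up at most half of its slack \<open>b\<close>;
    the \<open>+ 1\<close> guards against \<open>r = 0\<close>.\<close>
  define t where "t = min (1/2) (b / (2 * (r + 1)))"
  have b: "b > 0" and r: "r \<ge> 0" using g by (auto simp: b_def r_def)
  then have t: "0 < t" "t < 1" by (auto simp: t_def)
  have "t * r \<le> b / 2"
  proof -
    have "t * r \<le> (b / (2 * (r + 1))) * (r + 1)" using r b t by (intro mult_mono) (auto simp: t_def)
    also have "\<dots> = b / 2" using r by (simp add: field_simps)
    finally show ?thesis .
  qed
  define S where "S = (\<lambda>x. (1 - t) * P x + t * R x)"
  note c1 = mutinf_concave[OF W(1) P(1) R(1) t, folded S_def]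
  note c2 = mutinf_concave[OF W(2) P(1) R(1) t, folded S_def]
  have "(1 - t) * mutinf P W1 + t * mutinf R W1 = mutinf P W1 + t * (mutinf R W1 - mutinf P W1)"
    by (simp add: algebra_simps)
  moreover have "t * (mutinf R W1 - mutinf P W1) \<ge> - (t * r)"
    using t mult_left_mono[of "-r" "mutinf R W1 - mutinf P W1" t] by (simp add: r_def)
  ultimately have 1: "mutinf S W1 > ?C" using c1(2) \<open>t * r \<le> b / 2\<close> b by (simp add: b_def)
  have "t * mutinf R W2 > t * ?C" using R t by simp
  moreover have "(1 - t) * ?C + t * ?C = ?C" by (simp add: algebra_simps)
  ultimately have "mutinf S W2 > ?C" using c2(2) unfolding g by linarith
  with 1 show False using common_cap_upper[OF W(1) P c1(1), of W2] by simp
qed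

text \<open>If every derivative vanished, then so would the one towards an input law
  \<open>R\<close> better than \<open>P\<close>; but the tangent at \<open>P\<close> lies above
  mutual information, so \<open>R\<close> could not be better.\<close>

lemma dI_nonzero:
  assumes W: "stochastic W" and P: "P \<in> prob_simplex" "\<And>x. 0 < P x" and C: "capacity W > mutinf P W"
  obtains v where "sum v UNIV = 0" "dI W P v \<noteq> 0"
proof (rule ccontr)
  assume a: "\<not> thesis"
  obtain R where R: "R \<in> prob_simplex" "mutinf R W > mutinf P W" by (rule exceeds_of_capacity_gt[OF C P(1)])
  have "sum (\<lambda>x. R x - P x) UNIV = 0"
    using prob_simplexD(2)[OF P(1)] prob_simplexD(2)[OF R(1)] by (simp add: sum_subtractf)
  then have "dI W P (\<lambda>x. R x - P x) = 0" using that[of "\<lambda>x. R x - P x"] a by fast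
  then have "(\<Sum>x\<in>UNIV. R x * kl_row W x (outdist P W)) = mutinf P W"
    by (simp add: dI_def mutinf_def left_diff_distrib sum_subtractf)
  then show False using mutinf_bdd_above[OF W P R(1)] R(2) by simp
qed

section \<open>Converse\<close>

definition lratio :: "('x::finite \<Rightarrow> real) \<Rightarrow> ('x \<Rightarrow> 'y \<Rightarrow> real) \<Rightarrow> 'x \<Rightarrow> 'y \<Rightarrow> real" where
  "lratio P W x y = W x y / outdist P W y"

lemma ln_lratio: "ln (lratio P W x y) = info_dens P W x y"
  by (simp add: lratio_def info_dens_def)

lemma lratio_pos:
  assumes "stochastic W" "\<And>x. 0 < P x" "0 < W x y" shows "0 < lratio P W x y"
  using outdist_pos_full[where P = P, OF assms] assms(3) by (simp add: lratio_def)

lemma lratio_mult_outdist: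
  assumes "stochastic W" "\<And>x. 0 < P x" shows "lratio P W x y * outdist P W y = W x y"
proof (cases "W x y = 0")
  case False
  then have "0 < W x y" using stochasticD(1)[OF assms(1), of x y] by simp
  from outdist_pos_full[where P = P, OF assms this] show ?thesis by (simp add: lratio_def)
qed (simp add: lratio_def)

lemma lratio_nonneg: "stochastic W \<Longrightarrow> (\<And>x. 0 \<le> P x) \<Longrightarrow> 0 \<le> lratio P W x y"
  by (simp add: lratio_def stochasticD outdist_nonneg)

type_synonym ('x, 'y) triple = "'x \<times> 'y \<times> 'y"

abbreviation out1 :: "('x, 'y) triple \<Rightarrow> 'y" where "out1 om \<equiv> fst (snd om)"
abbreviation out2 :: "('x, 'y) triple \<Rightarrow> 'y" where "out2 om \<equiv> snd (snd om)"

definition triple_dist :: "('x \<Rightarrow> 'y \<Rightarrow> real) \<Rightarrow> ('x \<Rightarrow> 'y \<Rightarrow> real) \<Rightarrow> ('x \<Rightarrow> real) \<Rightarrow> ('x, 'y) triple \<Rightarrow> real" where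
  "triple_dist W1 W2 P om = P (fst om) * W1 (fst om) (out1 om) * W2 (fst om) (out2 om)"

lemma triple_dist_nonneg:
  assumes "stochastic W1" "stochastic W2" "\<And>x. 0 \<le> Q x" shows "0 \<le> triple_dist W1 W2 Q om"
  using assms by (simp add: triple_dist_def stochasticD)

lemma sum_triple_dist:
  assumes "stochastic W1" "stochastic W2"
  shows "(\<Sum>om\<in>UNIV. triple_dist W1 W2 Q om * G (fst om) (out1 om)) = (\<Sum>x\<in>UNIV. Q x * (\<Sum>y\<in>UNIV. W1 x y * G x y))"
    "(\<Sum>om\<in>UNIV. triple_dist W1 W2 Q om * G (fst om) (out2 om)) = (\<Sum>x\<in>UNIV. Q x * (\<Sum>y\<in>UNIV. W2 x y * G x y))"
proof -
  have "(\<Sum>om\<in>UNIV. triple_dist W1 W2 Q om * G (fst om) (out1 om))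
     = (\<Sum>x\<in>UNIV. Q x * (\<Sum>y\<in>UNIV. W1 x y * G x y * (\<Sum>z\<in>UNIV. W2 x z)))"
    unfolding sum_triple triple_dist_def sum_distrib_left by (intro sum.cong refl) (simp add: mult_ac)
  then show "(\<Sum>om\<in>UNIV. triple_dist W1 W2 Q om * G (fst om) (out1 om)) = (\<Sum>x\<in>UNIV. Q x * (\<Sum>y\<in>UNIV. W1 x y * G x y))"
    by (simp add: stochasticD(2)[OF assms(2)])
  have "(\<Sum>om\<in>UNIV. triple_dist W1 W2 Q om * G (fst om) (out2 om))
     = (\<Sum>x\<in>UNIV. Q x * (\<Sum>y\<in>UNIV. W1 x y * (\<Sum>z\<in>UNIV. W2 x z * G x z)))"
    unfolding sum_triple triple_dist_def sum_distrib_left by (intro sum.cong refl) (simp add: mult_ac)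
  then show "(\<Sum>om\<in>UNIV. triple_dist W1 W2 Q om * G (fst om) (out2 om)) = (\<Sum>x\<in>UNIV. Q x * (\<Sum>y\<in>UNIV. W2 x y * G x y))"
    by (simp add: stochasticD(2)[OF assms(1)] flip: sum_distrib_right)
qed

text \<open>The input letter is recorded in the history because information densities depend on it
  and the encoder may be randomised; the encoder's law nevertheless reads only the past
  outputs.\<close>

definition code_kernel :: "('x::finite \<Rightarrow> 'y::finite \<Rightarrow> real) \<Rightarrow> ('x \<Rightarrow> 'y \<Rightarrow> real) \<Rightarrow>
   (nat \<Rightarrow> nat \<Rightarrow> 'y list \<Rightarrow> 'y list \<Rightarrow> 'x \<Rightarrow> real) \<Rightarrow> nat \<Rightarrow> ('x, 'y) triple list \<Rightarrow> ('x, 'y) triple \<Rightarrow> real" where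
  "code_kernel W1 W2 f j l = triple_dist W1 W2 (f (length l) j (map out1 l) (map out2 l))"

lemma sum_code_kernel:
  assumes "stochastic W1" "stochastic W2" "(\<Sum>x\<in>UNIV. f (length l) j (map out1 l) (map out2 l) x) = 1"
  shows "(\<Sum>om\<in>UNIV. code_kernel W1 W2 f j l om) = 1"
  using sum_triple_dist(1)[OF assms(1,2), of _ "\<lambda>_ _. 1"] assms(3)
  by (simp add: code_kernel_def stochasticD(2)[OF assms(1)])

lemma joint_prob_snoc:
  assumes "length a = n" "length b = n"
  shows "joint_prob W1 W2 (Suc n) f j (a @ [y]) (b @ [z])
    = joint_prob W1 W2 n f j a b * (\<Sum>x\<in>UNIV. f n j a b x * W1 x y * W2 x z)"
  using assms unfolding joint_prob_def by (simp add: nth_append)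

text \<open>Since the encoder does not look at past inputs, the inputs can be summed out position by
  position, which gives the product form of \<open>joint_prob\<close>. This links the tree
  expectations to the error probability of a code.\<close>

lemma texp_code_kernel:
  "texp (code_kernel W1 W2 f j) n (\<lambda>l. G (map out1 l) (map out2 l))
    = (\<Sum>a | length a = n. \<Sum>b | length b = n. joint_prob W1 W2 n f j a b * G a b)"
proof (induction n arbitrary: G)
  case 0
  have "{a :: 'b list. a = []} = {[]}" by auto
  then show ?case by (simp add: joint_prob_def)
next
  case (Suc n)
  let ?k = "\<lambda>a b x y z. f n j a b x * W1 x y * W2 x z"
  have "texp (code_kernel W1 W2 f j) (Suc n) (\<lambda>l. G (map out1 l) (map out2 l))
    = texp (code_kernel W1 W2 f j) n (\<lambda>l. \<Sum>y\<in>UNIV. \<Sum>z\<in>UNIV. (\<Sum>x\<in>UNIV. ?k (map out1 l) (map out2 l) x y z) * G (map out1 l @ [y]) (map out2 l @ [z]))"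
    unfolding texp.simps
  proof (rule texp_cong)
    fix l :: "('a, 'b) triple list" assume l: "length l = n"
    have "(\<Sum>om\<in>UNIV. code_kernel W1 W2 f j l om * G (map out1 (l @ [om])) (map out2 (l @ [om])))
       = (\<Sum>x\<in>UNIV. \<Sum>y\<in>UNIV. \<Sum>z\<in>UNIV. ?k (map out1 l) (map out2 l) x y z * G (map out1 l @ [y]) (map out2 l @ [z]))"
      by (simp add: sum_triple code_kernel_def triple_dist_def l)
    also have "\<dots> = (\<Sum>y\<in>UNIV. \<Sum>x\<in>UNIV. \<Sum>z\<in>UNIV. ?k (map out1 l) (map out2 l) x y z * G (map out1 l @ [y]) (map out2 l @ [z]))"
      by (rule sum.swap)
    also have "\<dots> = (\<Sum>y\<in>UNIV. \<Sum>z\<in>UNIV. \<Sum>x\<in>UNIV. ?k (map out1 l) (map out2 l) x y z * G (map out1 l @ [y]) (map out2 l @ [z]))"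
      by (intro sum.cong refl sum.swap)
    finally show "(\<Sum>om\<in>UNIV. code_kernel W1 W2 f j l om * G (map out1 (l @ [om])) (map out2 (l @ [om])))
       = (\<Sum>y\<in>UNIV. \<Sum>z\<in>UNIV. (\<Sum>x\<in>UNIV. ?k (map out1 l) (map out2 l) x y z) * G (map out1 l @ [y]) (map out2 l @ [z]))"
      by (simp add: sum_distrib_right)
  qed
  also have "\<dots> = (\<Sum>a | length a = n. \<Sum>b | length b = n. joint_prob W1 W2 n f j a b *
      (\<Sum>y\<in>UNIV. \<Sum>z\<in>UNIV. (\<Sum>x\<in>UNIV. ?k a b x y z) * G (a @ [y]) (b @ [z])))"
    by (rule Suc.IH)
  also have "\<dots> = (\<Sum>a | length a = n. \<Sum>b | length b = n. \<Sum>y\<in>UNIV. \<Sum>z\<in>UNIV.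
      joint_prob W1 W2 (Suc n) f j (a @ [y]) (b @ [z]) * G (a @ [y]) (b @ [z]))"
  proof (intro sum.cong refl)
    have *: "c * (\<Sum>y\<in>UNIV. \<Sum>z\<in>UNIV. S y z * H y z) = (\<Sum>y\<in>UNIV. \<Sum>z\<in>UNIV. (c * S y z) * H y z)"
      for c and S H :: "'b \<Rightarrow> 'b \<Rightarrow> real"
      by (simp add: sum_distrib_left mult.assoc)
    fix a b :: "'b list" assume "a \<in> {a. length a = n}" "b \<in> {b. length b = n}"
    then show "joint_prob W1 W2 n f j a b * (\<Sum>y\<in>UNIV. \<Sum>z\<in>UNIV. (\<Sum>x\<in>UNIV. ?k a b x y z) * G (a @ [y]) (b @ [z]))
        = (\<Sum>y\<in>UNIV. \<Sum>z\<in>UNIV. joint_prob W1 W2 (Suc n) f j (a @ [y]) (b @ [z]) * G (a @ [y]) (b @ [z]))"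
      unfolding * by (simp add: joint_prob_snoc)
  qed
  also have "\<dots> = (\<Sum>a | length a = n. \<Sum>y\<in>UNIV. \<Sum>b | length b = n. \<Sum>z\<in>UNIV.
      joint_prob W1 W2 (Suc n) f j (a @ [y]) (b @ [z]) * G (a @ [y]) (b @ [z]))"
    by (intro sum.cong refl sum.swap)
  also have "\<dots> = (\<Sum>a | length a = Suc n. \<Sum>b | length b = Suc n. joint_prob W1 W2 (Suc n) f j a b * G a b)"
    by (simp only: sum_lists_Suc)
  finally show ?case .
qed

text \<open>Under \<open>\<kappa>'\<close> the user's output is i.i.d. and carries no information
  about the message, so a correct decision there is a guess. On the event considered, the density of
  \<open>\<kappa>\<close> with respect to \<open>\<kappa>'\<close> is at most
  \<open>\<gamma>\<close>.\<close>

lemma correct_small_ratio_bound: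
  assumes q: "\<And>y. 0 \<le> q y"
    and \<kappa>': "\<And>l om. length l < n \<Longrightarrow> 0 \<le> \<kappa>' l om"
      "\<And>l G. length l < n \<Longrightarrow> (\<Sum>om\<in>UNIV. \<kappa>' l om * G (\<pi> om)) = (\<Sum>y\<in>UNIV. q y * G y)"
    and \<kappa>: "\<And>l om. length l < n \<Longrightarrow> \<kappa> l om = \<rho> om * \<kappa>' l om"
    and \<gamma>: "0 \<le> \<gamma>"
  shows "texp \<kappa> n (\<lambda>l. of_bool (g (map \<pi> l) = j \<and> prod_list (map \<rho> l) \<le> \<gamma>)) \<le> \<gamma> * iid q n (\<lambda>a. of_bool (g a = j))"
proof -
  have "texp \<kappa> n (\<lambda>l. of_bool (g (map \<pi> l) = j \<and> prod_list (map \<rho> l) \<le> \<gamma>))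
      = texp \<kappa>' n (\<lambda>l. prod_list (map \<rho> l) * of_bool (g (map \<pi> l) = j \<and> prod_list (map \<rho> l) \<le> \<gamma>))"
    by (rule texp_change_of_measure[OF \<kappa>])
  also have "\<dots> \<le> texp \<kappa>' n (\<lambda>l. \<gamma> * of_bool (g (map \<pi> l) = j))"
    by (rule texp_mono) (use \<kappa>' \<gamma> in auto)
  also have "\<dots> = \<gamma> * iid q n (\<lambda>a. of_bool (g a = j))"
    unfolding texp_cmult by (subst texp_map[where \<pi> = \<pi> and q = q, OF \<kappa>'(2)]) auto
  finally show ?thesis .
qed

text \<open>The decoding regions of distinct messages are disjoint.\<close>

lemma sum_texp_partition_le:
  assumes q: "\<And>y. 0 \<le> q y" "sum q UNIV = 1"
  shows "(\<Sum>j\<in>{1..M}. iid q n (\<lambda>a. of_bool (g a = (j::nat)))) \<le> 1"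
proof -
  have "(\<Sum>j\<in>{1..M}. iid q n (\<lambda>a. of_bool (g a = j))) = iid q n (\<lambda>a. \<Sum>j\<in>{1..M}. of_bool (g a = j))"
    by (rule texp_sum[symmetric])
  also have "\<dots> \<le> 1"
  proof (rule texp_le_const)
    show "(\<Sum>j\<in>{1..M}. of_bool (g a = j)) \<le> (1::real)" for a
      unfolding of_bool_def by (subst sum.delta') auto
  qed (use q in auto)
  finally show ?thesis .
qed

text \<open>Of the optimisation problem only its stationarity condition is kept: the mixed
  divergence is the same for every input letter.\<close>

locale balanced_bc =
  fixes W1 W2 :: "'x::finite \<Rightarrow> 'y::finite \<Rightarrow> real" and P :: "'x \<Rightarrow> real" and \<eta> C :: real
  assumes W1: "stochastic W1" and W2: "stochastic W2"
    and P_simplex: "P \<in> prob_simplex" and P_pos: "\<And>x. 0 < P x"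
    and \<eta>: "0 < \<eta>" "\<eta> < 1"
    and balance: "\<And>x. \<eta> * kl_row W1 x (outdist P W1) + (1 - \<eta>) * kl_row W2 x (outdist P W2) = C"
begin

definition mixdens :: "('x, 'y) triple \<Rightarrow> real" where
  "mixdens om = \<eta> * info_dens P W1 (fst om) (out1 om) + (1 - \<eta>) * info_dens P W2 (fst om) (out2 om) - C"

text \<open>Centred for each \<open>x\<close> separately and not merely on average over
  \<open>P\<close>, hence under every input law that a feedback encoder can choose.\<close>

lemma sum_channel_mixdens: "(\<Sum>y\<in>UNIV. \<Sum>z\<in>UNIV. W1 x y * W2 x z * mixdens (x, y, z)) = 0"
proof -
  let ?i = "info_dens P W1 x" and ?k = "info_dens P W2 x"
  have "(\<Sum>y\<in>UNIV. \<Sum>z\<in>UNIV. W1 x y * W2 x z * mixdens (x, y, z))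
     = (\<Sum>y\<in>UNIV. \<Sum>z\<in>UNIV. \<eta> * (W1 x y * ?i y) * W2 x z + (1 - \<eta>) * W1 x y * (W2 x z * ?k z) - C * W1 x y * W2 x z)"
    by (intro sum.cong refl) (simp add: mixdens_def algebra_simps)
  also have "\<dots> = \<eta> * (\<Sum>y\<in>UNIV. W1 x y * ?i y) + (1 - \<eta>) * (\<Sum>z\<in>UNIV. W2 x z * ?k z) - C"
    using stochasticD(2)[OF W1, of x] stochasticD(2)[OF W2, of x]
    by (simp add: sum.distrib sum_subtractf flip: sum_distrib_left sum_distrib_right)
  also have "\<dots> = 0" using balance[of x] by (simp add: kl_row_sum info_dens_def)
  finally show ?thesis .
qed

text \<open>A crude bound on all conditional variances. It also counts triples of probability zero,
  which is harmless for an upper bound.\<close>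

definition sqbound :: real where "sqbound = (\<Sum>om\<in>UNIV. (mixdens om)\<^sup>2)"

lemma sum_triple_dist_mixdens: "(\<Sum>om\<in>UNIV. triple_dist W1 W2 Q om * mixdens om) = 0"
proof -
  have "(\<Sum>om\<in>UNIV. triple_dist W1 W2 Q om * mixdens om)
      = (\<Sum>x\<in>UNIV. Q x * (\<Sum>y\<in>UNIV. \<Sum>z\<in>UNIV. W1 x y * W2 x z * mixdens (x, y, z)))"
    by (simp add: sum_triple triple_dist_def sum_distrib_left mult.assoc)
  then show ?thesis by (simp add: sum_channel_mixdens)
qed

lemma converse_bound:
  assumes code: "is_flf_code W1 W2 n M \<epsilon> f g1 g2" and n: "1 \<le> n" and K: "0 < K"
  shows "1 \<le> 2 * \<epsilon> + 2 * exp (real n * C + K * sqrt (real n)) / real M + sqbound / K\<^sup>2"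
proof -
  define \<gamma> where "\<gamma> = exp (real n * C + K * sqrt (real n))"
  have \<gamma>: "0 < \<gamma>" "ln \<gamma> = real n * C + K * sqrt (real n)" by (auto simp: \<gamma>_def)
  let ?q1 = "outdist P W1" and ?q2 = "outdist P W2" and ?E = "\<lambda>j. texp (code_kernel W1 W2 f j) n"
  let ?\<rho>1 = "\<lambda>om. lratio P W1 (fst om) (out1 om)" and ?\<rho>2 = "\<lambda>om. lratio P W2 (fst om) (out2 om)"
  let ?p1 = "\<lambda>l. prod_list (map ?\<rho>1 l)" and ?p2 = "\<lambda>l. prod_list (map ?\<rho>2 l)"
  have P0: "\<And>x. 0 \<le> P x" using P_pos less_imp_le by blast
  have q: "\<And>y. 0 \<le> outdist P W y" "sum (outdist P W) UNIV = 1" "stochastic (\<lambda>_. outdist P W)"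
    if "stochastic W" for W :: "'x \<Rightarrow> 'y \<Rightarrow> real"
    using outdist_nonneg[where P = P, OF that P0] sum_outdist[OF that, of P] prob_simplexD(2)[OF P_simplex]
    by (auto simp: stochastic_def)
  have M: "1 \<le> M" using code by (simp add: is_flf_code_def)
  define B where "B = sqbound / K\<^sup>2"
  \<comment> \<open>The five terms cover every outcome: an error of either user, a correct decision
    of either user at likelihood ratio at most \<open>\<gamma>\<close>, or both ratios above
    \<open>\<gamma>\<close>. The third and fourth stay dependent on \<open>j\<close>, because only
    their sum over \<open>j\<close> is small compared with \<open>M\<close>.\<close>
  define b where "b j = ?E j (\<lambda>l. of_bool (g1 (map out1 l) \<noteq> j)) + ?E j (\<lambda>l. of_bool (g2 (map out2 l) \<noteq> j))
      + \<gamma> * iid ?q1 n (\<lambda>a. of_bool (g1 a = j)) + \<gamma> * iid ?q2 n (\<lambda>a. of_bool (g2 a = j)) + B" for j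
  have main: "1 \<le> b j" if j: "j \<in> {1..M}" for j
  proof -
    let ?\<kappa> = "code_kernel W1 W2 f j" and ?f = "\<lambda>l :: ('x, 'y) triple list. f (length l) j (map out1 l) (map out2 l)"
    have fj: "0 \<le> ?f l x" "sum (?f l) UNIV = 1" if "length l < n" for l x
      using code j that by (auto simp: is_flf_code_def)
    have \<kappa>0: "0 \<le> ?\<kappa> l om" if "length l < n" for l om
      unfolding code_kernel_def by (rule triple_dist_nonneg[OF W1 W2 fj(1)[OF that]])
    have \<kappa>1: "(\<Sum>om\<in>UNIV. ?\<kappa> l om) = 1" if "length l < n" for l
      by (rule sum_code_kernel) (use W1 W2 fj(2)[OF that] in auto)
    \<comment> \<open>In the reference law user 1's output is drawn from \<open>?q1\<close>
      regardless of the input, while \<open>W2\<close> and the encoder stay as they are. The density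
      is then a product of the letterwise ratios \<open>?\<rho>1\<close>, with no contribution from
      the encoder.\<close>
    have b1: "texp ?\<kappa> n (\<lambda>l. of_bool (g1 (map out1 l) = j \<and> ?p1 l \<le> \<gamma>)) \<le> \<gamma> * iid ?q1 n (\<lambda>a. of_bool (g1 a = j))"
    proof (rule correct_small_ratio_bound[where \<kappa>' = "\<lambda>l. triple_dist (\<lambda>_. ?q1) W2 (?f l)"])
      show "0 \<le> triple_dist (\<lambda>_. ?q1) W2 (?f l) om" if "length l < n" for l om
        by (rule triple_dist_nonneg[OF q(3)[OF W1] W2 fj(1)[OF that]])
      show "?\<kappa> l om = ?\<rho>1 om * triple_dist (\<lambda>_. ?q1) W2 (?f l) om" for l om
        using lratio_mult_outdist[where P = P, OF W1 P_pos, of "fst om" "out1 om", symmetric]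
        by (simp add: code_kernel_def triple_dist_def mult_ac)
      show "(\<Sum>om\<in>UNIV. triple_dist (\<lambda>_. ?q1) W2 (?f l) om * G (out1 om)) = (\<Sum>y\<in>UNIV. ?q1 y * G y)"
        if "length l < n" for l G
        using sum_triple_dist(1)[OF q(3)[OF W1] W2, of "?f l" "\<lambda>_. G"] fj(2)[OF that] by (simp flip: sum_distrib_right)
    qed (use q[OF W1] \<gamma> in auto)
    have b2: "texp ?\<kappa> n (\<lambda>l. of_bool (g2 (map out2 l) = j \<and> ?p2 l \<le> \<gamma>)) \<le> \<gamma> * iid ?q2 n (\<lambda>a. of_bool (g2 a = j))"
    proof (rule correct_small_ratio_bound[where \<kappa>' = "\<lambda>l. triple_dist W1 (\<lambda>_. ?q2) (?f l)"])
      show "0 \<le> triple_dist W1 (\<lambda>_. ?q2) (?f l) om" if "length l < n" for l om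
        by (rule triple_dist_nonneg[OF W1 q(3)[OF W2] fj(1)[OF that]])
      show "?\<kappa> l om = ?\<rho>2 om * triple_dist W1 (\<lambda>_. ?q2) (?f l) om" for l om
        using lratio_mult_outdist[where P = P, OF W2 P_pos, of "fst om" "out2 om", symmetric]
        by (simp add: code_kernel_def triple_dist_def mult_ac)
      show "(\<Sum>om\<in>UNIV. triple_dist W1 (\<lambda>_. ?q2) (?f l) om * G (out2 om)) = (\<Sum>y\<in>UNIV. ?q2 y * G y)"
        if "length l < n" for l G
        using sum_triple_dist(2)[OF W1 q(3)[OF W2], of "?f l" "\<lambda>_. G"] fj(2)[OF that] by (simp flip: sum_distrib_right)
    qed (use q[OF W2] \<gamma> in auto)
    have b3: "texp ?\<kappa> n (\<lambda>l. of_bool (?p1 l > \<gamma> \<and> ?p2 l > \<gamma>)) \<le> B"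
    proof -
      define c where "c = 1 / (K\<^sup>2 * real n)"
      have c0: "0 \<le> c" by (simp add: c_def)
      have "texp ?\<kappa> n (\<lambda>l. of_bool (?p1 l > \<gamma> \<and> ?p2 l > \<gamma>)) \<le> texp ?\<kappa> n (\<lambda>l. c * (sum_list (map mixdens l))\<^sup>2)"
      proof (rule texp_mono_support)
        fix l :: "('x, 'y) triple list" assume l: "length l = n" "\<And>i. i < n \<Longrightarrow> 0 < ?\<kappa> (take i l) (l ! i)"
        have w: "0 < W1 (fst om) (out1 om)" "0 < W2 (fst om) (out2 om)" if "om \<in> set l" for om
        proof -
          obtain i where i: "i < n" "om = l ! i" using \<open>om \<in> set l\<close> l(1) by (auto simp: in_set_conv_nth)
          then have "0 < ?\<kappa> (take i l) om" using l(2) by simp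
          then show "0 < W1 (fst om) (out1 om)" "0 < W2 (fst om) (out2 om)"
            using stochasticD(1)[OF W1, of "fst om" "out1 om"] stochasticD(1)[OF W2, of "fst om" "out2 om"]
            by (auto simp: code_kernel_def triple_dist_def less_le)
        qed
        have p1: "0 < ?\<rho>1 om" and p2: "0 < ?\<rho>2 om" if "om \<in> set l" for om
          using lratio_pos[where P = P, OF W1 P_pos] lratio_pos[where P = P, OF W2 P_pos] w[OF that] by auto
        have "1 \<le> c * (sum_list (map mixdens l))\<^sup>2" if h: "?p1 l > \<gamma>" "?p2 l > \<gamma>"
        proof -
          let ?s1 = "\<Sum>om\<leftarrow>l. ln (?\<rho>1 om)" and ?s2 = "\<Sum>om\<leftarrow>l. ln (?\<rho>2 om)"
          have "ln \<gamma> < ln (?p1 l)" "ln \<gamma> < ln (?p2 l)" using h \<gamma>(1) by (auto simp: ln_less_cancel_iff)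
          then have s: "ln \<gamma> < ?s1" "ln \<gamma> < ?s2"
            using ln_prod_list[of l ?\<rho>1, OF p1] ln_prod_list[of l ?\<rho>2, OF p2] by auto
          have e: "sum_list (map mixdens l) = \<eta> * ?s1 + (1 - \<eta>) * ?s2 - real (length l) * C"
            by (induction l) (auto simp: mixdens_def ln_lratio algebra_simps)
          have "\<eta> * ln \<gamma> + (1 - \<eta>) * ln \<gamma> \<le> \<eta> * ?s1 + (1 - \<eta>) * ?s2"
            using s \<eta> by (intro add_mono mult_left_mono) auto
          then have "K * sqrt (real n) \<le> sum_list (map mixdens l)"
            unfolding e l(1) using \<gamma>(2) by (simp add: algebra_simps)
          then have "(K * sqrt (real n))\<^sup>2 \<le> (sum_list (map mixdens l))\<^sup>2" using K by (intro power_mono) auto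
          then show ?thesis unfolding c_def power_mult_distrib using K n by (simp add: field_simps)
        qed
        then show "of_bool (?p1 l > \<gamma> \<and> ?p2 l > \<gamma>) \<le> c * (sum_list (map mixdens l))\<^sup>2" using c0 by auto
      qed (use \<kappa>0 in auto)
      also have "\<dots> \<le> c * (real n * sqbound)"
        unfolding texp_cmult
      proof (intro mult_left_mono texp_square_le)
        show "(\<Sum>om\<in>UNIV. ?\<kappa> l om * mixdens om) = 0" for l unfolding code_kernel_def by (rule sum_triple_dist_mixdens)
        show "(\<Sum>om\<in>UNIV. ?\<kappa> l om * (mixdens om)\<^sup>2) \<le> sqbound" if "length l < n" for l
        proof -
          have "(\<Sum>om\<in>UNIV. ?\<kappa> l om * (mixdens om)\<^sup>2) \<le> (\<Sum>om\<in>UNIV. ?\<kappa> l om * sqbound)"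
            using \<kappa>0[OF that] unfolding sqbound_def by (intro sum_mono mult_left_mono member_le_sum) auto
          then show ?thesis using \<kappa>1[OF that] by (simp flip: sum_distrib_right)
        qed
      qed (use c0 \<kappa>0 \<kappa>1 in auto)
      also have "\<dots> = B" using n K by (simp add: c_def B_def)
      finally show ?thesis .
    qed
    have "1 = texp ?\<kappa> n (\<lambda>l. 1)" using texp_const[of n ?\<kappa> 1] \<kappa>1 by simp
    also have "\<dots> \<le> texp ?\<kappa> n (\<lambda>l. of_bool (g1 (map out1 l) \<noteq> j) + of_bool (g2 (map out2 l) \<noteq> j)
       + of_bool (g1 (map out1 l) = j \<and> ?p1 l \<le> \<gamma>) + of_bool (g2 (map out2 l) = j \<and> ?p2 l \<le> \<gamma>)
       + of_bool (?p1 l > \<gamma> \<and> ?p2 l > \<gamma>))"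
      by (rule texp_mono) (use \<kappa>0 in auto)
    finally show ?thesis unfolding texp_add b_def using b1 b2 b3 by linarith
  qed
  have err: "(\<Sum>j\<in>{1..M}. ?E j (\<lambda>l. of_bool (g (map out1 l) (map out2 l) \<noteq> j))) \<le> real M * \<epsilon>"
    if "err_prob W1 W2 n M f g \<le> \<epsilon>" for g
  proof -
    have "(\<Sum>j\<in>{1..M}. ?E j (\<lambda>l. of_bool (g (map out1 l) (map out2 l) \<noteq> j)))
        = (\<Sum>j\<in>{1..M}. \<Sum>a | length a = n. \<Sum>b | length b = n. if g a b \<noteq> j then joint_prob W1 W2 n f j a b else 0)"
      by (rule sum.cong[OF refl], subst texp_code_kernel[where G = "\<lambda>a b. of_bool (g a b \<noteq> _)"])
         (intro sum.cong refl, auto)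
    also have "\<dots> = real M * err_prob W1 W2 n M f g" using M by (simp add: err_prob_def)
    finally show ?thesis using that by (simp add: mult_left_mono)
  qed
  have e1: "(\<Sum>j\<in>{1..M}. ?E j (\<lambda>l. of_bool (g1 (map out1 l) \<noteq> j))) \<le> real M * \<epsilon>"
    and e2: "(\<Sum>j\<in>{1..M}. ?E j (\<lambda>l. of_bool (g2 (map out2 l) \<noteq> j))) \<le> real M * \<epsilon>"
    using err[of "\<lambda>a b. g1 a"] err[of "\<lambda>a b. g2 b"] code by (simp_all add: is_flf_code_def)
  have "real M = (\<Sum>j\<in>{1..M}. 1)" by simp
  also have "\<dots> \<le> sum b {1..M}" by (intro sum_mono main)
  also have "\<dots> \<le> real M * \<epsilon> + real M * \<epsilon> + \<gamma> * 1 + \<gamma> * 1 + real M * B"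
    unfolding b_def sum.distrib sum_distrib_left[symmetric]
    using e1 e2 \<gamma> by (intro add_mono mult_left_mono sum_texp_partition_le q W1 W2) auto
  finally have "real M * 1 \<le> real M * (2 * \<epsilon> + 2 * \<gamma> / real M + B)" using M by (simp add: algebra_simps)
  then show ?thesis using M unfolding B_def \<gamma>_def by simp
qed

end

section \<open>Random coding for two receivers\<close>

lemma exists_le_average:
  assumes "finite S" "\<And>w. w \<in> S \<Longrightarrow> 0 \<le> \<mu> w" "sum \<mu> S = 1" "(\<Sum>w\<in>S. \<mu> w * F w) \<le> (c::real)"
  shows "\<exists>w\<in>S. F w \<le> c"
proof (rule ccontr)
  assume "\<not> ?thesis"
  then have F: "\<And>w. w \<in> S \<Longrightarrow> c < F w" by force
  obtain w0 where w0: "w0 \<in> S" "0 < \<mu> w0"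
    using assms(2,3) by (metis less_le sum.neutral zero_neq_one)
  have "(\<Sum>w\<in>S. \<mu> w * c) < (\<Sum>w\<in>S. \<mu> w * F w)"
  proof (rule sum_strict_mono_ex1)
    show "\<forall>w\<in>S. \<mu> w * c \<le> \<mu> w * F w" using assms(2) F less_imp_le by (intro ballI mult_left_mono) blast+
    show "\<exists>w\<in>S. \<mu> w * c < \<mu> w * F w" using w0 F by (auto intro!: bexI[of _ w0])
  qed (rule assms(1))
  then show False using assms(3,4) by (simp flip: sum_distrib_right)
qed

text \<open>The added term is centred, so the cross term averages out, and its variance is at most
  1. This is one step of the growth of the quadratic potential.\<close>

lemma sum_shifted_square_le:
  assumes "finite S" "\<And>w. w \<in> S \<Longrightarrow> 0 \<le> \<mu> w" "sum \<mu> S = 1"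
    "\<And>w. w \<in> S \<Longrightarrow> 0 \<le> h w \<and> h w \<le> 1" "e = (\<Sum>w\<in>S. \<mu> w * h w)"
  shows "(\<Sum>w\<in>S. \<mu> w * (A + (h w - e))\<^sup>2) \<le> A\<^sup>2 + (1::real)"
proof -
  have "0 \<le> e" unfolding assms(5) by (intro sum_nonneg mult_nonneg_nonneg) (use assms in auto)
  have "e \<le> (\<Sum>w\<in>S. \<mu> w * 1)" unfolding assms(5) by (intro sum_mono mult_left_mono) (use assms in auto)
  then have e1: "e \<le> 1" using assms by simp
  have "(\<Sum>w\<in>S. \<mu> w * (A + (h w - e))\<^sup>2) = (\<Sum>w\<in>S. (A\<^sup>2 - 2 * A * e) * \<mu> w + (2 * A) * (\<mu> w * h w) + \<mu> w * (h w - e)\<^sup>2)"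
    by (intro sum.cong) (auto simp: power2_eq_square algebra_simps)
  also have "\<dots> = A\<^sup>2 + (\<Sum>w\<in>S. \<mu> w * (h w - e)\<^sup>2)"
    unfolding sum.distrib sum_distrib_left[symmetric] assms(3) assms(5)[symmetric] by simp
  also have "(\<Sum>w\<in>S. \<mu> w * (h w - e)\<^sup>2) \<le> (\<Sum>w\<in>S. \<mu> w * 1)"
  proof (intro sum_mono mult_left_mono)
    fix w assume "w \<in> S"
    then have "\<bar>h w - e\<bar> \<le> 1" using assms(4)[of w] \<open>0 \<le> e\<close> e1 by auto
    then show "(h w - e)\<^sup>2 \<le> 1" by (simp add: abs_square_le_1)
  qed (use assms in auto)
  finally show ?thesis using assms(3) by simp
qed

text \<open>Codewords are selected one at a time, keeping a quadratic potential below its mean; this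
  controls both users' average errors simultaneously without a product measure on codebooks.\<close>
lemma sequential_selection:
  fixes h1 h2 :: "'w \<Rightarrow> real" and I :: "'w \<Rightarrow> 'w \<Rightarrow> real"
  assumes S: "finite S" "\<And>w. w \<in> S \<Longrightarrow> 0 \<le> \<mu> w" "sum \<mu> S = 1"
    and h1: "\<And>w. w \<in> S \<Longrightarrow> 0 \<le> h1 w \<and> h1 w \<le> 1" "e1 = (\<Sum>w\<in>S. \<mu> w * h1 w)"
    and h2: "\<And>w. w \<in> S \<Longrightarrow> 0 \<le> h2 w \<and> h2 w \<le> 1" "e2 = (\<Sum>w\<in>S. \<mu> w * h2 w)"
    and I: "\<And>w. w \<in> S \<Longrightarrow> (\<Sum>w'\<in>S. \<mu> w' * I w w') \<le> \<theta>" and \<theta>: "0 \<le> \<theta>" and L: "0 \<le> L"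
  shows "\<exists>c. (\<forall>j\<in>{1..m}. c j \<in> S) \<and>
     (\<Sum>j\<in>{1..m}. h1 (c j) - e1)\<^sup>2 + (\<Sum>j\<in>{1..m}. h2 (c j) - e2)\<^sup>2
       + L * (\<Sum>j\<in>{1..m}. \<Sum>i\<in>{1..<j}. I (c i) (c j)) \<le> 2 * real m + L * \<theta> * (real m)\<^sup>2"
proof (induction m)
  case (Suc m)
  then obtain c where c: "\<forall>j\<in>{1..m}. c j \<in> S" and
    b: "(\<Sum>j\<in>{1..m}. h1 (c j) - e1)\<^sup>2 + (\<Sum>j\<in>{1..m}. h2 (c j) - e2)\<^sup>2
       + L * (\<Sum>j\<in>{1..m}. \<Sum>i\<in>{1..<j}. I (c i) (c j)) \<le> 2 * real m + L * \<theta> * (real m)\<^sup>2" by blast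
  define A1 where "A1 = (\<Sum>j\<in>{1..m}. h1 (c j) - e1)"
  define A2 where "A2 = (\<Sum>j\<in>{1..m}. h2 (c j) - e2)"
  define J where "J = (\<Sum>j\<in>{1..m}. \<Sum>i\<in>{1..<j}. I (c i) (c j))"
  \<comment> \<open>The potential after appending \<open>w\<close>. Its mean exceeds the present
    potential by at most \<open>2 + L * m * \<theta>\<close>, so some \<open>w\<close> does no
    worse.\<close>
  define F where "F w = (A1 + (h1 w - e1))\<^sup>2 + (A2 + (h2 w - e2))\<^sup>2 + L * (J + (\<Sum>i\<in>{1..m}. I (c i) w))" for w
  have "(\<Sum>w\<in>S. \<mu> w * F w) = (\<Sum>w\<in>S. \<mu> w * (A1 + (h1 w - e1))\<^sup>2) + (\<Sum>w\<in>S. \<mu> w * (A2 + (h2 w - e2))\<^sup>2)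
      + (\<Sum>w\<in>S. (L * J) * \<mu> w + L * (\<Sum>i\<in>{1..m}. \<mu> w * I (c i) w))"
    unfolding sum.distrib[symmetric] F_def
    by (intro sum.cong refl) (simp add: algebra_simps sum_distrib_left)
  also have "(\<Sum>w\<in>S. (L * J) * \<mu> w + L * (\<Sum>i\<in>{1..m}. \<mu> w * I (c i) w))
      = L * J + L * (\<Sum>i\<in>{1..m}. \<Sum>w\<in>S. \<mu> w * I (c i) w)"
  proof -
    have "(\<Sum>w\<in>S. (L * J) * \<mu> w) = L * J" using S(3) by (simp flip: sum_distrib_left)
    moreover have "(\<Sum>w\<in>S. L * (\<Sum>i\<in>{1..m}. \<mu> w * I (c i) w)) = L * (\<Sum>i\<in>{1..m}. \<Sum>w\<in>S. \<mu> w * I (c i) w)"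
      by (subst sum.swap) (rule sum_distrib_left[symmetric])
    ultimately show ?thesis by (simp only: sum.distrib)
  qed
  also have "(\<Sum>i\<in>{1..m}. \<Sum>w\<in>S. \<mu> w * I (c i) w) \<le> (\<Sum>i\<in>{1..m}. \<theta>)"
    by (intro sum_mono I) (use c in auto)
  also have "(\<Sum>w\<in>S. \<mu> w * (A1 + (h1 w - e1))\<^sup>2) \<le> A1\<^sup>2 + 1"
    by (rule sum_shifted_square_le) (use S h1 in auto)
  also have "(\<Sum>w\<in>S. \<mu> w * (A2 + (h2 w - e2))\<^sup>2) \<le> A2\<^sup>2 + 1"
    by (rule sum_shifted_square_le) (use S h2 in auto)
  finally have "(\<Sum>w\<in>S. \<mu> w * F w) \<le> (A1\<^sup>2 + 1) + (A2\<^sup>2 + 1) + (L * J + L * (real m * \<theta>))"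
    using L by (simp add: mult_left_mono)
  also have "\<dots> \<le> 2 * real (Suc m) + L * \<theta> * (real (Suc m))\<^sup>2"
  proof -
    have "L * \<theta> * (real m)\<^sup>2 + L * (real m * \<theta>) = (L * \<theta>) * ((real m)\<^sup>2 + real m)" by (simp add: algebra_simps)
    also have "\<dots> \<le> (L * \<theta>) * (real (Suc m))\<^sup>2"
      using L \<theta> by (intro mult_left_mono) (auto simp: power2_eq_square algebra_simps)
    finally show ?thesis using b unfolding A1_def[symmetric] A2_def[symmetric] J_def[symmetric] by simp
  qed
  finally obtain w where w: "w \<in> S" "F w \<le> 2 * real (Suc m) + L * \<theta> * (real (Suc m))\<^sup>2"
    using exists_le_average[OF S] by blast
  define c' where "c' = c(Suc m := w)"
  have c'e: "\<And>i. i \<in> {1..m} \<Longrightarrow> c' i = c i" "c' (Suc m) = w" by (auto simp: c'_def)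
  have s: "(\<Sum>j\<in>{1..Suc m}. X j) = (\<Sum>j\<in>{1..m}. X j) + X (Suc m)" for X :: "nat \<Rightarrow> real" by simp
  have "(\<Sum>j\<in>{1..m}. h1 (c' j) - e1) = A1" "(\<Sum>j\<in>{1..m}. h2 (c' j) - e2) = A2"
    "(\<Sum>j\<in>{1..m}. \<Sum>i\<in>{1..<j}. I (c' i) (c' j)) = J"
    "(\<Sum>i\<in>{1..<Suc m}. I (c' i) (c' (Suc m))) = (\<Sum>i\<in>{1..m}. I (c i) w)"
    unfolding A1_def A2_def J_def atLeastLessThanSuc_atLeastAtMost
    by (intro sum.cong refl; auto simp: c'_def intro!: sum.cong)+
  then have "(\<Sum>j\<in>{1..Suc m}. h1 (c' j) - e1)\<^sup>2 + (\<Sum>j\<in>{1..Suc m}. h2 (c' j) - e2)\<^sup>2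
       + L * (\<Sum>j\<in>{1..Suc m}. \<Sum>i\<in>{1..<j}. I (c' i) (c' j)) = F w"
    unfolding s F_def c'e(2) by simp
  moreover have "\<forall>j\<in>{1..Suc m}. c' j \<in> S" using c w by (auto simp: c'_def)
  ultimately show ?case using w(2) by (intro exI[of _ c']) auto
qed auto

text \<open>Decoding to the largest accepted message means that only later codewords interfere, and a codeword
  is drawn after the ones it interferes with have been fixed.\<close>
lemma sum_max_decoder_errors:
  fixes A :: "'a set" and R :: "'w \<Rightarrow> 'a \<Rightarrow> bool" and q :: "'w \<Rightarrow> 'a \<Rightarrow> real" and c :: "nat \<Rightarrow> 'w"
  assumes q: "\<And>j a. j \<in> {1..M} \<Longrightarrow> a \<in> A \<Longrightarrow> 0 \<le> q (c j) a"
  defines "g \<equiv> \<lambda>a. Max (insert 0 {j \<in> {1..M}. R (c j) a})"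
  shows "(\<Sum>j\<in>{1..M}. \<Sum>a\<in>A. q (c j) a * of_bool (g a \<noteq> j)) \<le>
    (\<Sum>j\<in>{1..M}. \<Sum>a\<in>A. q (c j) a * of_bool (\<not> R (c j) a))
    + (\<Sum>k\<in>{1..M}. \<Sum>j\<in>{1..<k}. \<Sum>a\<in>A. q (c j) a * of_bool (R (c k) a))"
proof -
  \<comment> \<open>If message \<open>j\<close> is accepted but not chosen, the maximum is larger
    than \<open>j\<close>, so some later message is accepted as well. The inserted 0 is not a
    message; it makes \<open>Max\<close> defined when nothing is accepted.\<close>
  have d: "of_bool (g a \<noteq> j) \<le> (of_bool (\<not> R (c j) a) + (\<Sum>k\<in>{k\<in>{1..M}. j < k}. of_bool (R (c k) a)) :: real)"
    if j: "j \<in> {1..M}" for a j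
  proof (cases "g a = j \<or> \<not> R (c j) a")
    case True
    then show ?thesis by (auto intro!: sum_nonneg add_nonneg_nonneg)
  next
    case False
    have "j \<le> g a" unfolding g_def using False j by (intro Max_ge) auto
    moreover have "g a \<in> insert 0 {j \<in> {1..M}. R (c j) a}" unfolding g_def by (intro Max_in) auto
    ultimately have "g a \<in> {k\<in>{1..M}. j < k}" "R (c (g a)) a" using False j by auto
    then have "(1::real) \<le> (\<Sum>k\<in>{k\<in>{1..M}. j < k}. of_bool (R (c k) a))"
      using member_le_sum[of "g a" "{k\<in>{1..M}. j < k}" "\<lambda>k. of_bool (R (c k) a) :: real"] by simp
    then show ?thesis by (auto simp: of_bool_def)
  qed
  have "(\<Sum>j\<in>{1..M}. \<Sum>a\<in>A. q (c j) a * of_bool (g a \<noteq> j))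
     \<le> (\<Sum>j\<in>{1..M}. \<Sum>a\<in>A. q (c j) a * (of_bool (\<not> R (c j) a) + (\<Sum>k\<in>{k\<in>{1..M}. j < k}. of_bool (R (c k) a))))"
    by (intro sum_mono mult_left_mono d q) auto
  also have "\<dots> = (\<Sum>j\<in>{1..M}. \<Sum>a\<in>A. q (c j) a * of_bool (\<not> R (c j) a))
     + (\<Sum>j\<in>{1..M}. \<Sum>k\<in>{k\<in>{1..M}. j < k}. \<Sum>a\<in>A. q (c j) a * of_bool (R (c k) a))"
  proof -
    have "(\<Sum>a\<in>A. q (c j) a * (of_bool (\<not> R (c j) a) + (\<Sum>k\<in>{k\<in>{1..M}. j < k}. of_bool (R (c k) a))))
      = (\<Sum>a\<in>A. q (c j) a * of_bool (\<not> R (c j) a)) + (\<Sum>k\<in>{k\<in>{1..M}. j < k}. \<Sum>a\<in>A. q (c j) a * of_bool (R (c k) a))" for j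
      unfolding distrib_left sum.distrib sum_distrib_left by (subst (2) sum.swap) (rule refl)
    then show ?thesis by (simp only: sum.distrib)
  qed
  also have "(\<Sum>j\<in>{1..M}. \<Sum>k\<in>{k\<in>{1..M}. j < k}. \<Sum>a\<in>A. q (c j) a * of_bool (R (c k) a))
     = (\<Sum>k\<in>{1..M}. \<Sum>j\<in>{j\<in>{1..M}. j < k}. \<Sum>a\<in>A. q (c j) a * of_bool (R (c k) a))"
    by (rule sum.swap_restrict) auto
  also have "\<dots> = (\<Sum>k\<in>{1..M}. \<Sum>j\<in>{1..<k}. \<Sum>a\<in>A. q (c j) a * of_bool (R (c k) a))"
    by (intro sum.cong) auto
  finally show ?thesis .
qed

lemma receiver_bounds:
  fixes q :: "'w \<Rightarrow> 'a \<Rightarrow> real"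
  assumes q: "\<And>w a. w \<in> S \<Longrightarrow> a \<in> A \<Longrightarrow> 0 \<le> q w a" "\<And>w. w \<in> S \<Longrightarrow> (\<Sum>a\<in>A. q w a) = 1"
    and fa: "\<And>a. a \<in> A \<Longrightarrow> (\<Sum>w\<in>S. \<mu> w * of_bool (R w a)) \<le> \<theta>" and w: "w \<in> S"
  shows "0 \<le> (\<Sum>a\<in>A. q w a * of_bool (\<not> R w a)) \<and> (\<Sum>a\<in>A. q w a * of_bool (\<not> R w a)) \<le> 1"
    "(\<Sum>w'\<in>S. \<mu> w' * (\<Sum>a\<in>A. q w a * of_bool (R w' a))) \<le> \<theta>"
proof -
  have "(\<Sum>a\<in>A. q w a * of_bool (\<not> R w a)) \<le> (\<Sum>a\<in>A. q w a)" using q(1)[OF w] by (intro sum_mono) auto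
  then show "0 \<le> (\<Sum>a\<in>A. q w a * of_bool (\<not> R w a)) \<and> (\<Sum>a\<in>A. q w a * of_bool (\<not> R w a)) \<le> 1"
    using q(1)[OF w] q(2)[OF w] by (auto intro!: sum_nonneg)
  have "(\<Sum>w'\<in>S. \<mu> w' * (\<Sum>a\<in>A. q w a * of_bool (R w' a))) = (\<Sum>a\<in>A. q w a * (\<Sum>w'\<in>S. \<mu> w' * of_bool (R w' a)))"
    unfolding sum_distrib_left by (subst sum.swap) (simp add: mult_ac)
  also have "\<dots> \<le> (\<Sum>a\<in>A. q w a * \<theta>)" by (intro sum_mono mult_left_mono fa q w)
  finally show "(\<Sum>w'\<in>S. \<mu> w' * (\<Sum>a\<in>A. q w a * of_bool (R w' a))) \<le> \<theta>"
    using q(2)[OF w] by (simp flip: sum_distrib_right)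
qed

text \<open>The interference enters the potential with weight \<open>real M\<close>, which puts both
  kinds of error on one scale: the potential is at most \<open>M^2 * \<delta>\<close>. Its squares
  then give an average deviation of at most \<open>sqrt \<delta>\<close>, and its interference part
  gives at most \<open>\<delta>\<close>.\<close>

lemma random_coding:
  fixes \<mu> :: "'w \<Rightarrow> real" and p :: "'w \<Rightarrow> 'a \<Rightarrow> 'b \<Rightarrow> real"
  assumes S: "finite S" "\<And>w. w \<in> S \<Longrightarrow> 0 \<le> \<mu> w" "sum \<mu> S = 1"
    and fin: "finite A" "finite B"
    and p: "\<And>w a b. w \<in> S \<Longrightarrow> a \<in> A \<Longrightarrow> b \<in> B \<Longrightarrow> 0 \<le> p w a b" "\<And>w. w \<in> S \<Longrightarrow> (\<Sum>a\<in>A. \<Sum>b\<in>B. p w a b) = 1"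
    and fa1: "\<And>a. a \<in> A \<Longrightarrow> (\<Sum>w\<in>S. \<mu> w * of_bool (R1 w a)) \<le> \<theta>"
    and fa2: "\<And>b. b \<in> B \<Longrightarrow> (\<Sum>w\<in>S. \<mu> w * of_bool (R2 w b)) \<le> \<theta>"
    and e1: "(\<Sum>w\<in>S. \<mu> w * (\<Sum>a\<in>A. \<Sum>b\<in>B. p w a b * of_bool (\<not> R1 w a))) \<le> e"
    and e2: "(\<Sum>w\<in>S. \<mu> w * (\<Sum>a\<in>A. \<Sum>b\<in>B. p w a b * of_bool (\<not> R2 w b))) \<le> e"
    and M: "1 \<le> M" and \<theta>: "0 \<le> \<theta>"
  defines "\<delta> \<equiv> 2 / real M + 2 * \<theta> * real M"
  obtains c g1 g2 where "\<And>j. j \<in> {1..M} \<Longrightarrow> c j \<in> S"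
    "(\<Sum>j\<in>{1..M}. \<Sum>a\<in>A. \<Sum>b\<in>B. p (c j) a b * of_bool (g1 a \<noteq> j)) \<le> real M * (e + sqrt \<delta> + \<delta>)"
    "(\<Sum>j\<in>{1..M}. \<Sum>a\<in>A. \<Sum>b\<in>B. p (c j) a b * of_bool (g2 b \<noteq> j)) \<le> real M * (e + sqrt \<delta> + \<delta>)"
proof -
  define q1 where "q1 w a = (\<Sum>b\<in>B. p w a b)" for w a
  define q2 where "q2 w b = (\<Sum>a\<in>A. p w a b)" for w b
  have q10: "0 \<le> q1 w a" if "w \<in> S" "a \<in> A" for w a unfolding q1_def by (intro sum_nonneg p that)
  have q20: "0 \<le> q2 w b" if "w \<in> S" "b \<in> B" for w b unfolding q2_def by (intro sum_nonneg p that)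
  have s1: "(\<Sum>a\<in>A. \<Sum>b\<in>B. p w a b * F a) = (\<Sum>a\<in>A. q1 w a * F a)" for w and F :: "'a \<Rightarrow> real"
    by (simp add: q1_def sum_distrib_right)
  have s2: "(\<Sum>a\<in>A. \<Sum>b\<in>B. p w a b * F b) = (\<Sum>b\<in>B. q2 w b * F b)" for w and F :: "'b \<Rightarrow> real"
    unfolding q2_def sum_distrib_right by (rule sum.swap)
  have q11: "(\<Sum>a\<in>A. q1 w a) = 1" if "w \<in> S" for w using p(2)[OF that] by (simp add: q1_def)
  have q21: "(\<Sum>b\<in>B. q2 w b) = 1" if "w \<in> S" for w using p(2)[OF that] s2[of w "\<lambda>_. 1"] by simp
  define h1 where "h1 w = (\<Sum>a\<in>A. q1 w a * of_bool (\<not> R1 w a))" for w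
  define h2 where "h2 w = (\<Sum>b\<in>B. q2 w b * of_bool (\<not> R2 w b))" for w
  define I1 where "I1 w w' = (\<Sum>a\<in>A. q1 w a * of_bool (R1 w' a))" for w w'
  define I2 where "I2 w w' = (\<Sum>b\<in>B. q2 w b * of_bool (R2 w' b))" for w w'
  have b1: "0 \<le> h1 w \<and> h1 w \<le> 1" "(\<Sum>w'\<in>S. \<mu> w' * I1 w w') \<le> \<theta>" if "w \<in> S" for w
    unfolding h1_def I1_def by (rule receiver_bounds; use q10 q11 fa1 that in auto)+
  have b2: "0 \<le> h2 w \<and> h2 w \<le> 1" "(\<Sum>w'\<in>S. \<mu> w' * I2 w w') \<le> \<theta>" if "w \<in> S" for w
    unfolding h2_def I2_def by (rule receiver_bounds; use q20 q21 fa2 that in auto)+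
  define E1 where "E1 = (\<Sum>w\<in>S. \<mu> w * h1 w)"
  define E2 where "E2 = (\<Sum>w\<in>S. \<mu> w * h2 w)"
  have Ee: "E1 \<le> e" "E2 \<le> e" using e1 e2 by (auto simp: E1_def E2_def h1_def h2_def s1 s2)
  have "\<exists>c. (\<forall>j\<in>{1..M}. c j \<in> S) \<and>
     (\<Sum>j\<in>{1..M}. h1 (c j) - E1)\<^sup>2 + (\<Sum>j\<in>{1..M}. h2 (c j) - E2)\<^sup>2
       + real M * (\<Sum>j\<in>{1..M}. \<Sum>i\<in>{1..<j}. I1 (c i) (c j) + I2 (c i) (c j)) \<le> 2 * real M + real M * (2 * \<theta>) * (real M)\<^sup>2"
  proof (rule sequential_selection[OF S b1(1) E1_def b2(1) E2_def])
    show "(\<Sum>w'\<in>S. \<mu> w' * (I1 w w' + I2 w w')) \<le> 2 * \<theta>" if "w \<in> S" for w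
      using b1(2)[OF that] b2(2)[OF that] by (simp add: distrib_left sum.distrib)
  qed (use \<theta> in auto)
  then obtain c where c: "\<And>j. j \<in> {1..M} \<Longrightarrow> c j \<in> S" and
    b: "(\<Sum>j\<in>{1..M}. h1 (c j) - E1)\<^sup>2 + (\<Sum>j\<in>{1..M}. h2 (c j) - E2)\<^sup>2
       + real M * (\<Sum>j\<in>{1..M}. \<Sum>i\<in>{1..<j}. I1 (c i) (c j) + I2 (c i) (c j)) \<le> 2 * real M + real M * (2 * \<theta>) * (real M)\<^sup>2"
    by blast
  define J1 where "J1 = (\<Sum>j\<in>{1..M}. \<Sum>i\<in>{1..<j}. I1 (c i) (c j))"
  define J2 where "J2 = (\<Sum>j\<in>{1..M}. \<Sum>i\<in>{1..<j}. I2 (c i) (c j))"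
  have J0: "0 \<le> J1" "0 \<le> J2" unfolding J1_def J2_def I1_def I2_def
    by (intro sum_nonneg mult_nonneg_nonneg q10 q20 c; auto)+
  have Mp: "real M > 0" using M by simp
  have T: "2 * real M + real M * (2 * \<theta>) * (real M)\<^sup>2 = (real M)\<^sup>2 * \<delta>"
    using Mp by (simp add: \<delta>_def power2_eq_square field_simps)
  have JJ: "(\<Sum>j\<in>{1..M}. \<Sum>i\<in>{1..<j}. I1 (c i) (c j) + I2 (c i) (c j)) = J1 + J2"
    by (simp add: J1_def J2_def sum.distrib)
  have b': "(\<Sum>j\<in>{1..M}. h1 (c j) - E1)\<^sup>2 + (\<Sum>j\<in>{1..M}. h2 (c j) - E2)\<^sup>2 + real M * (J1 + J2) \<le> (real M)\<^sup>2 * \<delta>"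
    using b unfolding T JJ .
  have MJ: "0 \<le> real M * (J1 + J2)" using J0 by simp
  have r: "(\<Sum>j\<in>{1..M}. h (c j)) \<le> real M * (e + sqrt \<delta>)"
    if "(\<Sum>j\<in>{1..M}. h (c j) - E)\<^sup>2 \<le> (real M)\<^sup>2 * \<delta>" "E \<le> e" for h E
  proof -
    have "(\<Sum>j\<in>{1..M}. h (c j) - E) \<le> sqrt ((real M)\<^sup>2 * \<delta>)" using that(1) by (rule real_le_rsqrt)
    then show ?thesis using mult_left_mono[OF that(2), of "real M"]
      by (simp add: real_sqrt_mult sum_subtractf distrib_left)
  qed
  have r1: "(\<Sum>j\<in>{1..M}. h1 (c j)) \<le> real M * (e + sqrt \<delta>)"
    by (rule r[OF _ Ee(1)]) (use b' MJ zero_le_power2[of "\<Sum>j\<in>{1..M}. h2 (c j) - E2"] in linarith)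
  have r2: "(\<Sum>j\<in>{1..M}. h2 (c j)) \<le> real M * (e + sqrt \<delta>)"
    by (rule r[OF _ Ee(2)]) (use b' MJ zero_le_power2[of "\<Sum>j\<in>{1..M}. h1 (c j) - E1"] in linarith)
  have "real M * (J1 + J2) \<le> real M * (real M * \<delta>)"
    using b' zero_le_power2[of "\<Sum>j\<in>{1..M}. h1 (c j) - E1"] zero_le_power2[of "\<Sum>j\<in>{1..M}. h2 (c j) - E2"]
    unfolding power2_eq_square[of "real M"] mult.assoc by linarith
  then have J: "J1 \<le> real M * \<delta>" "J2 \<le> real M * \<delta>" using J0 Mp by auto
  define g1 where "g1 a = Max (insert 0 {j \<in> {1..M}. R1 (c j) a})" for a
  define g2 where "g2 b = Max (insert 0 {j \<in> {1..M}. R2 (c j) b})" for b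
  show thesis
  proof (rule that[OF c])
    have "(\<Sum>j\<in>{1..M}. \<Sum>a\<in>A. q1 (c j) a * of_bool (g1 a \<noteq> j)) \<le> (\<Sum>j\<in>{1..M}. h1 (c j)) + J1"
      unfolding g1_def h1_def J1_def I1_def by (rule sum_max_decoder_errors) (use q10 c in auto)
    then show "(\<Sum>j\<in>{1..M}. \<Sum>a\<in>A. \<Sum>b\<in>B. p (c j) a b * of_bool (g1 a \<noteq> j)) \<le> real M * (e + sqrt \<delta> + \<delta>)"
      unfolding s1 using r1 J(1) by (simp add: distrib_left)
    have "(\<Sum>j\<in>{1..M}. \<Sum>b\<in>B. q2 (c j) b * of_bool (g2 b \<noteq> j)) \<le> (\<Sum>j\<in>{1..M}. h2 (c j)) + J2"
      unfolding g2_def h2_def J2_def I2_def by (rule sum_max_decoder_errors) (use q20 c in auto)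
    then show "(\<Sum>j\<in>{1..M}. \<Sum>a\<in>A. \<Sum>b\<in>B. p (c j) a b * of_bool (g2 b \<noteq> j)) \<le> real M * (e + sqrt \<delta> + \<delta>)"
      unfolding s2 using r2 J(2) by (simp add: distrib_left)
  qed
qed

section \<open>Likelihoods and random laws of words\<close>

definition lik :: "('a \<Rightarrow> 'b \<Rightarrow> real) \<Rightarrow> 'a list \<Rightarrow> 'b list \<Rightarrow> real" where
  "lik h x a = prod_list (map2 h x a)"

lemma lik_snoc [simp]: "length x = length a \<Longrightarrow> lik h (x @ [\<xi>]) (a @ [y]) = lik h x a * h \<xi> y"
  by (simp add: lik_def)

lemma lik_append: "length x = length a \<Longrightarrow> lik h (x @ x') (a @ a') = lik h x a * lik h x' a'"
  by (simp add: lik_def)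

lemma lik_Nil [simp]: "lik h [] [] = 1" by (simp add: lik_def)

lemma lik_nonneg:
  assumes "\<And>x y. 0 \<le> h x y" shows "0 \<le> lik h x a"
  unfolding lik_def by (induction x a rule: list_induct2') (auto simp: assms)

lemma lik_conv_prod:
  assumes "length x = n" "length a = n" shows "lik h x a = (\<Prod>i<n. h (x ! i) (a ! i))"
proof -
  have "lik h x a = (\<Prod>i\<in>{0..<n}. (map2 h x a) ! i)"
    unfolding lik_def prod.list_conv_set_nth using assms by simp
  also have "\<dots> = (\<Prod>i<n. h (x ! i) (a ! i))"
    unfolding atLeast0LessThan using assms by (intro prod.cong) auto
  finally show ?thesis .
qed

lemma map_triples:
  assumes "length x = length a" "length a = length b"
  shows "map (\<lambda>om. h (fst om) (out1 om)) (zip x (zip a b)) = map2 h x a"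
    "map (\<lambda>om. h (fst om) (out2 om)) (zip x (zip a b)) = map2 h x b"
  using assms by (auto intro!: nth_equalityI)

definition plist :: "('x \<Rightarrow> real) \<Rightarrow> 'x list \<Rightarrow> real" where
  "plist P x = prod_list (map P x)"

lemma plist_nonneg: "(\<And>x. 0 \<le> P x) \<Longrightarrow> 0 \<le> plist P x"
  unfolding plist_def by (induction x) auto

lemma sum_plist_lik:
  fixes P :: "'x::finite \<Rightarrow> real"
  assumes "length a = n"
  shows "(\<Sum>x | length x = n. plist P x * lik h x a) = prod_list (map (\<lambda>y. \<Sum>x\<in>UNIV. P x * h x y) a)"
  using assms
proof (induction n arbitrary: a)
  case 0
  have "{a :: 'x list. a = []} = {[]}" by auto
  with 0 show ?case by (simp add: plist_def)
next
  case (Suc n)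
  then obtain a' y where a: "a = a' @ [y]" "length a' = n"
    by (metis length_Suc_conv_rev)
  have "(\<Sum>x | length x = Suc n. plist P x * lik h x a)
     = (\<Sum>x | length x = n. \<Sum>\<xi>\<in>UNIV. (plist P x * lik h x a') * (P \<xi> * h \<xi> y))"
    unfolding sum_lists_Suc by (intro sum.cong refl) (auto simp: a plist_def)
  also have "\<dots> = (\<Sum>x | length x = n. plist P x * lik h x a') * (\<Sum>\<xi>\<in>UNIV. P \<xi> * h \<xi> y)"
    by (simp only: sum_product)
  finally show ?case using Suc.IH[of a'] a by simp
qed

lemma sum_plist: fixes P :: "'x::finite \<Rightarrow> real" shows "(\<Sum>x | length x = n. plist P x) = (sum P UNIV) ^ n"
proof -
  have l: "lik (\<lambda>_ _. 1) x a = 1" for x :: "'x list" and a :: "unit list"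
    unfolding lik_def by (induction x a rule: list_induct2') auto
  show ?thesis
    using sum_plist_lik[of "replicate n ()" n P "\<lambda>_ _. 1"] l by (simp add: prod_list_replicate)
qed

text \<open>Passage from the tree form, in which tail bounds are proved, to separate sums over input
  and output words, in which random coding averages are computed.\<close>

lemma texp_triple_dist:
  "iid (triple_dist W1 W2 P) n F
    = (\<Sum>x | length x = n. \<Sum>a | length a = n. \<Sum>b | length b = n.
        plist P x * lik W1 x a * lik W2 x b * F (zip x (zip a b)))"
proof (induction n arbitrary: F)
  case 0
  have "{a :: 'a list. a = []} = {[]}" "{a :: 'b list. a = []} = {[]}" by auto
  then show ?case by (simp add: plist_def)
next
  case (Suc n)
  let ?T = "\<lambda>x a b \<xi> y z. plist P (x @ [\<xi>]) * lik W1 (x @ [\<xi>]) (a @ [y]) * lik W2 (x @ [\<xi>]) (b @ [z])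
      * F (zip (x @ [\<xi>]) (zip (a @ [y]) (b @ [z])))"
  have "iid (triple_dist W1 W2 P) (Suc n) F = (\<Sum>x | length x = n. \<Sum>a | length a = n. \<Sum>b | length b = n.
     plist P x * lik W1 x a * lik W2 x b * (\<Sum>\<xi>\<in>UNIV. \<Sum>y\<in>UNIV. \<Sum>z\<in>UNIV. triple_dist W1 W2 P (\<xi>, y, z) * F (zip x (zip a b) @ [(\<xi>, y, z)])))"
    by (simp add: Suc.IH sum_triple)
  also have "\<dots> = (\<Sum>x | length x = n. \<Sum>a | length a = n. \<Sum>b | length b = n. \<Sum>\<xi>\<in>UNIV. \<Sum>y\<in>UNIV. \<Sum>z\<in>UNIV. ?T x a b \<xi> y z)"
    unfolding sum_distrib_left by (intro sum.cong refl) (auto simp: triple_dist_def plist_def)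
  also have "\<dots> = (\<Sum>x | length x = n. \<Sum>a | length a = n. \<Sum>\<xi>\<in>UNIV. \<Sum>b | length b = n. \<Sum>y\<in>UNIV. \<Sum>z\<in>UNIV. ?T x a b \<xi> y z)"
    by (rule sum.cong[OF refl], rule sum.cong[OF refl], rule sum.swap)
  also have "\<dots> = (\<Sum>x | length x = n. \<Sum>\<xi>\<in>UNIV. \<Sum>a | length a = n. \<Sum>b | length b = n. \<Sum>y\<in>UNIV. \<Sum>z\<in>UNIV. ?T x a b \<xi> y z)"
    by (rule sum.cong[OF refl], rule sum.swap)
  also have "\<dots> = (\<Sum>x | length x = n. \<Sum>\<xi>\<in>UNIV. \<Sum>a | length a = n. \<Sum>y\<in>UNIV. \<Sum>b | length b = n. \<Sum>z\<in>UNIV. ?T x a b \<xi> y z)"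
    by (rule sum.cong[OF refl], rule sum.cong[OF refl], rule sum.cong[OF refl], rule sum.swap)
  also have "\<dots> = (\<Sum>x | length x = Suc n. \<Sum>a | length a = Suc n. \<Sum>b | length b = Suc n.
        plist P x * lik W1 x a * lik W2 x b * F (zip x (zip a b)))"
    by (simp only: sum_lists_Suc)
  finally show ?case .
qed

lemma sum_lists_add:
  "(\<Sum>a | length a = m + n. F a) = (\<Sum>a | length a = m. \<Sum>b | length b = n. F (a @ b :: 'y::finite list))"
proof -
  have "bij_betw (\<lambda>(a, b). a @ b) ({a. length a = m} \<times> {b. length b = n}) {a :: 'y list. length a = m + n}"
    by (rule bij_betw_byWitness[where f' = "\<lambda>c. (take m c, drop m c)"]) auto
  from sum.reindex_bij_betw[OF this, of F] show ?thesis
    by (simp add: sum.cartesian_product split_def)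
qed

text \<open>Under a product law, a function of one coordinate sees only that marginal; the remaining
  factors sum to one.\<close>

lemma sum_PiE_marginal:
  fixes m :: "'s \<Rightarrow> 'a \<Rightarrow> real"
  assumes "finite St" "s0 \<in> St" "finite A" "\<And>s. s \<in> St \<Longrightarrow> sum (m s) A = 1"
  shows "(\<Sum>u\<in>PiE St (\<lambda>_. A). (\<Prod>s\<in>St. m s (u s)) * H (u s0)) = (\<Sum>y\<in>A. m s0 y * H y)"
proof -
  define k where "k s y = m s y * (if s = s0 then H y else 1)" for s y
  have "(\<Prod>s\<in>St. m s (u s)) * H (u s0) = (\<Prod>s\<in>St. k s (u s))" for u
    unfolding k_def prod.distrib using assms(1,2) by (simp add: prod.delta)
  then have "(\<Sum>u\<in>PiE St (\<lambda>_. A). (\<Prod>s\<in>St. m s (u s)) * H (u s0)) = (\<Prod>s\<in>St. \<Sum>y\<in>A. k s y)"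
    using prod_sum_PiE[of St "\<lambda>_. A" k] assms by simp
  also have "\<dots> = (\<Prod>s\<in>St. if s = s0 then (\<Sum>y\<in>A. m s0 y * H y) else 1)"
    by (intro prod.cong refl) (auto simp: k_def assms(4))
  finally show ?thesis using assms(1,2) by (simp add: prod.delta)
qed

section \<open>The two-phase code\<close>

lemma prod_list_le_1: "(\<And>y. y \<in> set ys \<Longrightarrow> 0 \<le> (y::real) \<and> y \<le> 1) \<Longrightarrow> 0 \<le> prod_list ys \<and> prod_list ys \<le> 1"
  by (induction ys) (auto simp: mult_le_one)

text \<open>Each letter contributes \<open>outdist P W y / outdist P W y\<close>, which is 1, or 0
  for an output of probability zero since division by zero yields 0. Hence an inequality rather than
  an equality.\<close>

lemma sum_plist_lratio_le_1:
  fixes P :: "'x::finite \<Rightarrow> real"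
  assumes "stochastic W" "\<And>x. 0 \<le> P x" "length a = n"
  shows "0 \<le> (\<Sum>x | length x = n. plist P x * lik (lratio P W) x a)"
    "(\<Sum>x | length x = n. plist P x * lik (lratio P W) x a) \<le> 1"
proof -
  have "(\<Sum>x\<in>UNIV. P x * lratio P W x y) = outdist P W y / outdist P W y" for y
    unfolding lratio_def times_divide_eq_right sum_divide_distrib[symmetric]
    by (simp only: outdist_def)
  then have "0 \<le> prod_list (map (\<lambda>y. \<Sum>x\<in>UNIV. P x * lratio P W x y) a) \<and>
      prod_list (map (\<lambda>y. \<Sum>x\<in>UNIV. P x * lratio P W x y) a) \<le> 1"
    by (intro prod_list_le_1) auto
  then show "0 \<le> (\<Sum>x | length x = n. plist P x * lik (lratio P W) x a)"
    "(\<Sum>x | length x = n. plist P x * lik (lratio P W) x a) \<le> 1"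
    unfolding sum_plist_lik[OF assms(3)] by auto
qed

type_synonym 'x codeword = "bool \<times> 'x list \<times> (int \<Rightarrow> 'x list)"

text \<open>The rule \<open>\<sigma>\<close> is left arbitrary: the coding argument only needs it to
  take finitely many values, and their number enters as a factor in the false-alarm bound.\<close>

locale two_phase =
  fixes W1 W2 :: "'x::finite \<Rightarrow> 'y::finite \<Rightarrow> real" and P :: "'x \<Rightarrow> real" and Ps :: "int \<Rightarrow> 'x \<Rightarrow> real"
    and St :: "int set" and \<sigma> :: "bool \<Rightarrow> ('x, 'y) triple list \<Rightarrow> int" and n1 n2 :: nat and \<gamma> :: real
  assumes W1: "stochastic W1" and W2: "stochastic W2"
    and P: "P \<in> prob_simplex" and St: "finite St" "\<And>\<beta> l. \<sigma> \<beta> l \<in> St"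
    and Ps: "\<And>s. s \<in> St \<Longrightarrow> Ps s \<in> prob_simplex"
begin

abbreviation "T \<equiv> triple_dist W1 W2"

text \<open>A codeword is a triple \<open>(\<beta>, x, u)\<close>: the user \<open>\<beta>\<close> to be favoured after a bad first phase, the
  first-phase word \<open>x\<close>, and a second-phase word \<open>u s\<close> for every state \<open>s\<close> chosen from the feedback.
  Decoders do not know the state; they accept if some state explains their output.\<close>

definition codewords :: "'x codeword set" where
  "codewords = UNIV \<times> {x. length x = n1} \<times> PiE St (\<lambda>_. {x. length x = n2})"

definition cweight :: "'x codeword \<Rightarrow> real" where
  "cweight w = 1/2 * plist P (fst (snd w)) * (\<Prod>s\<in>St. plist (Ps s) (snd (snd w) s))"

text \<open>Causal despite its form: before position \<open>n1\<close> only the first part is read,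
  and from there on the first \<open>n1\<close> outputs, hence the state, are known. With shorter
  outputs the state is meaningless but does not influence the letter used.\<close>

definition word :: "'x codeword \<Rightarrow> 'y list \<Rightarrow> 'y list \<Rightarrow> 'x list" where
  "word w a b = fst (snd w) @ snd (snd w) (\<sigma> (fst w) (zip (fst (snd w)) (zip (take n1 a) (take n1 b))))"

definition enc :: "'x codeword \<Rightarrow> nat \<Rightarrow> 'y list \<Rightarrow> 'y list \<Rightarrow> 'x \<Rightarrow> real" where
  "enc w i a b \<xi> = of_bool (\<xi> = word w a b ! i)"

text \<open>The message 0 is a dummy; the encoder is determined by the codeword alone.\<close>

definition pword :: "'x codeword \<Rightarrow> 'y list \<Rightarrow> 'y list \<Rightarrow> real" where
  "pword w a b = joint_prob W1 W2 (n1 + n2) (\<lambda>i j. enc w i) 0 a b"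

definition accepts :: "('x \<Rightarrow> 'y \<Rightarrow> real) \<Rightarrow> 'x codeword \<Rightarrow> 'y list \<Rightarrow> bool" where
  "accepts W w a \<longleftrightarrow> (\<exists>s\<in>St. exp \<gamma> < lik (lratio P W) (fst (snd w)) (take n1 a)
      * lik (lratio (Ps s) W) (snd (snd w) s) (drop n1 a))"

lemma finite_codewords: "finite codewords"
  unfolding codewords_def using St(1) by (intro finite_cartesian_product finite_PiE) auto

lemma sum_codewords:
  "(\<Sum>w\<in>codewords. F w) = (\<Sum>\<beta>\<in>UNIV. \<Sum>x | length x = n1. \<Sum>u\<in>PiE St (\<lambda>_. {x. length x = n2}). F (\<beta>, x, u))"
  unfolding codewords_def by (simp add: sum.cartesian_product split_def)

lemma sum_states_marginal:
  assumes "s \<in> St"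
  shows "(\<Sum>u\<in>PiE St (\<lambda>_. {x. length x = n2}). (\<Prod>s\<in>St. plist (Ps s) (u s)) * H (u s))
     = (\<Sum>x | length x = n2. plist (Ps s) x * H x)"
  by (rule sum_PiE_marginal) (use St assms in \<open>auto simp: sum_plist prob_simplexD[OF Ps]\<close>)

lemma cweight_nonneg: "0 \<le> cweight w"
  unfolding cweight_def using prob_simplexD(1)[OF P] prob_simplexD(1)[OF Ps]
  by (intro mult_nonneg_nonneg prod_nonneg plist_nonneg) auto

lemma sum_cweight: "sum cweight codewords = 1"
proof -
  have "\<sigma> True [] \<in> St" by (rule St(2))
  from sum_states_marginal[OF this, of "\<lambda>_. 1"]
  have u: "(\<Sum>u\<in>PiE St (\<lambda>_. {x. length x = n2}). (\<Prod>s\<in>St. plist (Ps s) (u s))) = 1"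
    by (simp add: sum_plist prob_simplexD(2)[OF Ps[OF \<open>\<sigma> True [] \<in> St\<close>]])
  have "sum cweight codewords = (\<Sum>\<beta>\<in>(UNIV :: bool set). \<Sum>x | length x = n1. 1/2 * plist P x)"
    by (simp only: sum_codewords cweight_def fst_conv snd_conv u mult_1_right flip: sum_distrib_left)
  also have "\<dots> = 1" unfolding sum_distrib_left[symmetric] sum_plist by (simp add: UNIV_bool prob_simplexD(2)[OF P])
  finally show ?thesis .
qed

lemma pword_nonneg: "0 \<le> pword w a b"
  unfolding pword_def joint_prob_def enc_def
  by (intro prod_nonneg sum_nonneg mult_nonneg_nonneg) (auto simp: stochasticD(1)[OF W1] stochasticD(1)[OF W2])

lemma sum_pword: "(\<Sum>a | length a = n1 + n2. \<Sum>b | length b = n1 + n2. pword w a b) = 1"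
proof -
  have "texp (code_kernel W1 W2 (\<lambda>i j. enc w i) 0) (n1 + n2) (\<lambda>l. 1) = 1"
    by (rule texp_const, rule sum_code_kernel) (use W1 W2 in \<open>auto simp: enc_def of_bool_def\<close>)
  then show ?thesis
    using texp_code_kernel[of W1 W2 "\<lambda>i j. enc w i" 0 "n1 + n2" "\<lambda>_ _. 1"] by (simp add: pword_def)
qed

text \<open>The completed first phase fixes the state \<open>s\<close>, so the second phase is a
  plain memoryless transmission of \<open>u s\<close>.\<close>

lemma pword_append:
  fixes \<beta> :: bool
  assumes "length x = n1" "length a1 = n1" "length b1 = n1" "length a2 = n2" "length b2 = n2"
    and "\<And>s. s \<in> St \<Longrightarrow> length (u s) = n2"
  defines "s \<equiv> \<sigma> \<beta> (zip x (zip a1 b1))"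
  shows "pword (\<beta>, x, u) (a1 @ a2) (b1 @ b2) = lik W1 x a1 * lik W2 x b1 * (lik W1 (u s) a2 * lik W2 (u s) b2)"
proof -
  let ?a = "a1 @ a2" and ?b = "b1 @ b2" and ?x = "x @ u s"
  have len: "length (u s) = n2" using assms(6) St(2) by (simp add: s_def)
  have "pword (\<beta>, x, u) ?a ?b = (\<Prod>i<n1 + n2. W1 (?x ! i) (?a ! i) * W2 (?x ! i) (?b ! i))"
    unfolding pword_def joint_prob_def
  proof (rule prod.cong[OF refl])
    fix i assume i: "i \<in> {..<n1 + n2}"
    have "word (\<beta>, x, u) (take i ?a) (take i ?b) ! i = ?x ! i"
    proof (cases "i < n1")
      case True then show ?thesis using assms(1) by (simp add: word_def nth_append)
    next
      case False
      then have "take n1 (take i ?a) = a1" "take n1 (take i ?b) = b1"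
        using assms(2,3) by (simp_all add: min_def)
      then show ?thesis by (simp add: word_def s_def)
    qed
    then show "(\<Sum>\<xi>\<in>UNIV. enc (\<beta>, x, u) i (take i ?a) (take i ?b) \<xi> * W1 \<xi> (?a ! i) * W2 \<xi> (?b ! i))
        = W1 (?x ! i) (?a ! i) * W2 (?x ! i) (?b ! i)"
      by (simp add: enc_def of_bool_def if_distrib if_distribR cong: if_cong)
  qed
  also have "\<dots> = lik W1 ?x ?a * lik W2 ?x ?b"
    unfolding prod.distrib using assms len
    by (subst (1 2) lik_conv_prod[where n = "n1 + n2"]) auto
  also have "\<dots> = lik W1 x a1 * lik W2 x b1 * (lik W1 (u s) a2 * lik W2 (u s) b2)"
    using assms by (simp add: lik_append)
  finally show ?thesis .
qed

text \<open>The state is a function of the coin and the first phase, which are independent of the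
  second-phase words. Only the component \<open>u s\<close> at the state used is sent, and its
  marginal is i.i.d. with law \<open>Ps s\<close>; the average is therefore a nested i.i.d.
  expectation.\<close>

lemma average_two_phase:
  assumes H: "\<And>\<beta> x u a1 a2 b1 b2. length x = n1 \<Longrightarrow> length a1 = n1 \<Longrightarrow> length b1 = n1 \<Longrightarrow>
      length a2 = n2 \<Longrightarrow> length b2 = n2 \<Longrightarrow> (\<And>s. s \<in> St \<Longrightarrow> length (u s) = n2) \<Longrightarrow>
      G (\<beta>, x, u) (a1 @ a2) (b1 @ b2) \<le>
        H \<beta> (zip x (zip a1 b1)) (zip (u (\<sigma> \<beta> (zip x (zip a1 b1)))) (zip a2 b2))"
  shows "(\<Sum>w\<in>codewords. cweight w * (\<Sum>a | length a = n1 + n2. \<Sum>b | length b = n1 + n2. pword w a b * G w a b))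
    \<le> 1/2 * (\<Sum>\<beta>\<in>UNIV. iid (T P) n1 (\<lambda>l. iid (T (Ps (\<sigma> \<beta> l))) n2 (H \<beta> l)))"
proof -
  let ?U = "PiE St (\<lambda>_. {x :: 'x list. length x = n2})" and ?A = "{a :: 'y list. length a = n1}" and ?B = "{a :: 'y list. length a = n2}"
  define K where "K \<beta> l x = (\<Sum>a\<in>?B. \<Sum>b\<in>?B. lik W1 x a * lik W2 x b * H \<beta> l (zip x (zip a b)))" for \<beta> l x
  define pu where "pu u = (\<Prod>s\<in>St. plist (Ps s) (u s))" for u
  define k where "k \<beta> x u a b = K \<beta> (zip x (zip a b)) (u (\<sigma> \<beta> (zip x (zip a b))))" for \<beta> x u a b
  define D where "D x a b = lik W1 x a * lik W2 x b" for x a b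
  have inner: "(\<Sum>a | length a = n1 + n2. \<Sum>b | length b = n1 + n2. pword (\<beta>, x, u) a b * G (\<beta>, x, u) a b)
      \<le> (\<Sum>a\<in>?A. \<Sum>b\<in>?A. D x a b * k \<beta> x u a b)"
    if x: "length x = n1" and u: "u \<in> ?U" for \<beta> x u
  proof -
    let ?F = "\<lambda>a1 a2 b1 b2. pword (\<beta>, x, u) (a1 @ a2) (b1 @ b2) * G (\<beta>, x, u) (a1 @ a2) (b1 @ b2)"
    have ul: "length (u s) = n2" if "s \<in> St" for s using u that by (auto simp: PiE_iff)
    have "(\<Sum>a | length a = n1 + n2. \<Sum>b | length b = n1 + n2. pword (\<beta>, x, u) a b * G (\<beta>, x, u) a b)
       = (\<Sum>a1\<in>?A. \<Sum>a2\<in>?B. \<Sum>b1\<in>?A. \<Sum>b2\<in>?B. ?F a1 a2 b1 b2)"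
      by (simp only: sum_lists_add)
    also have "\<dots> = (\<Sum>a1\<in>?A. \<Sum>b1\<in>?A. \<Sum>a2\<in>?B. \<Sum>b2\<in>?B. ?F a1 a2 b1 b2)"
      by (rule sum.cong[OF refl], rule sum.swap)
    also have "\<dots> \<le> (\<Sum>a\<in>?A. \<Sum>b\<in>?A. D x a b * k \<beta> x u a b)"
      unfolding k_def K_def sum_distrib_left
    proof (rule sum_mono, rule sum_mono, rule sum_mono, rule sum_mono)
      fix a1 b1 a2 b2 assume "a1 \<in> ?A" "b1 \<in> ?A" "a2 \<in> ?B" "b2 \<in> ?B"
      then have len: "length a1 = n1" "length b1 = n1" "length a2 = n2" "length b2 = n2" by auto
      let ?l = "zip x (zip a1 b1)"
      have pe: "pword (\<beta>, x, u) (a1 @ a2) (b1 @ b2) = D x a1 b1 * (lik W1 (u (\<sigma> \<beta> ?l)) a2 * lik W2 (u (\<sigma> \<beta> ?l)) b2)"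
        unfolding D_def by (rule pword_append) (use x len ul in auto)
      have "?F a1 a2 b1 b2 \<le> pword (\<beta>, x, u) (a1 @ a2) (b1 @ b2) * H \<beta> ?l (zip (u (\<sigma> \<beta> ?l)) (zip a2 b2))"
        by (intro mult_left_mono H pword_nonneg x len ul)
      then show "?F a1 a2 b1 b2 \<le> D x a1 b1 * (lik W1 (u (\<sigma> \<beta> ?l)) a2 * lik W2 (u (\<sigma> \<beta> ?l)) b2 * H \<beta> ?l (zip (u (\<sigma> \<beta> ?l)) (zip a2 b2)))"
        unfolding pe by (simp only: mult.assoc)
    qed
    finally show ?thesis .
  qed
  have marg: "(\<Sum>u\<in>?U. pu u * K \<beta> l (u (\<sigma> \<beta> l))) = iid (T (Ps (\<sigma> \<beta> l))) n2 (H \<beta> l)" for \<beta> l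
    unfolding pu_def sum_states_marginal[OF St(2), where H = "K \<beta> l"] texp_triple_dist
    unfolding K_def sum_distrib_left by (simp only: mult.assoc)
  have "(\<Sum>w\<in>codewords. cweight w * (\<Sum>a | length a = n1 + n2. \<Sum>b | length b = n1 + n2. pword w a b * G w a b))
     \<le> (\<Sum>\<beta>\<in>UNIV. \<Sum>x | length x = n1. \<Sum>u\<in>?U. cweight (\<beta>, x, u) * (\<Sum>a\<in>?A. \<Sum>b\<in>?A. D x a b * k \<beta> x u a b))"
    unfolding sum_codewords
    by (rule sum_mono, rule sum_mono, rule sum_mono, rule mult_left_mono[OF inner cweight_nonneg]) auto
  also have "\<dots> = (\<Sum>\<beta>\<in>UNIV. \<Sum>x | length x = n1. \<Sum>a\<in>?A. \<Sum>b\<in>?A. 1/2 * (plist P x * D x a b * (\<Sum>u\<in>?U. pu u * k \<beta> x u a b)))"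
  proof (rule sum.cong[OF refl], rule sum.cong[OF refl])
    fix \<beta> x
    let ?t = "\<lambda>u a b. 1/2 * (plist P x * D x a b * (pu u * k \<beta> x u a b))"
    have "(\<Sum>u\<in>?U. cweight (\<beta>, x, u) * (\<Sum>a\<in>?A. \<Sum>b\<in>?A. D x a b * k \<beta> x u a b)) = (\<Sum>u\<in>?U. \<Sum>a\<in>?A. \<Sum>b\<in>?A. ?t u a b)"
      unfolding sum_distrib_left by (intro sum.cong refl) (simp add: cweight_def pu_def)
    also have "\<dots> = (\<Sum>a\<in>?A. \<Sum>u\<in>?U. \<Sum>b\<in>?A. ?t u a b)" by (rule sum.swap)
    also have "\<dots> = (\<Sum>a\<in>?A. \<Sum>b\<in>?A. \<Sum>u\<in>?U. ?t u a b)" by (rule sum.cong[OF refl], rule sum.swap)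
    finally show "(\<Sum>u\<in>?U. cweight (\<beta>, x, u) * (\<Sum>a\<in>?A. \<Sum>b\<in>?A. D x a b * k \<beta> x u a b))
      = (\<Sum>a\<in>?A. \<Sum>b\<in>?A. 1/2 * (plist P x * D x a b * (\<Sum>u\<in>?U. pu u * k \<beta> x u a b)))"
      unfolding sum_distrib_left .
  qed
  also have "\<dots> = 1/2 * (\<Sum>\<beta>\<in>UNIV. iid (T P) n1 (\<lambda>l. iid (T (Ps (\<sigma> \<beta> l))) n2 (H \<beta> l)))"
    unfolding k_def marg texp_triple_dist[of W1 W2 P] sum_distrib_left D_def by (simp only: mult.assoc)
  finally show ?thesis .
qed

text \<open>For a fixed output and a fixed state, the product of the two ratios has mean at most 1
  over a random codeword; Markov's inequality gives \<open>exp (- \<gamma>)\<close>, and a union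
  over the states gives the factor \<open>card St\<close>.\<close>

lemma false_alarm:
  assumes W: "stochastic W" and a: "length a = n1 + n2"
  shows "(\<Sum>w\<in>codewords. cweight w * of_bool (accepts W w a)) \<le> real (card St) * exp (- \<gamma>)"
proof -
  let ?U = "PiE St (\<lambda>_. {x :: 'x list. length x = n2})"
  let ?f = "\<lambda>x. lik (lratio P W) x (take n1 a)" and ?g = "\<lambda>s x. lik (lratio (Ps s) W) x (drop n1 a)"
  have f0: "0 \<le> ?f x" for x by (intro lik_nonneg lratio_nonneg W prob_simplexD(1)[OF P])
  have g0: "0 \<le> ?g s x" if "s \<in> St" for s x by (intro lik_nonneg lratio_nonneg W prob_simplexD(1)[OF Ps[OF that]])
  have "(\<Sum>w\<in>codewords. cweight w * of_bool (accepts W w a))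
     \<le> (\<Sum>w\<in>codewords. cweight w * (\<Sum>s\<in>St. exp (- \<gamma>) * (?f (fst (snd w)) * ?g s (snd (snd w) s))))"
  proof (intro sum_mono mult_left_mono cweight_nonneg)
    fix w :: "'x codeword"
    let ?t = "\<lambda>s. exp (- \<gamma>) * (?f (fst (snd w)) * ?g s (snd (snd w) s))"
    have t0: "0 \<le> ?t s" if "s \<in> St" for s using f0 g0[OF that] by simp
    show "of_bool (accepts W w a) \<le> (\<Sum>s\<in>St. ?t s)"
    proof (cases "accepts W w a")
      case True
      then obtain s where s: "s \<in> St" "exp \<gamma> < ?f (fst (snd w)) * ?g s (snd (snd w) s)" by (auto simp: accepts_def)
      have "1 = exp (- \<gamma>) * exp \<gamma>" by (simp add: exp_minus)
      also have "\<dots> \<le> ?t s" using s(2) by (intro mult_left_mono) auto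
      also have "\<dots> \<le> (\<Sum>s\<in>St. ?t s)" using s(1) t0 St(1) by (intro member_le_sum) auto
      finally show ?thesis using True by simp
    qed (use t0 in \<open>auto intro: sum_nonneg\<close>)
  qed
  also have "\<dots> = (\<Sum>s\<in>St. \<Sum>w\<in>codewords. exp (- \<gamma>) * (cweight w * (?f (fst (snd w)) * ?g s (snd (snd w) s))))"
    unfolding sum_distrib_left by (subst sum.swap) (simp only: mult.left_commute)
  also have "\<dots> \<le> (\<Sum>s\<in>St. exp (- \<gamma>))"
  proof (rule sum_mono)
    fix s assume s: "s \<in> St"
    have "(\<Sum>w\<in>codewords. cweight w * (?f (fst (snd w)) * ?g s (snd (snd w) s)))
       = (\<Sum>\<beta>\<in>(UNIV :: bool set). \<Sum>x | length x = n1. \<Sum>u\<in>?U. 1/2 * (plist P x * ?f x) * ((\<Prod>s\<in>St. plist (Ps s) (u s)) * ?g s (u s)))"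
      unfolding sum_codewords cweight_def by (intro sum.cong refl) simp
    also have "\<dots> = (\<Sum>\<beta>\<in>(UNIV :: bool set). \<Sum>x | length x = n1. 1/2 * (plist P x * ?f x) * (\<Sum>x | length x = n2. plist (Ps s) x * ?g s x))"
      by (intro sum.cong refl) (simp only: sum_distrib_left[symmetric] sum_states_marginal[OF s, where H = "?g s"])
    also have "\<dots> = (\<Sum>\<beta>\<in>(UNIV :: bool set). 1/2 * (\<Sum>x | length x = n1. plist P x * ?f x) * (\<Sum>x | length x = n2. plist (Ps s) x * ?g s x))"
      by (intro sum.cong refl) (simp only: sum_distrib_left[symmetric] sum_distrib_right[symmetric])
    also have "\<dots> = (\<Sum>x | length x = n1. plist P x * ?f x) * (\<Sum>x | length x = n2. plist (Ps s) x * ?g s x)"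
      by (simp add: UNIV_bool)
    also have "\<dots> \<le> 1"
      using a by (intro mult_le_one sum_plist_lratio_le_1 W prob_simplexD(1)[OF P] prob_simplexD(1)[OF Ps[OF s]]) auto
    finally show "(\<Sum>w\<in>codewords. exp (- \<gamma>) * (cweight w * (?f (fst (snd w)) * ?g s (snd (snd w) s)))) \<le> exp (- \<gamma>)"
      unfolding sum_distrib_left[symmetric] by simp
  qed
  finally show ?thesis by simp
qed

text \<open>The test at the state actually used. A decoder accepts if any state passes, so this
  overestimates its rejections while involving only two i.i.d. phases.\<close>

definition miss :: "('x \<Rightarrow> 'y \<Rightarrow> real) \<Rightarrow> (('x, 'y) triple \<Rightarrow> 'y) \<Rightarrow> bool \<Rightarrow> ('x, 'y) triple list \<Rightarrow> ('x, 'y) triple list \<Rightarrow> real" where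
  "miss W \<pi> \<beta> l l' = of_bool (\<not> exp \<gamma> < prod_list (map (\<lambda>om. lratio P W (fst om) (\<pi> om)) l)
     * prod_list (map (\<lambda>om. lratio (Ps (\<sigma> \<beta> l)) W (fst om) (\<pi> om)) l'))"

lemma not_accepts_le_miss:
  assumes len: "length x = n1" "length a1 = n1" "length b1 = n1" "length a2 = n2" "length b2 = n2" "\<And>s. s \<in> St \<Longrightarrow> length (u s) = n2"
  defines "l \<equiv> zip x (zip a1 b1)"
  shows "of_bool (\<not> accepts W (\<beta>, x, u) (a1 @ a2)) \<le> miss W out1 \<beta> l (zip (u (\<sigma> \<beta> l)) (zip a2 b2))"
    "of_bool (\<not> accepts W (\<beta>, x, u) (b1 @ b2)) \<le> miss W out2 \<beta> l (zip (u (\<sigma> \<beta> l)) (zip a2 b2))"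
proof -
  have 1: "map (\<lambda>om. h (fst om) (out1 om)) l = map2 h x a1" "map (\<lambda>om. h (fst om) (out2 om)) l = map2 h x b1" for h :: "'x \<Rightarrow> 'y \<Rightarrow> real"
    unfolding l_def by (rule map_triples; use len in simp)+
  have 2: "map (\<lambda>om. h (fst om) (out1 om)) (zip (u (\<sigma> \<beta> l)) (zip a2 b2)) = map2 h (u (\<sigma> \<beta> l)) a2"
    "map (\<lambda>om. h (fst om) (out2 om)) (zip (u (\<sigma> \<beta> l)) (zip a2 b2)) = map2 h (u (\<sigma> \<beta> l)) b2" for h :: "'x \<Rightarrow> 'y \<Rightarrow> real"
    by (rule map_triples; use len St(2) in simp)+
  show "of_bool (\<not> accepts W (\<beta>, x, u) (a1 @ a2)) \<le> miss W out1 \<beta> l (zip (u (\<sigma> \<beta> l)) (zip a2 b2))"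
    "of_bool (\<not> accepts W (\<beta>, x, u) (b1 @ b2)) \<le> miss W out2 \<beta> l (zip (u (\<sigma> \<beta> l)) (zip a2 b2))"
    using len St(2)[of \<beta> l] unfolding miss_def 1 2 by (auto simp: accepts_def lik_def)
qed

lemma two_phase_code:
  assumes e1: "1/2 * (\<Sum>\<beta>\<in>UNIV. iid (T P) n1
        (\<lambda>l. iid (T (Ps (\<sigma> \<beta> l))) n2 (miss W1 out1 \<beta> l))) \<le> e"
    and e2: "1/2 * (\<Sum>\<beta>\<in>UNIV. iid (T P) n1
        (\<lambda>l. iid (T (Ps (\<sigma> \<beta> l))) n2 (miss W2 out2 \<beta> l))) \<le> e"
    and M: "1 \<le> M"
  defines "\<delta> \<equiv> 2 / real M + 2 * (real (card St) * exp (- \<gamma>)) * real M"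
  assumes \<epsilon>: "e + sqrt \<delta> + \<delta> \<le> \<epsilon>"
  shows "\<exists>f g1 g2. is_flf_code W1 W2 (n1 + n2) M \<epsilon> f g1 g2"
proof -
  let ?L = "{a :: 'y list. length a = n1 + n2}"
  obtain c g1 g2 where c: "\<And>j. j \<in> {1..M} \<Longrightarrow> c j \<in> codewords"
    and r1: "(\<Sum>j\<in>{1..M}. \<Sum>a\<in>?L. \<Sum>b\<in>?L. pword (c j) a b * of_bool (g1 a \<noteq> j)) \<le> real M * (e + sqrt \<delta> + \<delta>)"
    and r2: "(\<Sum>j\<in>{1..M}. \<Sum>a\<in>?L. \<Sum>b\<in>?L. pword (c j) a b * of_bool (g2 b \<noteq> j)) \<le> real M * (e + sqrt \<delta> + \<delta>)"
    unfolding \<delta>_def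
  proof (rule random_coding[where S = codewords and \<mu> = cweight and A = ?L and B = ?L and p = pword
        and ?R1.0 = "accepts W1" and ?R2.0 = "accepts W2" and e = e and \<theta> = "real (card St) * exp (- \<gamma>)" and M = M])
    show "(\<Sum>w\<in>codewords. cweight w * (\<Sum>a\<in>?L. \<Sum>b\<in>?L. pword w a b * of_bool (\<not> accepts W1 w a))) \<le> e"
      by (rule order_trans[OF average_two_phase e1]) (rule not_accepts_le_miss(1))
    show "(\<Sum>w\<in>codewords. cweight w * (\<Sum>a\<in>?L. \<Sum>b\<in>?L. pword w a b * of_bool (\<not> accepts W2 w b))) \<le> e"
      by (rule order_trans[OF average_two_phase e2]) (rule not_accepts_le_miss(2))
  qed (use finite_codewords cweight_nonneg sum_cweight pword_nonneg sum_pword false_alarm W1 W2 M in auto)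
  define f where "f i j a b = enc (c j) i a b" for i j a b
  have jp: "joint_prob W1 W2 (n1 + n2) f j a b = pword (c j) a b" for j a b
    by (simp add: joint_prob_def pword_def f_def)
  have Mp: "0 < real M" using M by simp
  have err: "err_prob W1 W2 (n1 + n2) M f g \<le> \<epsilon>"
    if "(\<Sum>j\<in>{1..M}. \<Sum>a\<in>?L. \<Sum>b\<in>?L. pword (c j) a b * of_bool (g a b \<noteq> j)) \<le> real M * (e + sqrt \<delta> + \<delta>)" for g
  proof -
    have "err_prob W1 W2 (n1 + n2) M f g = (1 / real M) * (\<Sum>j\<in>{1..M}. \<Sum>a\<in>?L. \<Sum>b\<in>?L. pword (c j) a b * of_bool (g a b \<noteq> j))"
      unfolding err_prob_def jp by (intro arg_cong2[where f = "(*)"] refl sum.cong) auto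
    also have "\<dots> \<le> (1 / real M) * (real M * (e + sqrt \<delta> + \<delta>))"
      using that by (intro mult_left_mono) auto
    finally show ?thesis using \<epsilon> Mp by simp
  qed
  have "is_flf_code W1 W2 (n1 + n2) M \<epsilon> f g1 g2"
    unfolding is_flf_code_def
    using M err[of "\<lambda>a b. g1 a"] err[of "\<lambda>a b. g2 b"] r1 r2
    by (auto simp: f_def enc_def of_bool_def)
  then show ?thesis by blast
qed

end

section \<open>Steering the two users\<close>

lemma sum_triple_dist_info:
  assumes "stochastic W1" "stochastic W2" "Q \<in> prob_simplex"
  shows "sum (triple_dist W1 W2 Q) UNIV = 1"
    "(\<Sum>om\<in>UNIV. triple_dist W1 W2 Q om * info_dens Q W1 (fst om) (out1 om)) = mutinf Q W1"
    "(\<Sum>om\<in>UNIV. triple_dist W1 W2 Q om * info_dens Q W2 (fst om) (out2 om)) = mutinf Q W2"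
  using sum_triple_dist(1)[OF assms(1,2), of Q "\<lambda>_ _. 1"] prob_simplexD(2)[OF assms(3)]
    sum_triple_dist(1)[OF assms(1,2), of Q "info_dens Q W1"] sum_triple_dist(2)[OF assms(1,2), of Q "info_dens Q W2"]
  by (simp_all add: stochasticD(2)[OF assms(1)] mutinf_def kl_row_sum info_dens_def)

lemma weighted_mean_abs_le:
  fixes p g :: "'w::finite \<Rightarrow> real"
  assumes "\<And>om. 0 \<le> p om" "sum p UNIV = 1" "\<And>om. 0 < p om \<Longrightarrow> \<bar>g om\<bar> \<le> R"
  shows "\<bar>\<Sum>om\<in>UNIV. p om * g om\<bar> \<le> R"
proof -
  have "\<bar>\<Sum>om\<in>UNIV. p om * g om\<bar> \<le> (\<Sum>om\<in>UNIV. p om * R)"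
  proof (rule order_trans[OF sum_abs sum_mono])
    fix om show "\<bar>p om * g om\<bar> \<le> p om * R"
      using assms(1)[of om] assms(3)[of om] by (cases "p om = 0") (auto simp: abs_mult intro!: mult_left_mono)
  qed
  then show ?thesis using assms(2) by (simp flip: sum_distrib_right)
qed

lemma iid_lower_tail_bounded:
  fixes p g :: "'w::finite \<Rightarrow> real"
  assumes p: "\<And>om. 0 \<le> p om" "sum p UNIV = 1"
    and g: "(\<Sum>om\<in>UNIV. p om * g om) = m" "\<And>om. 0 < p om \<Longrightarrow> \<bar>g om\<bar> \<le> R" "0 < R"
    and t: "0 \<le> t" "t \<le> 8 * real n * R" and n: "0 < n"
  shows "iid p n (\<lambda>l. of_bool (sum_list (map g l) \<le> real n * m - t)) \<le> exp (- t\<^sup>2 / (32 * real n * R\<^sup>2))"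
proof -
  have "\<bar>m\<bar> \<le> R" using weighted_mean_abs_le[of p g R] p g by auto
  \<comment> \<open>Centring at most doubles the bound on \<open>g\<close>, which turns the 8 of
    \<open>iid_lower_tail\<close> into 32.\<close>
  then have b: "\<bar>g om - m\<bar> \<le> 2 * R" if "0 < p om" for om using g(2)[OF that] by linarith
  have "iid p n (\<lambda>l. of_bool (sum_list (map g l) \<le> real n * m - t)) \<le> exp (- t\<^sup>2 / (8 * real n * (2 * R)\<^sup>2))"
    by (rule iid_lower_tail[OF p g(1) b]) (use g t n in auto)
  then show ?thesis by (simp add: power_mult_distrib mult.assoc)
qed

lemma iid_upper_tail_bounded:
  fixes p g :: "'w::finite \<Rightarrow> real"
  assumes p: "\<And>om. 0 \<le> p om" "sum p UNIV = 1"
    and g: "(\<Sum>om\<in>UNIV. p om * g om) = m" "\<And>om. 0 < p om \<Longrightarrow> \<bar>g om\<bar> \<le> R" "0 < R"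
    and t: "0 \<le> t" "t \<le> 8 * real n * R" and n: "0 < n"
  shows "iid p n (\<lambda>l. of_bool (real n * m + t \<le> sum_list (map g l))) \<le> exp (- t\<^sup>2 / (32 * real n * R\<^sup>2))"
proof -
  have s: "sum_list (map (\<lambda>om. - g om) l) = - sum_list (map g l)" for l by (induction l) auto
  have "iid p n (\<lambda>l. of_bool (sum_list (map (\<lambda>om. - g om) l) \<le> real n * (- m) - t)) \<le> exp (- t\<^sup>2 / (32 * real n * R\<^sup>2))"
    by (rule iid_lower_tail_bounded[OF p]) (use g t n in \<open>auto simp: sum_negf\<close>)
  then show ?thesis unfolding s by (simp add: algebra_simps)
qed

text \<open>What matters is uniformity: one \<open>R\<close> and one \<open>Kq\<close> serve all
  tilts up to \<open>s0\<close>, so the tail and curvature estimates do not depend on the state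
  chosen by feedback.\<close>

locale steerable_bc = balanced_bc +
  fixes v :: "'a \<Rightarrow> real" and s0 R Kq :: real
  assumes v0: "sum v UNIV = 0" and dI1: "dI W1 P v \<noteq> 0"
    and C1: "mutinf P W1 = C" and C2: "mutinf P W2 = C"
    and s0: "0 < s0" "s0 \<le> 1"
    and tilt_pos: "\<And>r x. \<bar>r\<bar> \<le> s0 \<Longrightarrow> 0 < P x + r * v x"
    and R0: "0 < R"
    and R1: "\<And>r x y. \<bar>r\<bar> \<le> s0 \<Longrightarrow> 0 < W1 x y \<Longrightarrow> \<bar>info_dens (\<lambda>x. P x + r * v x) W1 x y\<bar> \<le> R"
    and R2: "\<And>r x y. \<bar>r\<bar> \<le> s0 \<Longrightarrow> 0 < W2 x y \<Longrightarrow> \<bar>info_dens (\<lambda>x. P x + r * v x) W2 x y\<bar> \<le> R"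
    and Kq0: "0 \<le> Kq"
    and quad1: "\<And>r. \<bar>r\<bar> \<le> s0 \<Longrightarrow> C + r * dI W1 P v - Kq * r\<^sup>2 \<le> mutinf (\<lambda>x. P x + r * v x) W1"
    and quad2: "\<And>r. \<bar>r\<bar> \<le> s0 \<Longrightarrow> C + r * dI W2 P v - Kq * r\<^sup>2 \<le> mutinf (\<lambda>x. P x + r * v x) W2"
begin

abbreviation "T \<equiv> triple_dist W1 W2"

definition tilt :: "real \<Rightarrow> 'a \<Rightarrow> real" where "tilt r = (\<lambda>x. P x + r * v x)"

definition a1 :: real where "a1 = dI W1 P v"
definition a2 :: real where "a2 = dI W2 P v"
definition c0 :: real where "c0 = min \<bar>a1\<bar> \<bar>a2\<bar>"

lemma tilt_simplex: "\<bar>r\<bar> \<le> s0 \<Longrightarrow> tilt r \<in> prob_simplex"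
  using tilt_pos[of r] prob_simplexD(2)[OF P_simplex] v0 less_imp_le
  by (auto simp: prob_simplex_def tilt_def sum.distrib simp flip: sum_distrib_left)

lemma tilt_0: "tilt 0 = P" by (simp add: tilt_def)

text \<open>The mixed divergence is constant in \<open>x\<close>, so it vanishes along a zero-sum
  direction: a tilt helps one user exactly at the expense of the other, in the weights
  \<open>\<eta>\<close> and \<open>1 - \<eta>\<close>.\<close>

lemma a_relation: "\<eta> * a1 + (1 - \<eta>) * a2 = 0"
proof -
  have "\<eta> * a1 + (1 - \<eta>) * a2 = (\<Sum>x\<in>UNIV. v x * (\<eta> * kl_row W1 x (outdist P W1) + (1 - \<eta>) * kl_row W2 x (outdist P W2)))"
    unfolding a1_def a2_def dI_def sum_distrib_left sum.distrib[symmetric]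
    by (intro sum.cong refl) (simp add: algebra_simps)
  also have "\<dots> = 0" unfolding balance using v0 by (simp flip: sum_distrib_right)
  finally show ?thesis .
qed

lemma a_nonzero: "a1 \<noteq> 0" "a2 \<noteq> 0" "0 < c0" "a1 - a2 = a1 / (1 - \<eta>)" "a1 - a2 = - a2 / \<eta>"
proof -
  show 1: "a1 \<noteq> 0" using dI1 by (simp add: a1_def)
  show 2: "a2 \<noteq> 0" using a_relation 1 \<eta> by auto
  show "0 < c0" using 1 2 by (simp add: c0_def)
  show "a1 - a2 = a1 / (1 - \<eta>)" "a1 - a2 = - a2 / \<eta>"
    using a_relation \<eta> by (auto simp: field_simps)
qed

text \<open>Pairs a channel with the matching output coordinate, so that each estimate is proved
  once for both users.\<close>

definition user :: "('a \<Rightarrow> 'b \<Rightarrow> real) \<Rightarrow> (('a, 'b) triple \<Rightarrow> 'b) \<Rightarrow> bool" where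
  "user W \<pi> \<longleftrightarrow> W = W1 \<and> \<pi> = out1 \<or> W = W2 \<and> \<pi> = out2"

lemma userI: "user W1 out1" "user W2 out2" by (auto simp: user_def)

lemma user_facts:
  assumes "user W \<pi>"
  shows "stochastic W" "mutinf P W = C"
    "\<And>Q. Q \<in> prob_simplex \<Longrightarrow> (\<Sum>om\<in>UNIV. T Q om * info_dens Q W (fst om) (\<pi> om)) = mutinf Q W"
    "\<And>Q om. 0 < T Q om \<Longrightarrow> 0 < W (fst om) (\<pi> om)"
    "\<And>r x y. \<bar>r\<bar> \<le> s0 \<Longrightarrow> 0 < W x y \<Longrightarrow> \<bar>info_dens (tilt r) W x y\<bar> \<le> R"
    "\<And>r. \<bar>r\<bar> \<le> s0 \<Longrightarrow> C + r * dI W P v - Kq * r\<^sup>2 \<le> mutinf (tilt r) W"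
    "\<bar>dI W P v\<bar> \<le> \<bar>a1\<bar> + \<bar>a2\<bar>"
proof -
  have pos: "0 < W1 (fst om) (out1 om)" "0 < W2 (fst om) (out2 om)" if "0 < T Q om" for Q om
    using that stochasticD(1)[OF W1, of "fst om" "out1 om"] stochasticD(1)[OF W2, of "fst om" "out2 om"]
    by (auto simp: triple_dist_def less_le)
  show "stochastic W" "mutinf P W = C" "\<bar>dI W P v\<bar> \<le> \<bar>a1\<bar> + \<bar>a2\<bar>"
    using assms W1 W2 C1 C2 by (auto simp: user_def a1_def a2_def)
  show "\<And>Q. Q \<in> prob_simplex \<Longrightarrow> (\<Sum>om\<in>UNIV. T Q om * info_dens Q W (fst om) (\<pi> om)) = mutinf Q W"
    "\<And>Q om. 0 < T Q om \<Longrightarrow> 0 < W (fst om) (\<pi> om)"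
    "\<And>r x y. \<bar>r\<bar> \<le> s0 \<Longrightarrow> 0 < W x y \<Longrightarrow> \<bar>info_dens (tilt r) W x y\<bar> \<le> R"
    "\<And>r. \<bar>r\<bar> \<le> s0 \<Longrightarrow> C + r * dI W P v - Kq * r\<^sup>2 \<le> mutinf (tilt r) W"
    using assms sum_triple_dist_info(2,3)[OF W1 W2] pos R1 R2 quad1 quad2 unfolding user_def tilt_def by auto
qed

definition dev :: "('a \<Rightarrow> 'b \<Rightarrow> real) \<Rightarrow> (('a, 'b) triple \<Rightarrow> 'b) \<Rightarrow> ('a, 'b) triple list \<Rightarrow> real" where
  "dev W \<pi> l = (\<Sum>om\<leftarrow>l. info_dens P W (fst om) (\<pi> om)) - real (length l) * C"
abbreviation "dev1 \<equiv> dev W1 out1"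
abbreviation "dev2 \<equiv> dev W2 out2"

lemma mixdens_dev: "sum_list (map mixdens l) = \<eta> * dev1 l + (1 - \<eta>) * dev2 l"
  by (induction l) (auto simp: dev_def mixdens_def algebra_simps)

text \<open>The tilt that makes both users finish at the mixed deviation, or, if that lies below \<open>z\<close>, the
  tilt that lifts the favoured user alone to \<open>z\<close>.\<close>
definition aim :: "real \<Rightarrow> real \<Rightarrow> bool \<Rightarrow> ('a, 'b) triple list \<Rightarrow> real" where
  "aim z m \<beta> l = (if z < sum_list (map mixdens l) then - (dev1 l - dev2 l) / (m * (a1 - a2))
     else if \<beta> then (z - dev1 l) / (m * a1) else (z - dev2 l) / (m * a2))"

text \<open>Since \<open>a1 / (a1 - a2) = 1 - \<eta>\<close> and
  \<open>a2 / (a1 - a2) = - \<eta>\<close>, removing the difference of the deviations turns each of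
  them into the mixture \<open>\<eta> * dev1 l + (1 - \<eta>) * dev2 l\<close>.\<close>

lemma aim_gain:
  assumes "0 < m"
  shows "z < sum_list (map mixdens l) \<or> \<beta> \<Longrightarrow> z \<le> dev1 l + m * a1 * aim z m \<beta> l"
    "z < sum_list (map mixdens l) \<or> \<not> \<beta> \<Longrightarrow> z \<le> dev2 l + m * a2 * aim z m \<beta> l"
proof -
  have q1: "a1 / (a1 - a2) = 1 - \<eta>" unfolding a_nonzero(4) using a_nonzero(1) \<eta> by simp
  have q2: "a2 / (a1 - a2) = - \<eta>" unfolding a_nonzero(5) using a_nonzero(2) \<eta> by simp
  have e: "m * a * (- (dev1 l - dev2 l) / (m * (a1 - a2))) = - (dev1 l - dev2 l) * (a / (a1 - a2))" for a
    using assms by simp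
  show "z \<le> dev1 l + m * a1 * aim z m \<beta> l" if "z < sum_list (map mixdens l) \<or> \<beta>"
  proof (cases "z < sum_list (map mixdens l)")
    case True
    then have "m * a1 * aim z m \<beta> l = - (dev1 l - dev2 l) * (1 - \<eta>)" unfolding aim_def if_P[OF True] e q1 by simp
    then show ?thesis using True mixdens_dev[of l] by (simp add: algebra_simps)
  next
    case False
    then show ?thesis using that assms a_nonzero by (simp add: aim_def)
  qed
  show "z \<le> dev2 l + m * a2 * aim z m \<beta> l" if "z < sum_list (map mixdens l) \<or> \<not> \<beta>"
  proof (cases "z < sum_list (map mixdens l)")
    case True
    then have "m * a2 * aim z m \<beta> l = - (dev1 l - dev2 l) * (- \<eta>)" unfolding aim_def if_P[OF True] e q2 by simp
    then show ?thesis using True mixdens_dev[of l] by (simp add: algebra_simps)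
  next
    case False
    then show ?thesis using that assms a_nonzero by (simp add: aim_def)
  qed
qed

lemma aim_bound:
  assumes "0 < m" "\<bar>dev1 l\<bar> \<le> t" "\<bar>dev2 l\<bar> \<le> t" "\<bar>z\<bar> \<le> t"
  shows "\<bar>aim z m \<beta> l\<bar> \<le> 2 * t / (m * c0)"
proof -
  have *: "\<bar>x / (m * a)\<bar> \<le> 2 * t / (m * c0)" if "\<bar>x\<bar> \<le> 2 * t" "c0 \<le> \<bar>a\<bar>" for x a
    using that assms(1) a_nonzero(3) by (auto simp: abs_mult intro!: frac_le)
  \<comment> \<open>Opposite signs give \<open>\<bar>a1\<bar> \<le> \<bar>a1 - a2\<bar>\<close>, so
    \<open>c0\<close> bounds all three denominators in \<open>aim\<close> from below.\<close>
  have "a1 * a2 < 0"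
  proof -
    have "a2 = - (\<eta> / (1 - \<eta>)) * a1" using a_relation \<eta> by (simp add: field_simps)
    then have "a1 * a2 = - (\<eta> / (1 - \<eta>) * a1\<^sup>2)" by (simp add: power2_eq_square)
    then show ?thesis using a_nonzero(1) \<eta> by simp
  qed
  then have "\<bar>a1\<bar> \<le> \<bar>a1 - a2\<bar>" by (auto simp: mult_less_0_iff)
  then have "c0 \<le> \<bar>a1 - a2\<bar>" "c0 \<le> \<bar>a1\<bar>" "c0 \<le> \<bar>a2\<bar>" by (auto simp: c0_def)
  moreover have "\<bar>- (dev1 l - dev2 l)\<bar> \<le> 2 * t" "\<bar>z - dev1 l\<bar> \<le> 2 * t" "\<bar>z - dev2 l\<bar> \<le> 2 * t" using assms by auto
  ultimately show ?thesis unfolding aim_def using * by presburger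
qed

lemma triple_dist_prob:
  assumes "Q \<in> prob_simplex"
  shows "\<And>om. 0 \<le> T Q om" "sum (T Q) UNIV = 1"
  using triple_dist_nonneg[OF W1 W2 prob_simplexD(1)[OF assms]] sum_triple_dist_info(1)[OF W1 W2 assms] by auto

lemma tilt_tail:
  assumes u: "user W \<pi>" and r: "\<bar>r\<bar> \<le> s0" and n: "0 < n" and t: "0 \<le> t" "t \<le> 8 * real n * R"
  shows "iid (T (tilt r)) n (\<lambda>l. of_bool
        ((\<Sum>om\<leftarrow>l. info_dens (tilt r) W (fst om) (\<pi> om)) \<le> real n * mutinf (tilt r) W - t)) \<le> exp (- t\<^sup>2 / (32 * real n * R\<^sup>2))"
    "iid (T (tilt r)) n (\<lambda>l. of_bool
        (real n * mutinf (tilt r) W + t \<le> (\<Sum>om\<leftarrow>l. info_dens (tilt r) W (fst om) (\<pi> om)))) \<le> exp (- t\<^sup>2 / (32 * real n * R\<^sup>2))"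
  by (rule iid_lower_tail_bounded iid_upper_tail_bounded;
      use triple_dist_prob[OF tilt_simplex[OF r]] user_facts(3)[OF u tilt_simplex[OF r]]
        user_facts(4,5)[OF u] R0 r n t in auto)+

definition good :: "real \<Rightarrow> ('a, 'b) triple list \<Rightarrow> bool" where
  "good t l \<longleftrightarrow> \<bar>dev1 l\<bar> \<le> t \<and> \<bar>dev2 l\<bar> \<le> t"

lemma not_good_prob:
  assumes "0 < n" "0 \<le> t" "t \<le> 8 * real n * R"
  shows "iid (T P) n (\<lambda>l. of_bool (\<not> good t l)) \<le> 4 * exp (- t\<^sup>2 / (32 * real n * R\<^sup>2))"
proof -
  let ?i1 = "\<lambda>l. \<Sum>om\<leftarrow>l. info_dens P W1 (fst om) (out1 om)" and ?i2 = "\<lambda>l. \<Sum>om\<leftarrow>l. info_dens P W2 (fst om) (out2 om)"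
  have "iid (T P) n (\<lambda>l. of_bool (\<not> good t l))
    \<le> iid (T P) n (\<lambda>l. of_bool (?i1 l \<le> real n * C - t) + of_bool (?i2 l \<le> real n * C - t)
        + of_bool (real n * C + t \<le> ?i1 l) + of_bool (real n * C + t \<le> ?i2 l))"
    by (rule texp_mono) (auto simp: good_def dev_def triple_dist_prob[OF P_simplex])
  also have "\<dots> \<le> 4 * exp (- t\<^sup>2 / (32 * real n * R\<^sup>2))"
    unfolding texp_add using tilt_tail[OF userI(1), of 0 n t] tilt_tail[OF userI(2), of 0 n t] s0 assms
    unfolding tilt_0 C1 C2 by simp
  finally show ?thesis .
qed

text \<open>The threshold \<open>\<gamma>\<close> is a budget. Rounding the aimed tilt
  \<open>\<rho>\<close> to \<open>r\<close> costs at most \<open>\<bar>dI W P v\<bar>\<close>,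
  because \<open>m \<le> n\<close>; curvature costs at most \<open>Kq * B\<close>; the fluctuation
  of the second phase costs \<open>t\<close>, except with the stated probability.\<close>

lemma second_phase_miss:
  assumes u: "user W \<pi>" and r: "\<bar>r\<bar> \<le> s0" "\<bar>r - \<rho>\<bar> \<le> 1 / real n" and m: "0 < m" "m \<le> n"
    and t: "0 \<le> t" "t \<le> 8 * real m * R" and B: "real m * r\<^sup>2 \<le> B"
    and \<gamma>: "\<gamma> \<le> real (length l) * C + real m * C + z - \<bar>a1\<bar> - \<bar>a2\<bar> - Kq * B - t"
    and l: "\<And>om. om \<in> set l \<Longrightarrow> 0 < W (fst om) (\<pi> om)" and g: "z \<le> dev W \<pi> l + real m * dI W P v * \<rho>"
  shows "iid (T (tilt r)) m (\<lambda>l'. of_bool (\<not> exp \<gamma> <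
        prod_list (map (\<lambda>om. lratio P W (fst om) (\<pi> om)) l) * prod_list (map (\<lambda>om. lratio (tilt r) W (fst om) (\<pi> om)) l')))
      \<le> exp (- t\<^sup>2 / (32 * real m * R\<^sup>2))" (is "texp ?k m ?F \<le> _")
proof -
  let ?a = "dI W P v" and ?I = "mutinf (tilt r) W"
  have tp: "\<And>x. 0 < tilt r x" using tilt_pos[OF r(1)] by (simp add: tilt_def)
  note W = user_facts(1)[OF u]
  have d: "z - \<bar>a1\<bar> - \<bar>a2\<bar> - Kq * B \<le> dev W \<pi> l + real m * (?I - C)"
  proof -
    have "real m * (r * ?a - Kq * r\<^sup>2) \<le> real m * (?I - C)"
      using user_facts(6)[OF u r(1)] by (intro mult_left_mono) auto
    then have 1: "real m * ?a * r - Kq * (real m * r\<^sup>2) \<le> real m * (?I - C)" by (simp add: algebra_simps)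
    have 2: "Kq * (real m * r\<^sup>2) \<le> Kq * B" using B Kq0 by (rule mult_left_mono)
    have "\<bar>real m * ?a * (r - \<rho>)\<bar> = \<bar>?a\<bar> * (real m * \<bar>r - \<rho>\<bar>)" by (simp add: abs_mult)
    also have "\<dots> \<le> \<bar>?a\<bar> * (real n * (1 / real n))" using r(2) m by (intro mult_left_mono mult_mono) auto
    also have "\<dots> = \<bar>?a\<bar>" using m by simp
    finally have 3: "real m * ?a * \<rho> - \<bar>?a\<bar> \<le> real m * ?a * r" by (simp add: algebra_simps abs_le_iff)
    show ?thesis using 1 2 3 g user_facts(7)[OF u] by linarith
  qed
  have "texp ?k m ?F \<le> texp ?k m (\<lambda>l'. of_bool ((\<Sum>om\<leftarrow>l'. info_dens (tilt r) W (fst om) (\<pi> om)) \<le> real m * ?I - t))"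
  proof (rule texp_mono_support)
    fix l' :: "('a, 'b) triple list" assume l': "length l' = m" "\<And>i. i < m \<Longrightarrow> 0 < T (tilt r) (l' ! i)"
    have w: "0 < W (fst om) (\<pi> om)" if "om \<in> set l'" for om
      using user_facts(4)[OF u, of "tilt r" om] l' that by (auto simp: in_set_conv_nth)
    let ?A = "prod_list (map (\<lambda>om. lratio P W (fst om) (\<pi> om)) l)" and ?B = "prod_list (map (\<lambda>om. lratio (tilt r) W (fst om) (\<pi> om)) l')"
    have p: "\<And>om. om \<in> set l \<Longrightarrow> 0 < lratio P W (fst om) (\<pi> om)" "\<And>om. om \<in> set l' \<Longrightarrow> 0 < lratio (tilt r) W (fst om) (\<pi> om)"
      using lratio_pos[where P = P, OF W P_pos] lratio_pos[where P = "tilt r", OF W tp] l w by auto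
    have AB: "0 < ?A" "0 < ?B" by (auto intro!: prod_list_map_pos p)
    have "ln (?A * ?B) = (\<Sum>om\<leftarrow>l. info_dens P W (fst om) (\<pi> om)) + (\<Sum>om\<leftarrow>l'. info_dens (tilt r) W (fst om) (\<pi> om))"
      unfolding ln_mult_pos[OF AB] ln_lratio[symmetric] by (subst (1 2) ln_prod_list) (auto intro: p)
    moreover have "ln (?A * ?B) \<le> \<gamma>" if "\<not> exp \<gamma> < ?A * ?B"
      using that AB ln_le_cancel_iff[of "?A * ?B" "exp \<gamma>"] by simp
    ultimately show "?F l' \<le> of_bool ((\<Sum>om\<leftarrow>l'. info_dens (tilt r) W (fst om) (\<pi> om)) \<le> real m * ?I - t)"
      using d \<gamma> by (auto simp: dev_def algebra_simps)
  qed (use triple_dist_nonneg[OF W1 W2 less_imp_le[OF tp]] in auto)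
  also have "\<dots> \<le> exp (- t\<^sup>2 / (32 * real m * R\<^sup>2))" by (rule tilt_tail(1)[OF u r(1) m(1) t])
  finally show ?thesis .
qed

lemma one_shot_code:
  assumes n: "0 < n1" "0 < n2" "n = n1 + n2"
    and t1: "0 \<le> t1" "t1 \<le> 8 * real n1 * R" and t2: "0 \<le> t2" "t2 \<le> 8 * real n2 * R"
    and z: "\<bar>z\<bar> \<le> t1" and small: "2 * t1 / (real n2 * c0) + 1 / real n \<le> s0" and M: "1 \<le> M"
    and \<gamma>: "\<gamma> = real n * C + z - \<bar>a1\<bar> - \<bar>a2\<bar> - Kq * (8 * t1\<^sup>2 / (real n2 * c0\<^sup>2) + 2) - t2"
    and pz: "iid (T P) n1 (\<lambda>l. of_bool (sum_list (map mixdens l) \<le> z)) \<le> pz"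
    and \<delta>: "\<delta> = 2 / real M + 2 * (3 * real n * exp (- \<gamma>)) * real M"
    and err: "4 * exp (- t1\<^sup>2 / (32 * real n1 * R\<^sup>2)) + pz / 2 + exp (- t2\<^sup>2 / (32 * real n2 * R\<^sup>2)) + sqrt \<delta> + \<delta> \<le> \<epsilon>"
  shows "\<exists>f g1 g2. is_flf_code W1 W2 n M \<epsilon> f g1 g2"
proof -
  \<comment> \<open>The states are the multiples of \<open>1 / n\<close> in the admissible range:
    rounding shifts the second-phase mean by a bounded amount, and there are at most
    \<open>3 * n\<close> states.\<close>
  define N where "N = \<lfloor>real n * s0\<rfloor>"
  define St where "St = {-N..N}"
  \<comment> \<open>After an atypical first phase the state defaults to 0, the untilted law. That
    event is counted as a failure anyway; the default keeps the state in \<open>St\<close>.\<close>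
  define \<sigma> where "\<sigma> \<beta> l = (if good t1 l then \<lfloor>real n * aim z (real n2) \<beta> l\<rfloor> else 0)" for \<beta> l
  define Ps where "Ps s = tilt (real_of_int s / real n)" for s :: int
  have np: "0 < real n" "0 < real n2" using n by auto
  have N0: "0 \<le> N" using np s0 by (simp add: N_def)
  have Ns: "real_of_int N \<le> real n * s0" by (simp add: N_def)
  have St_r: "\<bar>real_of_int s / real n\<bar> \<le> s0" if "s \<in> St" for s
  proof -
    have "\<bar>real_of_int s\<bar> \<le> real_of_int N" using that by (auto simp: St_def abs_le_iff)
    then have "\<bar>real_of_int s\<bar> \<le> real n * s0" using Ns by linarith
    then show ?thesis using np by (simp add: field_simps)
  qed
  have round: "\<bar>real_of_int \<lfloor>real n * x\<rfloor> / real n - x\<bar> \<le> 1 / real n" for x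
  proof -
    have "\<bar>real_of_int \<lfloor>real n * x\<rfloor> - real n * x\<bar> \<le> 1" by linarith
    then have "\<bar>real_of_int \<lfloor>real n * x\<rfloor> - real n * x\<bar> / real n \<le> 1 / real n" using np by (intro divide_right_mono) auto
    moreover have "real_of_int \<lfloor>real n * x\<rfloor> / real n - x = (real_of_int \<lfloor>real n * x\<rfloor> - real n * x) / real n"
      using np by (simp add: field_simps)
    ultimately show ?thesis using np by (simp add: abs_divide)
  qed
  have aimb: "\<bar>aim z (real n2) \<beta> l\<bar> \<le> 2 * t1 / (real n2 * c0)" if "good t1 l" for \<beta> l
    using that z np by (intro aim_bound) (auto simp: good_def)
  have \<sigma>g: "\<bar>real_of_int (\<sigma> \<beta> l) / real n - aim z (real n2) \<beta> l\<bar> \<le> 1 / real n"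
    "\<bar>real_of_int (\<sigma> \<beta> l) / real n\<bar> \<le> 2 * t1 / (real n2 * c0) + 1 / real n" if "good t1 l" for \<beta> l
  proof -
    show "\<bar>real_of_int (\<sigma> \<beta> l) / real n - aim z (real n2) \<beta> l\<bar> \<le> 1 / real n"
      using round[of "aim z (real n2) \<beta> l"] that by (simp add: \<sigma>_def)
    then show "\<bar>real_of_int (\<sigma> \<beta> l) / real n\<bar> \<le> 2 * t1 / (real n2 * c0) + 1 / real n"
      using aimb[OF that, of \<beta>] by linarith
  qed
  have \<sigma>St: "\<sigma> \<beta> l \<in> St" for \<beta> l
  proof (cases "good t1 l")
    case True
    have "\<bar>real_of_int (\<sigma> \<beta> l) / real n\<bar> \<le> s0" using \<sigma>g(2)[OF True, of \<beta>] small by linarith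
    then have "\<bar>real_of_int (\<sigma> \<beta> l)\<bar> \<le> real n * s0" using np by (simp add: field_simps)
    then have "\<sigma> \<beta> l \<le> N" "- \<sigma> \<beta> l \<le> N" unfolding N_def by (auto simp: le_floor_iff abs_le_iff)
    then show ?thesis by (simp add: St_def)
  qed (use N0 in \<open>simp add: \<sigma>_def St_def\<close>)
  interpret tp: two_phase W1 W2 P Ps St \<sigma> n1 n2 \<gamma>
    by unfold_locales (use W1 W2 P_simplex \<sigma>St tilt_simplex[OF St_r] in \<open>auto simp: Ps_def St_def\<close>)
  have cardSt: "real (card St) \<le> 3 * real n"
  proof -
    have "real (card St) = 2 * real_of_int N + 1" using N0 by (simp add: St_def)
    also have "\<dots> \<le> 2 * (real n * 1) + 1" using Ns s0 np mult_left_mono[of s0 1 "real n"] by linarith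
    finally show ?thesis using n by simp
  qed
  let ?\<tau>1 = "4 * exp (- t1\<^sup>2 / (32 * real n1 * R\<^sup>2))" and ?\<tau>2 = "exp (- t2\<^sup>2 / (32 * real n2 * R\<^sup>2))"
  let ?k1 = "\<lambda>_ :: ('a, 'b) triple list. T P" and ?k2 = "\<lambda>s (_ :: ('a, 'b) triple list). T (Ps s)"
  have k1: "0 \<le> T P om" "sum (T P) UNIV = 1" for om
    using triple_dist_prob[OF P_simplex] by auto
  have k2: "0 \<le> T (Ps s) om" "sum (T (Ps s)) UNIV = 1" if "s \<in> St" for s om
    using triple_dist_prob[OF tp.Ps[OF that]] by auto
  have le1: "texp (?k2 (\<sigma> \<beta> l)) n2 F \<le> 1" if "\<And>l'. F l' \<le> 1" for \<beta> l F
    by (rule texp_le_const) (use k2[OF \<sigma>St] that in auto)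
  have second: "texp (?k2 (\<sigma> \<beta> l)) n2 (tp.miss W \<pi> \<beta> l) \<le> ?\<tau>2"
    if u: "user W \<pi>" and l: "length l = n1" "\<And>i. i < n1 \<Longrightarrow> 0 < T P (l ! i)" and g: "good t1 l"
      and gain: "z \<le> dev W \<pi> l + real n2 * dI W P v * aim z (real n2) \<beta> l" for W \<pi> \<beta> l
  proof -
    let ?r = "real_of_int (\<sigma> \<beta> l) / real n"
    let ?x = "2 * t1 / (real n2 * c0)"
    have lw: "0 < W (fst om) (\<pi> om)" if "om \<in> set l" for om
      using user_facts(4)[OF u, of P om] l that by (auto simp: in_set_conv_nth)
    have x0: "0 \<le> ?x" using t1 np a_nonzero(3) by simp
    have "?r\<^sup>2 \<le> (?x + 1 / real n)\<^sup>2" using \<sigma>g(2)[OF g, of \<beta>] by (metis abs_ge_zero power2_abs power_mono)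
    also have "\<dots> \<le> 2 * ?x\<^sup>2 + 2 * (1 / real n)\<^sup>2"
    proof -
      have "(a + b)\<^sup>2 \<le> 2 * a\<^sup>2 + 2 * b\<^sup>2" for a b :: real
        using zero_le_power2[of "a - b"] by (simp add: power2_eq_square algebra_simps)
      then show ?thesis .
    qed
    finally have "real n2 * ?r\<^sup>2 \<le> real n2 * (2 * ?x\<^sup>2 + 2 * (1 / real n)\<^sup>2)" using np by (intro mult_left_mono) auto
    also have "\<dots> = 8 * t1\<^sup>2 / (real n2 * c0\<^sup>2) + 2 * (real n2 / (real n)\<^sup>2)"
      using np by (simp add: power2_eq_square field_simps)
    also have "real n2 / (real n)\<^sup>2 \<le> 1"
    proof -
      have "real n2 \<le> real n * 1" using n by simp
      also have "\<dots> \<le> real n * real n" using n by (intro mult_left_mono) auto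
      finally show ?thesis using np by (simp add: power2_eq_square)
    qed
    finally have B: "real n2 * ?r\<^sup>2 \<le> 8 * t1\<^sup>2 / (real n2 * c0\<^sup>2) + 2" by simp
    show ?thesis
      unfolding tp.miss_def[abs_def] Ps_def
      by (rule second_phase_miss[OF u St_r[OF \<sigma>St] \<sigma>g(1)[OF g] n(2) _ t2 B _ lw gain])
         (use n l in \<open>auto simp: \<gamma> algebra_simps\<close>)
  qed
  \<comment> \<open>\<open>b\<close> is the coin value favouring the user under study. Only the
    other value lets this user suffer from a mixed density below \<open>z\<close>, so the average
    over the coin halves \<open>pz\<close>.\<close>
  have half: "1/2 * (\<Sum>\<beta>\<in>UNIV. texp ?k1 n1 (\<lambda>l. texp (?k2 (\<sigma> \<beta> l)) n2 (F \<beta> l))) \<le> ?\<tau>1 + pz / 2 + ?\<tau>2"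
    if F: "\<And>\<beta> l l'. F \<beta> l l' \<le> 1"
      "\<And>\<beta> l. length l = n1 \<Longrightarrow> (\<And>i. i < n1 \<Longrightarrow> 0 < T P (l ! i)) \<Longrightarrow> good t1 l \<Longrightarrow>
         z < sum_list (map mixdens l) \<or> \<beta> = b \<Longrightarrow> texp (?k2 (\<sigma> \<beta> l)) n2 (F \<beta> l) \<le> ?\<tau>2" for F b
  proof -
    have "texp ?k1 n1 (\<lambda>l. texp (?k2 (\<sigma> \<beta> l)) n2 (F \<beta> l)) \<le> ?\<tau>1 + of_bool (\<beta> \<noteq> b) * pz + ?\<tau>2" for \<beta>
    proof -
      have "texp ?k1 n1 (\<lambda>l. texp (?k2 (\<sigma> \<beta> l)) n2 (F \<beta> l))
        \<le> texp ?k1 n1 (\<lambda>l. of_bool (\<not> good t1 l) + of_bool (\<beta> \<noteq> b) * of_bool (sum_list (map mixdens l) \<le> z) + ?\<tau>2)"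
      proof (rule texp_mono_support)
        fix l :: "('a, 'b) triple list" assume l: "length l = n1" "\<And>i. i < n1 \<Longrightarrow> 0 < T P (l ! i)"
        have le: "texp (?k2 (\<sigma> \<beta> l)) n2 (F \<beta> l) \<le> 1" by (rule le1) (rule F(1))
        have t0: "0 \<le> ?\<tau>2" by simp
        show "texp (?k2 (\<sigma> \<beta> l)) n2 (F \<beta> l) \<le> of_bool (\<not> good t1 l) + of_bool (\<beta> \<noteq> b) * of_bool (sum_list (map mixdens l) \<le> z) + ?\<tau>2"
        proof (cases "good t1 l \<and> (z < sum_list (map mixdens l) \<or> \<beta> = b)")
          case True
          then have "texp (?k2 (\<sigma> \<beta> l)) n2 (F \<beta> l) \<le> ?\<tau>2" using F(2)[OF l] by blast
          moreover have "(0::real) \<le> of_bool (\<not> good t1 l)" "(0::real) \<le> of_bool (\<beta> \<noteq> b) * of_bool (sum_list (map mixdens l) \<le> z)" by auto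
          ultimately show ?thesis by linarith
        next
          case False
          then have "(1::real) \<le> of_bool (\<not> good t1 l) + of_bool (\<beta> \<noteq> b) * of_bool (sum_list (map mixdens l) \<le> z)"
            by (auto simp: not_less)
          then show ?thesis using le t0 by linarith
        qed
      qed (use k1 in auto)
      also have "\<dots> = texp ?k1 n1 (\<lambda>l. of_bool (\<not> good t1 l)) + of_bool (\<beta> \<noteq> b) * texp ?k1 n1 (\<lambda>l. of_bool (sum_list (map mixdens l) \<le> z)) + ?\<tau>2"
        unfolding texp_add texp_cmult by (subst texp_const) (use k1 in auto)
      also have "\<dots> \<le> ?\<tau>1 + of_bool (\<beta> \<noteq> b) * pz + ?\<tau>2"
        using pz by (intro add_mono mult_left_mono not_good_prob n t1) auto
      finally show ?thesis .
    qed
    then have "(\<Sum>\<beta>\<in>UNIV. texp ?k1 n1 (\<lambda>l. texp (?k2 (\<sigma> \<beta> l)) n2 (F \<beta> l))) \<le> (\<Sum>\<beta>\<in>UNIV. ?\<tau>1 + of_bool (\<beta> \<noteq> b) * pz + ?\<tau>2)"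
      by (intro sum_mono)
    also have "\<dots> = 2 * (?\<tau>1 + pz / 2 + ?\<tau>2)" by (cases b) (simp_all add: UNIV_bool)
    finally show ?thesis by simp
  qed
  have e1: "1/2 * (\<Sum>\<beta>\<in>UNIV. texp ?k1 n1 (\<lambda>l. texp (?k2 (\<sigma> \<beta> l)) n2 (tp.miss W1 out1 \<beta> l))) \<le> ?\<tau>1 + pz / 2 + ?\<tau>2"
    by (rule half[where b = True]) (use second[OF userI(1)] aim_gain(1)[OF np(2)] in \<open>auto simp: tp.miss_def a1_def\<close>)
  have e2: "1/2 * (\<Sum>\<beta>\<in>UNIV. texp ?k1 n1 (\<lambda>l. texp (?k2 (\<sigma> \<beta> l)) n2 (tp.miss W2 out2 \<beta> l))) \<le> ?\<tau>1 + pz / 2 + ?\<tau>2"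
    by (rule half[where b = False]) (use second[OF userI(2)] aim_gain(2)[OF np(2)] in \<open>auto simp: tp.miss_def a2_def\<close>)
  define d where "d = 2 / real M + 2 * (real (card St) * exp (- \<gamma>)) * real M"
  have d: "d \<le> \<delta>" unfolding d_def \<delta> using cardSt by (intro add_mono mult_mono) auto
  then have "sqrt d \<le> sqrt \<delta>" by simp
  then have "?\<tau>1 + pz / 2 + ?\<tau>2 + sqrt d + d \<le> \<epsilon>" using err d by linarith
  then show ?thesis unfolding n(3) d_def by (intro tp.two_phase_code[OF e1 e2 M])
qed

end

section \<open>Uniform constants for small tilts, variance of the mixed density, choice of
  parameters\<close>

lemma info_dens_bound:
  assumes W: "stochastic W" and Q: "Q \<in> prob_simplex" "\<And>x. 0 < Q x" and P: "0 < p" "p / 2 \<le> Q x" and w: "0 < W x y"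
  shows "\<bar>info_dens Q W x y\<bar> \<le> \<bar>ln (2 / p)\<bar> + \<bar>ln (W x y)\<bar>"
proof -
  let ?O = "outdist Q W y"
  have O: "0 < ?O" by (rule outdist_pos_full[OF W Q(2) w])
  have "?O \<le> (\<Sum>y\<in>UNIV. outdist Q W y)"
    using outdist_nonneg[OF W less_imp_le[OF Q(2)]] by (intro member_le_sum) auto
  then have O1: "?O \<le> 1" using sum_outdist[OF W, of Q] prob_simplexD(2)[OF Q(1)] by simp
  have "p / 2 * W x y \<le> Q x * W x y" using P w by (intro mult_right_mono) auto
  also have "\<dots> \<le> ?O" by (rule outdist_ge[OF W less_imp_le[OF Q(2)]])
  finally have "W x y / ?O \<le> 2 / p" using O P w by (simp add: field_simps)
  then have u: "ln (W x y / ?O) \<le> ln (2 / p)" using O P w by (intro ln_mono) auto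
  have "W x y \<le> W x y / ?O" using O O1 w by (simp add: field_simps)
  then have "ln (W x y) \<le> ln (W x y / ?O)" using O w by (intro ln_mono) auto
  then show ?thesis using u unfolding info_dens_def by linarith
qed

lemma (in balanced_bc) exists_steerable:
  assumes "mutinf P W1 = C" "mutinf P W2 = C" "capacity W1 > C"
  obtains v s0 R Kq where "steerable_bc W1 W2 P \<eta> C v s0 R Kq"
proof -
  obtain v where v: "sum v UNIV = 0" "dI W1 P v \<noteq> 0"
    by (rule dI_nonzero[OF W1 P_simplex P_pos]) (use assms in auto)
  obtain K1 where K1: "0 \<le> K1" "\<And>s. (\<And>x. 0 < P x + s * v x) \<Longrightarrow>
     mutinf P W1 + s * dI W1 P v - K1 * s\<^sup>2 \<le> mutinf (\<lambda>x. P x + s * v x) W1"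
    using mutinf_quadratic[OF W1 P_simplex P_pos v(1)] by blast
  obtain K2 where K2: "0 \<le> K2" "\<And>s. (\<And>x. 0 < P x + s * v x) \<Longrightarrow>
     mutinf P W2 + s * dI W2 P v - K2 * s\<^sup>2 \<le> mutinf (\<lambda>x. P x + s * v x) W2"
    using mutinf_quadratic[OF W2 P_simplex P_pos v(1)] by blast
  define pm where "pm = Min (range P)"
  define vm where "vm = (\<Sum>x\<in>UNIV. \<bar>v x\<bar>)"
  have pm: "0 < pm" "\<And>x. pm \<le> P x" using P_pos by (auto simp: pm_def)
  have vm: "0 \<le> vm" "\<And>x. \<bar>v x\<bar> \<le> vm" unfolding vm_def by (auto intro!: sum_nonneg member_le_sum)
  \<comment> \<open>Keeps every tilted probability above half of \<open>P x\<close>, which bounds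
    the information densities uniformly; \<open>vm + 1\<close> guards against a zero
    denominator.\<close>
  define s0 where "s0 = min 1 (pm / (2 * (vm + 1)))"
  have s0: "0 < s0" "s0 \<le> 1" using pm vm by (auto simp: s0_def)
  have half: "P x / 2 \<le> P x + r * v x" if "\<bar>r\<bar> \<le> s0" for r x
  proof -
    have "\<bar>r * v x\<bar> \<le> (pm / (2 * (vm + 1))) * (vm + 1)"
      unfolding abs_mult using that vm(1) vm(2)[of x] pm(1) by (intro mult_mono) (auto simp: s0_def)
    also have "\<dots> = pm / 2" using vm by (simp add: field_simps)
    finally show ?thesis using pm(2)[of x] by linarith
  qed
  have pos: "0 < P x + r * v x" if "\<bar>r\<bar> \<le> s0" for r x using half[OF that, of x] P_pos[of x] by linarith
  have spl: "(\<lambda>x. P x + r * v x) \<in> prob_simplex" if "\<bar>r\<bar> \<le> s0" for r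
    using pos[OF that] prob_simplexD(2)[OF P_simplex] v(1) less_imp_le
    by (auto simp: prob_simplex_def sum.distrib simp flip: sum_distrib_left)
  define RW where "RW W = (\<Sum>x\<in>UNIV. \<Sum>y\<in>UNIV. \<bar>ln (W x y)\<bar>)" for W :: "'x \<Rightarrow> 'y \<Rightarrow> real"
  define RP where "RP = (\<Sum>x\<in>UNIV. \<bar>ln (2 / P x)\<bar>)"
  have RW: "\<bar>ln (W x y)\<bar> \<le> RW W" "0 \<le> RW W" for W x y
  proof -
    have "\<bar>ln (W x y)\<bar> \<le> (\<Sum>y\<in>UNIV. \<bar>ln (W x y)\<bar>)" by (rule member_le_sum) auto
    also have "\<dots> \<le> RW W" unfolding RW_def
      by (rule member_le_sum[of x UNIV "\<lambda>x. \<Sum>y\<in>UNIV. \<bar>ln (W x y)\<bar>"]) (auto intro: sum_nonneg)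
    finally show "\<bar>ln (W x y)\<bar> \<le> RW W" .
    then show "0 \<le> RW W" by linarith
  qed
  have RP: "\<bar>ln (2 / P x)\<bar> \<le> RP" "0 \<le> RP" for x unfolding RP_def by (auto intro!: member_le_sum sum_nonneg)
  define R where "R = 1 + RP + RW W1 + RW W2"
  define Kq where "Kq = K1 + K2"
  show thesis
  proof (rule that)
    show "steerable_bc W1 W2 P \<eta> C v s0 R Kq"
    proof unfold_locales
      show "0 < R" using RW(2)[of W1] RW(2)[of W2] RP(2) by (simp add: R_def)
      show "0 \<le> Kq" using K1 K2 by (simp add: Kq_def)
      fix r x y assume r: "\<bar>r\<bar> \<le> s0"
      let ?Q = "\<lambda>x. P x + r * v x"
      show "\<bar>info_dens ?Q W1 x y\<bar> \<le> R" if "0 < W1 x y"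
        using info_dens_bound[of W1 ?Q "P x" x y, OF W1 spl[OF r] pos[OF r] P_pos half[OF r] that]
          RW(1)[of W1 x y] RW(2)[of W2] RP(1)[of x] by (simp add: R_def)
      show "\<bar>info_dens ?Q W2 x y\<bar> \<le> R" if "0 < W2 x y"
        using info_dens_bound[of W2 ?Q "P x" x y, OF W2 spl[OF r] pos[OF r] P_pos half[OF r] that]
          RW(1)[of W2 x y] RW(2)[of W1] RP(1)[of x] by (simp add: R_def)
      have "K1 * r\<^sup>2 \<le> Kq * r\<^sup>2" "K2 * r\<^sup>2 \<le> Kq * r\<^sup>2" using K1(1) K2(1) by (auto simp: Kq_def intro!: mult_right_mono)
      then show "C + r * dI W1 P v - Kq * r\<^sup>2 \<le> mutinf ?Q W1" "C + r * dI W2 P v - Kq * r\<^sup>2 \<le> mutinf ?Q W2"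
        using K1(2)[of r, OF pos[OF r]] K2(2)[of r, OF pos[OF r]] assms by auto
    qed (use v assms s0 pos in auto)
  qed
qed

text \<open>By \<open>balance\<close>, \<open>C\<close> splits into the two row means. Given the
  input, the outputs are independent and both densities are then centred, so the cross term
  vanishes.\<close>

lemma (in balanced_bc) mixdens_variance:
  "(\<Sum>om\<in>UNIV. triple_dist W1 W2 P om * (mixdens om)\<^sup>2) = \<eta>\<^sup>2 * dispersion P W1 + (1 - \<eta>)\<^sup>2 * dispersion P W2"
proof -
  have row: "(\<Sum>y\<in>UNIV. \<Sum>z\<in>UNIV. W1 x y * W2 x z * (mixdens (x, y, z))\<^sup>2)
     = \<eta>\<^sup>2 * (\<Sum>y\<in>UNIV. W1 x y * (info_dens P W1 x y - kl_row W1 x (outdist P W1))\<^sup>2)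
     + (1 - \<eta>)\<^sup>2 * (\<Sum>y\<in>UNIV. W2 x y * (info_dens P W2 x y - kl_row W2 x (outdist P W2))\<^sup>2)" for x
  proof -
    define A where "A y = info_dens P W1 x y - kl_row W1 x (outdist P W1)" for y
    define B where "B z = info_dens P W2 x z - kl_row W2 x (outdist P W2)" for z
    have m: "mixdens (x, y, z) = \<eta> * A y + (1 - \<eta>) * B z" for y z
      using balance[of x] by (simp add: mixdens_def A_def B_def algebra_simps)
    have A0: "(\<Sum>y\<in>UNIV. W1 x y * A y) = 0"
      using stochasticD(2)[OF W1, of x]
      by (simp add: A_def right_diff_distrib sum_subtractf kl_row_sum info_dens_def flip: sum_distrib_right)
    have "(\<Sum>y\<in>UNIV. \<Sum>z\<in>UNIV. W1 x y * W2 x z * (mixdens (x, y, z))\<^sup>2)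
      = (\<Sum>y\<in>UNIV. \<Sum>z\<in>UNIV. \<eta>\<^sup>2 * (W1 x y * (A y)\<^sup>2) * W2 x z + (2 * \<eta> * (1 - \<eta>)) * (W1 x y * A y) * (W2 x z * B z)
          + (1 - \<eta>)\<^sup>2 * W1 x y * (W2 x z * (B z)\<^sup>2))"
      unfolding m by (intro sum.cong refl) (simp add: power2_eq_square algebra_simps)
    also have "\<dots> = \<eta>\<^sup>2 * (\<Sum>y\<in>UNIV. W1 x y * (A y)\<^sup>2) * (\<Sum>z\<in>UNIV. W2 x z)
       + (2 * \<eta> * (1 - \<eta>)) * (\<Sum>y\<in>UNIV. W1 x y * A y) * (\<Sum>z\<in>UNIV. W2 x z * B z)
       + (1 - \<eta>)\<^sup>2 * (\<Sum>y\<in>UNIV. W1 x y) * (\<Sum>z\<in>UNIV. W2 x z * (B z)\<^sup>2)"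
      by (simp only: sum.distrib sum_distrib_left[symmetric] sum_distrib_right[symmetric])
    finally show ?thesis using A0 stochasticD(2)[OF W1, of x] stochasticD(2)[OF W2, of x] by (simp add: A_def B_def)
  qed
  have disp: "dispersion P W = (\<Sum>x\<in>UNIV. P x * (\<Sum>y\<in>UNIV. W x y * (info_dens P W x y - kl_row W x (outdist P W))\<^sup>2))"
    for W :: "'x \<Rightarrow> 'y \<Rightarrow> real"
    unfolding dispersion_def by (intro sum.cong refl arg_cong2[where f = "(*)"] sum.mono_neutral_left) auto
  have "(\<Sum>om\<in>UNIV. triple_dist W1 W2 P om * (mixdens om)\<^sup>2)
      = (\<Sum>x\<in>UNIV. P x * (\<Sum>y\<in>UNIV. \<Sum>z\<in>UNIV. W1 x y * W2 x z * (mixdens (x, y, z))\<^sup>2))"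
    by (simp add: sum_triple triple_dist_def sum_distrib_left mult.assoc)
  also have "\<dots> = \<eta>\<^sup>2 * dispersion P W1 + (1 - \<eta>)\<^sup>2 * dispersion P W2"
    unfolding row disp sum_distrib_left[of "_\<^sup>2" "\<lambda>x. P x * _ x"] sum.distrib[symmetric] distrib_left
    by (simp add: sum_distrib_left sum.distrib mult_ac)
  finally show ?thesis .
qed

text \<open>The density is at least \<open>gauss (\<bar>q\<bar> + 1)\<close> on the interval
  crossed. A shift by \<open>\<kappa>\<close> thus lowers the tail linearly in
  \<open>\<kappa>\<close>, and this gain pays for all remaining error terms.\<close>

lemma Qfun_shift:
  assumes "0 \<le> \<kappa>" "\<kappa> \<le> 1"
  shows "Qfun (q + \<kappa>) \<le> Qfun q - \<kappa> * gauss (\<bar>q\<bar> + 1)"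
proof (cases "\<kappa> = 0")
  case False
  then have k: "q < q + \<kappa>" using assms by simp
  obtain z where z: "q < z" "z < q + \<kappa>" "Qfun (q + \<kappa>) - Qfun q = (q + \<kappa> - q) * (- gauss z)"
    using MVT2[OF k, of Qfun "\<lambda>x. - gauss x"] Qfun_has_derivative by blast
  have "\<bar>z\<bar> \<le> \<bar>q\<bar> + 1" using z assms by linarith
  then have "z\<^sup>2 \<le> (\<bar>q\<bar> + 1)\<^sup>2" by (metis abs_ge_zero power2_abs power_mono)
  then have "gauss (\<bar>q\<bar> + 1) \<le> gauss z"
    unfolding std_normal_density_def by (intro mult_left_mono) auto
  then have "\<kappa> * gauss (\<bar>q\<bar> + 1) \<le> \<kappa> * gauss z" using assms by (intro mult_left_mono)
  then show ?thesis using z(3) by simp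
qed simp

text \<open>Gathers every requirement on the size of \<open>n\<close>. The last three keep the
  threshold within the typical first-phase deviation, the tilts within \<open>s0\<close>, and the
  shift \<open>\<kappa>\<close> within 1.\<close>

lemma large_blocklength:
  fixes A B s K :: real
  assumes "0 < s"
  obtains n0 where "\<And>n :: nat. n0 \<le> n \<Longrightarrow> let x = real n in
     2 \<le> x \<and> 1 \<le> ln x \<and> 4 * x powr (2/3) \<le> x \<and> 2 * ln x \<le> x \<and> ln x \<le> 2 * x powr (2/3) \<and>
     A \<le> sqrt (ln x) \<and> B * (sqrt (x * ln x) / x powr (2/3)) + 1 / x \<le> s \<and> K * x powr (- 1/6) \<le> 1"
proof -
  have "filterlim (\<lambda>n. sqrt (ln (real n))) at_top sequentially" by real_asymp
  then have 1: "\<forall>\<^sub>F n in sequentially. A \<le> sqrt (ln (real n))" by (simp add: filterlim_at_top)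
  have "((\<lambda>n. sqrt (real n * ln (real n)) / real n powr (2/3)) \<longlongrightarrow> 0) sequentially" by real_asymp
  then have "((\<lambda>n. B * (sqrt (real n * ln (real n)) / real n powr (2/3)) + 1 / real n) \<longlongrightarrow> B * 0 + 0) sequentially"
    by (intro tendsto_intros lim_1_over_n)
  then have 2: "\<forall>\<^sub>F n in sequentially. B * (sqrt (real n * ln (real n)) / real n powr (2/3)) + 1 / real n < s"
    using assms by (intro order_tendstoD) auto
  have "((\<lambda>n. real n powr (- 1/6)) \<longlongrightarrow> 0) sequentially" by real_asymp
  then have "((\<lambda>n. K * real n powr (- 1/6)) \<longlongrightarrow> K * 0) sequentially" by (intro tendsto_intros)
  then have 3: "\<forall>\<^sub>F n in sequentially. K * real n powr (- 1/6) < 1" by (intro order_tendstoD) auto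
  have 4: "\<forall>\<^sub>F n in sequentially. 2 \<le> real n" "\<forall>\<^sub>F n in sequentially. 1 \<le> ln (real n)"
    "\<forall>\<^sub>F n in sequentially. 4 * real n powr (2/3) \<le> real n" "\<forall>\<^sub>F n in sequentially. 2 * ln (real n) \<le> real n"
    "\<forall>\<^sub>F n in sequentially. ln (real n) \<le> 2 * real n powr (2/3)" by real_asymp+
  have "\<forall>\<^sub>F n :: nat in sequentially. let x = real n in
     2 \<le> x \<and> 1 \<le> ln x \<and> 4 * x powr (2/3) \<le> x \<and> 2 * ln x \<le> x \<and> ln x \<le> 2 * x powr (2/3) \<and>
     A \<le> sqrt (ln x) \<and> B * (sqrt (x * ln x) / x powr (2/3)) + 1 / x \<le> s \<and> K * x powr (- 1/6) \<le> 1"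
    unfolding Let_def using 1 2 3 4 by eventually_elim auto
  then show thesis using that unfolding eventually_sequentially by blast
qed

section \<open>Asymptotics\<close>

lemma trivial_code:
  assumes "P \<in> prob_simplex" "0 \<le> \<epsilon>"
  shows "is_flf_code W1 W2 n 1 \<epsilon> (\<lambda>_ _ _ _. P) (\<lambda>_. 1) (\<lambda>_. 1)"
  using assms prob_simplexD[OF assms(1)] by (simp add: is_flf_code_def err_prob_def)

context steerable_bc
begin

definition Vmix :: real where "Vmix = \<eta>\<^sup>2 * dispersion P W1 + (1 - \<eta>)\<^sup>2 * dispersion P W2"

lemma achievability:
  assumes V: "0 < Vmix" and \<epsilon>: "0 < \<epsilon>" "\<epsilon> < 1/2"
  shows "\<exists>K (n0::nat). \<forall>n\<ge>n0. \<exists>M f g1 g2. is_flf_code W1 W2 n M \<epsilon> f g1 g2 \<and>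
     real n * C - sqrt (real n * Vmix) * Qinv (2 * \<epsilon>) - K * real n powr (1/3) * ln (real n) \<le> ln (real M)"
proof -
  let ?p = "triple_dist W1 W2 P"
  have p: "\<And>om. 0 \<le> ?p om" "sum ?p UNIV = 1"
    using triple_dist_nonneg[OF W1 W2 prob_simplexD(1)[OF P_simplex]] sum_triple_dist_info(1)[OF W1 W2 P_simplex] by auto
  have mb: "\<bar>mixdens om\<bar> \<le> (\<Sum>om\<in>UNIV. \<bar>mixdens om\<bar>)" for om by (rule member_le_sum) auto
  obtain Kc where Kc: "0 \<le> Kc" "\<And>N y. 1 \<le> N \<Longrightarrow> iid ?p N (\<lambda>l. of_bool (sum_list (map mixdens l) \<le> - (sqrt (real N * Vmix) * y)))
        \<le> Qfun y + Kc * (1 + \<bar>y\<bar>) * real N powr (- 1/6)"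
    by (rule iid_lower_tail_gaussian[OF p sum_triple_dist_mixdens, where V = Vmix and R = "\<Sum>om\<in>UNIV. \<bar>mixdens om\<bar>"])
       (use mixdens_variance V mb in \<open>auto simp: Vmix_def intro: sum_nonneg\<close>)
  define q where "q = Qinv (2 * \<epsilon>)"
  have q: "Qfun q = 2 * \<epsilon>" unfolding q_def by (rule Qfun_Qinv) (use \<epsilon> in auto)
  define c where "c = gauss (\<bar>q\<bar> + 1)"
  have c: "0 < c" unfolding c_def by (rule normal_density_pos) simp
  \<comment> \<open>Chosen so that the gain \<open>\<kappa> * c\<close> covers the central limit
    error, at most \<open>2 * Kc * (2 + \<bar>q\<bar>) * n^(-1/6)\<close>, and leaves
    \<open>34 * n^(-1/6)\<close>; after halving, 17 remain to absorb the other errors, at most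
    \<open>16 / n\<close>.\<close>
  define Ks where "Ks = (2 * Kc * (2 + \<bar>q\<bar>) + 34) / c"
  have Ks0: "0 \<le> Ks" using Kc(1) c by (simp add: Ks_def)
  define K where "K = 2 * \<bar>q\<bar> * sqrt Vmix + sqrt Vmix * Ks + \<bar>a1\<bar> + \<bar>a2\<bar> + Kq * (256 * R\<^sup>2 / c0\<^sup>2 + 2) + 8 * R + 6"
  obtain n0 where n0: "\<And>n :: nat. n0 \<le> n \<Longrightarrow> let x = real n in
     2 \<le> x \<and> 1 \<le> ln x \<and> 4 * x powr (2/3) \<le> x \<and> 2 * ln x \<le> x \<and> ln x \<le> 2 * x powr (2/3) \<and>
     sqrt Vmix * (\<bar>q\<bar> + 1) / (R * sqrt 32) \<le> sqrt (ln x) \<and> (2 * R * sqrt 32 / c0) * (sqrt (x * ln x) / x powr (2/3)) + 1 / x \<le> s0 \<and> Ks * x powr (- 1/6) \<le> 1"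
    using large_blocklength[OF s0(1), where A = "sqrt Vmix * (\<bar>q\<bar> + 1) / (R * sqrt 32)" and B = "2 * R * sqrt 32 / c0" and K = Ks]
    by blast
  have "\<exists>M f g1 g2. is_flf_code W1 W2 n M \<epsilon> f g1 g2 \<and>
     real n * C - sqrt (real n * Vmix) * q - K * real n powr (1/3) * ln (real n) \<le> ln (real M)" if "n0 \<le> n" for n
  proof -
    define x where "x = real n"
    define L where "L = ln x"
    define w where "w = x powr (1/3)"
    note cond = n0[OF that, unfolded Let_def, folded x_def, folded L_def]
    have x2: "2 \<le> x" and L1: "1 \<le> L" and x4: "4 * x powr (2/3) \<le> x" and L2: "2 * L \<le> x" and L3: "L \<le> 2 * x powr (2/3)"
      and cV: "sqrt Vmix * (\<bar>q\<bar> + 1) / (R * sqrt 32) \<le> sqrt L"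
      and cs: "(2 * R * sqrt 32 / c0) * (sqrt (x * L) / x powr (2/3)) + 1 / x \<le> s0" and ck: "Ks * x powr (- 1/6) \<le> 1"
      using cond by auto
    have x0: "0 < x" "1 \<le> x" using x2 by auto
    have w1: "1 \<le> w" unfolding w_def using x0 by (simp add: ge_one_powr_ge_zero)
    have p23: "1 \<le> x powr (2/3)" using x0 by (simp add: ge_one_powr_ge_zero)
    define n2 where "n2 = nat \<lceil>x powr (2/3)\<rceil>"
    have n2a: "x powr (2/3) \<le> real n2" unfolding n2_def by linarith
    have n2b: "real n2 \<le> 2 * x powr (2/3)" unfolding n2_def using p23 by linarith
    have n2x: "real n2 \<le> x / 2" using n2b x4 by linarith
    have n2n: "n2 \<le> n" using n2x x0 unfolding x_def by simp
    have n2p: "0 < n2" using n2a p23 by (cases n2) auto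
    define n1 where "n1 = n - n2"
    have n1r: "real n1 = x - real n2" using n2n by (simp add: n1_def x_def)
    have n1h: "x / 2 \<le> real n1" "real n1 \<le> x" using n1r n2x by auto
    have n1p: "0 < n1" using n1h x0 by (cases n1) auto
    have nsum: "n = n1 + n2" using n2n by (simp add: n1_def)
    define \<kappa> where "\<kappa> = Ks * x powr (- 1/6)"
    have \<kappa>: "0 \<le> \<kappa>" "\<kappa> \<le> 1" using Ks0 ck by (auto simp: \<kappa>_def)
    define y where "y = q + \<kappa>"
    define z where "z = - (sqrt (real n1 * Vmix) * y)"
    \<comment> \<open>Both deviations are scaled so that the exponential tail bounds are at most
      \<open>exp (- L) = 1 / x\<close>.\<close>
    define t1 where "t1 = R * sqrt (32 * (x * L))"
    define t2 where "t2 = R * sqrt (32 * (real n2 * L))"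
    have L0: "0 < L" using L1 by simp
    have t1sq: "t1\<^sup>2 = 32 * R\<^sup>2 * (x * L)" using x0 L0 by (simp add: t1_def power_mult_distrib)
    have t2sq: "t2\<^sup>2 = 32 * R\<^sup>2 * (real n2 * L)" using L0 by (simp add: t2_def power_mult_distrib)
    have t1n: "0 \<le> t1" using R0 x0 L0 by (simp add: t1_def)
    have t2n: "0 \<le> t2" using R0 L0 by (simp add: t2_def)
    have t1u: "t1 \<le> 8 * real n1 * R"
    proof -
      have "32 * (x * L) \<le> (8 * real n1)\<^sup>2"
      proof -
        have "32 * (x * L) = 16 * (x * (2 * L))" by simp
        also have "\<dots> \<le> 16 * (x * x)" using L2 x0 by (intro mult_left_mono) auto
        also have "\<dots> = (4 * x)\<^sup>2" by (simp add: power2_eq_square)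
        also have "\<dots> \<le> (8 * real n1)\<^sup>2" using n1h x0 by (intro power_mono) auto
        finally show ?thesis .
      qed
      then have "sqrt (32 * (x * L)) \<le> 8 * real n1" by (intro real_le_lsqrt) auto
      then show ?thesis unfolding t1_def using R0 mult_left_mono[of _ "8 * real n1" R] by (simp add: mult.commute)
    qed
    have t2u: "t2 \<le> 8 * real n2 * R"
    proof -
      have "32 * (real n2 * L) \<le> 32 * (real n2 * (2 * real n2))" using L3 n2a by (intro mult_left_mono) auto
      also have "\<dots> = (8 * real n2)\<^sup>2" by (simp add: power2_eq_square)
      finally have "sqrt (32 * (real n2 * L)) \<le> 8 * real n2" by (intro real_le_lsqrt) auto
      then show ?thesis unfolding t2_def using R0 mult_left_mono[of _ "8 * real n2" R] by (simp add: mult.commute)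
    qed
    have ya: "\<bar>y\<bar> \<le> \<bar>q\<bar> + 1" using \<kappa> by (auto simp: y_def)
    have zt: "\<bar>z\<bar> \<le> t1"
    proof -
      have "\<bar>z\<bar> = sqrt (real n1) * sqrt Vmix * \<bar>y\<bar>" using V by (simp add: z_def abs_mult real_sqrt_mult)
      also have "\<dots> \<le> sqrt x * sqrt Vmix * (\<bar>q\<bar> + 1)" using n1h ya V by (intro mult_mono) auto
      also have "\<dots> = sqrt x * (sqrt Vmix * (\<bar>q\<bar> + 1))" by simp
      also have "\<dots> \<le> sqrt x * (R * sqrt 32 * sqrt L)"
        using cV R0 x0 by (intro mult_left_mono) (auto simp: divide_le_eq mult_ac)
      also have "\<dots> = t1" by (simp add: t1_def real_sqrt_mult)
      finally show ?thesis .
    qed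
    have small: "2 * t1 / (real n2 * c0) + 1 / real n \<le> s0"
    proof -
      have "2 * t1 / (real n2 * c0) \<le> 2 * t1 / (x powr (2/3) * c0)"
        using t1n n2a p23 a_nonzero(3) by (intro divide_left_mono mult_right_mono mult_pos_pos) auto
      also have "\<dots> = (2 * R * sqrt 32 / c0) * (sqrt (x * L) / x powr (2/3))"
        by (simp add: t1_def real_sqrt_mult mult_ac)
      finally show ?thesis using cs by (simp add: x_def)
    qed
    define \<gamma> where "\<gamma> = real n * C + z - \<bar>a1\<bar> - \<bar>a2\<bar> - Kq * (8 * t1\<^sup>2 / (real n2 * c0\<^sup>2) + 2) - t2"
    have xw: "x powr (2/3) * w = x" using x0 by (simp add: w_def flip: powr_add)
    have pw: "x powr (-1/6) \<le> 1" using x0 powr_mono[of "-1/6" 0 x] by simp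
    have lower: "x * C - sqrt (x * Vmix) * q - K * w * L \<le> \<gamma> - 6 * L"
    proof -
      have wL: "w \<le> w * L" "L \<le> w * L" "1 \<le> w * L"
        using w1 L1 mult_left_mono[of 1 L w] mult_right_mono[of 1 w L] mult_mono[of 1 w 1 L] by auto
      have sV: "0 \<le> sqrt Vmix" using V by simp
      have z_lb: "- sqrt (x * Vmix) * q - (2 * \<bar>q\<bar> * sqrt Vmix + sqrt Vmix * Ks) * w \<le> z"
      proof -
        \<comment> \<open>Leaving the second phase out of the dispersion term costs only about
          \<open>n2 / sqrt x\<close>, of order \<open>x^(1/6)\<close>.\<close>
        have sx: "sqrt x - sqrt (real n1) \<le> 2 * w"
        proof -
          have s: "0 < sqrt x" "sqrt (real n1) \<le> sqrt x" using x0 n1h by auto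
          have "(sqrt x - sqrt (real n1)) * sqrt x \<le> (sqrt x - sqrt (real n1)) * (sqrt x + sqrt (real n1))"
            using s by (intro mult_left_mono) auto
          also have "\<dots> = real n2" using x0 n1r by (simp add: algebra_simps)
          also have "\<dots> \<le> 2 * x powr (2/3)" by (rule n2b)
          also have "\<dots> \<le> 2 * (w * sqrt x)"
          proof -
            have "w * sqrt x = x powr (5/6)" using x0 by (simp add: w_def powr_half_sqrt[symmetric] flip: powr_add)
            then show ?thesis using x0 by (simp add: powr_mono)
          qed
          finally have "(sqrt x - sqrt (real n1)) * sqrt x \<le> (2 * w) * sqrt x" by simp
          then show ?thesis using s by simp
        qed
        have d: "sqrt (x * Vmix) * q - sqrt (real n1 * Vmix) * q = sqrt Vmix * ((sqrt x - sqrt (real n1)) * q)"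
          by (simp add: real_sqrt_mult algebra_simps)
        have "sqrt (real n1) \<le> sqrt x" using n1h by simp
        then have "\<bar>(sqrt x - sqrt (real n1)) * q\<bar> \<le> 2 * w * \<bar>q\<bar>"
          unfolding abs_mult using sx by (intro mult_right_mono) auto
        then have "sqrt Vmix * ((sqrt x - sqrt (real n1)) * q) \<ge> sqrt Vmix * (- (2 * w * \<bar>q\<bar>))"
          using sV by (intro mult_left_mono) auto
        then have e1: "- sqrt (x * Vmix) * q - 2 * \<bar>q\<bar> * sqrt Vmix * w \<le> - sqrt (real n1 * Vmix) * q"
          using d by (simp add: algebra_simps)
        have "sqrt (real n1) * x powr (-1/6) \<le> sqrt x * x powr (-1/6)"
          using n1h by (intro mult_right_mono) auto
        also have "\<dots> = w" using x0 by (simp add: w_def powr_half_sqrt[symmetric] flip: powr_add)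
        finally have "(sqrt Vmix * Ks) * (sqrt (real n1) * x powr (-1/6)) \<le> (sqrt Vmix * Ks) * w"
          using sV Ks0 by (intro mult_left_mono) auto
        then have e2: "sqrt (real n1 * Vmix) * \<kappa> \<le> sqrt Vmix * Ks * w"
          by (simp add: \<kappa>_def real_sqrt_mult mult_ac)
        show ?thesis using e1 e2 unfolding z_def y_def by (simp add: algebra_simps)
      qed
      have t1b: "8 * t1\<^sup>2 / (real n2 * c0\<^sup>2) \<le> 256 * R\<^sup>2 / c0\<^sup>2 * (w * L)"
      proof -
        have e: "x * L = w * L * x powr (2/3)" using xw by (metis mult.assoc mult.commute)
        have "x powr (2/3) \<noteq> 0" using p23 by linarith
        then have "w * L * x powr (2/3) / x powr (2/3) = w * L" by (rule nonzero_mult_div_cancel_right)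
        then have "x * L / x powr (2/3) = w * L" unfolding e[symmetric] .
        moreover have "x * L / real n2 \<le> x * L / x powr (2/3)"
          using n2a p23 x0 L0 n2p by (intro divide_left_mono mult_pos_pos) auto
        ultimately have "256 * R\<^sup>2 / c0\<^sup>2 * (x * L / real n2) \<le> 256 * R\<^sup>2 / c0\<^sup>2 * (w * L)"
          by (intro mult_left_mono) auto
        then show ?thesis by (simp add: t1sq mult_ac)
      qed
      have t2b: "t2 \<le> 8 * R * (w * L)"
      proof -
        have "32 * (real n2 * L) \<le> 32 * ((2 * x powr (2/3)) * (L * L))"
          using n2b L1 by (intro mult_left_mono mult_mono) auto
        also have "\<dots> = 64 * (w * w) * (L * L)" by (simp add: w_def flip: powr_add)
        also have "\<dots> = (8 * (w * L))\<^sup>2" by (simp add: power2_eq_square)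
        finally have "sqrt (32 * (real n2 * L)) \<le> 8 * (w * L)" using w1 L0 by (intro real_le_lsqrt) auto
        then have "R * sqrt (32 * (real n2 * L)) \<le> R * (8 * (w * L))" using R0 by (intro mult_left_mono) auto
        then show ?thesis by (simp add: t2_def mult_ac)
      qed
      have k1: "(2 * \<bar>q\<bar> * sqrt Vmix + sqrt Vmix * Ks) * w \<le> (2 * \<bar>q\<bar> * sqrt Vmix + sqrt Vmix * Ks) * (w * L)"
        using wL(1) sV Ks0 by (intro mult_left_mono) auto
      have k2: "\<bar>a1\<bar> + \<bar>a2\<bar> \<le> (\<bar>a1\<bar> + \<bar>a2\<bar>) * (w * L)" using wL(3) mult_left_mono[of 1 "w * L" "\<bar>a1\<bar> + \<bar>a2\<bar>"] by simp
      have k3: "Kq * (8 * t1\<^sup>2 / (real n2 * c0\<^sup>2) + 2) \<le> Kq * ((256 * R\<^sup>2 / c0\<^sup>2 + 2) * (w * L))"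
        using t1b wL(3) Kq0 by (intro mult_left_mono) (auto simp: distrib_right)
      have k4: "6 * L \<le> 6 * (w * L)" using wL(2) by simp
      have "K * w * L = (2 * \<bar>q\<bar> * sqrt Vmix + sqrt Vmix * Ks) * (w * L) + (\<bar>a1\<bar> + \<bar>a2\<bar>) * (w * L)
        + Kq * ((256 * R\<^sup>2 / c0\<^sup>2 + 2) * (w * L)) + 8 * R * (w * L) + 6 * (w * L)"
        unfolding K_def by (simp only: distrib_right mult.assoc add.assoc)
      then show ?thesis unfolding \<gamma>_def x_def[symmetric] using z_lb t2b k1 k2 k3 k4 by linarith
    qed
    show ?thesis
    \<comment> \<open>Below \<open>6 * L\<close> the claimed bound is at most 0 and a single message
      suffices. Above it, \<open>exp \<gamma> / x^3\<close> is still at least \<open>x^3\<close>, so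
      that rounding down to an integer is harmless.\<close>
    proof (cases "\<gamma> < 6 * L")
      case True
      have "is_flf_code W1 W2 n 1 \<epsilon> (\<lambda>_ _ _ _. P) (\<lambda>_. 1) (\<lambda>_. 1)"
        by (rule trivial_code[OF P_simplex]) (use \<epsilon> in simp)
      moreover have "x * C - sqrt (x * Vmix) * q - K * w * L \<le> ln (real 1)" using lower True by simp
      ultimately show ?thesis unfolding x_def w_def L_def by blast
    next
      case False
      then have \<gamma>6: "6 * L \<le> \<gamma>" by simp
      \<comment> \<open>The factor \<open>x^3\<close> makes the false-alarm part of
        \<open>\<delta>\<close> at most \<open>6 / x^2\<close>; its price \<open>3 * L\<close> is
        well within the error term.\<close>
      define E where "E = exp \<gamma> / x^3"
      define M where "M = nat \<lfloor>E\<rfloor>"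
      have ex: "exp (real k * L) = x ^ k" for k using x0 by (simp add: L_def exp_of_nat_mult)
      have "x^6 \<le> exp \<gamma>" using ex[of 6, symmetric] \<gamma>6 by simp
      then have "x^6 / x^3 \<le> E" unfolding E_def using x0 by (intro divide_right_mono) auto
      moreover have "x^6 / x^3 = x^3" using x0 by (simp add: field_simps flip: power_add)
      ultimately have Ex: "x^3 \<le> E" by simp
      have "2 * x\<^sup>2 \<le> x^3" using x2 mult_right_mono[of 2 x "x\<^sup>2"] by (simp add: power3_eq_cube power2_eq_square mult.assoc)
      moreover have "4 \<le> x\<^sup>2" using x2 power_mono[of 2 x 2] by simp
      ultimately have E2: "x\<^sup>2 + 1 \<le> E" "2 \<le> E" using Ex by auto
      have Ml: "E - 1 \<le> real M" "real M \<le> E" unfolding M_def using E2(2) by linarith+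
      have Mx: "x\<^sup>2 \<le> real M" using Ml E2 by simp
      have M1: "1 \<le> M" using Ml E2(2) by (cases M) auto
      define \<delta> where "\<delta> = 2 / real M + 2 * (3 * real n * exp (- \<gamma>)) * real M"
      have \<delta>: "\<delta> \<le> 8 / x\<^sup>2"
      proof -
        have "2 / real M \<le> 2 / x\<^sup>2" using Mx x0 M1 by (intro divide_left_mono mult_pos_pos) auto
        moreover have "2 * (3 * real n * exp (- \<gamma>)) * real M \<le> 2 * (3 * real n * exp (- \<gamma>)) * E"
          using Ml(2) by (intro mult_left_mono) auto
        moreover have "2 * (3 * real n * exp (- \<gamma>)) * E = 6 / x\<^sup>2"
          using x0 by (simp add: E_def x_def[symmetric] exp_minus field_simps power3_eq_cube power2_eq_square)
        ultimately show ?thesis unfolding \<delta>_def by (simp add: add_divide_distrib[symmetric])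
      qed
      have s\<delta>: "sqrt \<delta> \<le> 3 / x"
      proof (rule real_le_lsqrt)
        show "\<delta> \<le> (3 / x)\<^sup>2" using \<delta> x0 by (simp add: power_divide field_simps)
      qed (use x0 in auto)
      have \<delta>x: "\<delta> \<le> 8 / x"
      proof -
        have "8 / x\<^sup>2 \<le> 8 / x" using x0 by (simp add: power2_eq_square field_simps)
        then show ?thesis using \<delta> by simp
      qed
      have eL: "exp (- L) = 1 / x" using x0 by (simp add: L_def exp_minus inverse_eq_divide)
      have tail1: "exp (- t1\<^sup>2 / (32 * real n1 * R\<^sup>2)) \<le> 1 / x"
      proof -
        have "L * real n1 \<le> x * L" using n1h L0 by simp
        then have "L \<le> t1\<^sup>2 / (32 * real n1 * R\<^sup>2)" unfolding t1sq using n1p R0 by (simp add: field_simps)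
        then show ?thesis unfolding eL[symmetric] by simp
      qed
      have tail2: "exp (- t2\<^sup>2 / (32 * real n2 * R\<^sup>2)) = 1 / x"
        unfolding t2sq eL[symmetric] using n2p R0 by simp
      define pz where "pz = Qfun y + Kc * (1 + \<bar>y\<bar>) * real n1 powr (- 1/6)"
      have pz: "iid ?p n1 (\<lambda>l. of_bool (sum_list (map mixdens l) \<le> z)) \<le> pz"
        unfolding pz_def z_def by (rule Kc(2)) (use n1p in simp)
      \<comment> \<open>The 16 adds up the other errors in units of \<open>1 / x\<close>: 4 and 1
        from the two phases' tails, 3 from \<open>sqrt \<delta>\<close>, and 8 from
        \<open>\<delta>\<close>.\<close>
      have pzb: "pz / 2 + 16 / x \<le> \<epsilon>"
      proof -
        let ?u = "x powr (- 1/6)"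
        have u0: "0 \<le> ?u" by simp
        have "real n1 powr (- 1/6) \<le> (x / 2) powr (- 1/6)" using n1h x0 by (intro powr_mono2') auto
        also have "\<dots> = ?u * 2 powr (1/6)" using x0 by (simp add: powr_divide powr_minus_divide)
        also have "\<dots> \<le> ?u * 2" using powr_mono[of "1/6" 1 "2::real"] by (intro mult_left_mono) auto
        finally have n1u: "real n1 powr (- 1/6) \<le> 2 * ?u" by simp
        have "Kc * (1 + \<bar>y\<bar>) * real n1 powr (- 1/6) \<le> Kc * (2 + \<bar>q\<bar>) * (2 * ?u)"
          using ya Kc(1) n1u by (intro mult_mono) auto
        moreover have "Qfun y \<le> 2 * \<epsilon> - \<kappa> * c" using Qfun_shift[OF \<kappa>, of q] q by (simp add: y_def c_def)
        moreover have "\<kappa> * c = Kc * (2 + \<bar>q\<bar>) * (2 * ?u) + 34 * ?u"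
        proof -
          have "\<kappa> * c = (2 * Kc * (2 + \<bar>q\<bar>) + 34) * ?u" using c by (simp add: \<kappa>_def Ks_def)
          then show ?thesis by (simp add: algebra_simps)
        qed
        moreover have "16 / x \<le> 16 * ?u"
          using x0 powr_mono[of "-1" "-1/6" x] by (simp add: powr_minus_divide)
        ultimately show ?thesis unfolding pz_def add_divide_distrib using u0 by linarith
      qed
      have "4 * exp (- t1\<^sup>2 / (32 * real n1 * R\<^sup>2)) + pz / 2 + exp (- t2\<^sup>2 / (32 * real n2 * R\<^sup>2)) + sqrt \<delta> + \<delta> \<le> \<epsilon>"
        using tail1 tail2 s\<delta> \<delta>x pzb by linarith
      then have code: "\<exists>f g1 g2. is_flf_code W1 W2 n M \<epsilon> f g1 g2"
        by (rule one_shot_code[OF n1p n2p nsum t1n t1u t2n t2u zt small M1 \<gamma>_def pz \<delta>_def])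
      have "\<gamma> - 6 * L \<le> ln (real M)"
      proof -
        have "E / 2 \<le> real M" using Ml E2(2) by linarith
        then have "ln (E / 2) \<le> ln (real M)" using E2(2) by (intro ln_mono) auto
        moreover have "ln (E / 2) = \<gamma> - 3 * L - ln 2"
          using x0 by (simp add: E_def ln_div ln_mult ln_realpow L_def)
        moreover have "ln 2 \<le> L" unfolding L_def using x2 by (intro ln_mono) auto
        ultimately show ?thesis using L0 by linarith
      qed
      then have "x * C - sqrt (x * Vmix) * q - K * w * L \<le> ln (real M)" using lower by simp
      then show ?thesis using code unfolding x_def w_def L_def by blast
    qed
  qed
  then show ?thesis unfolding q_def by blast
qed

end

lemma (in balanced_bc) converse:
  assumes \<epsilon>: "\<epsilon> < 1/2"
  shows "\<exists>K. \<forall>n\<ge>1. \<forall>M f g1 g2. is_flf_code W1 W2 n M \<epsilon> f g1 g2 \<longrightarrow> ln (real M) \<le> real n * C + K * sqrt (real n)"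
proof -
  define d where "d = 1 - 2 * \<epsilon>"
  have d: "0 < d" using \<epsilon> by (simp add: d_def)
  have B0: "0 \<le> sqbound" unfolding sqbound_def by (intro sum_nonneg) auto
  \<comment> \<open>Chebyshev may then use up at most half of \<open>d = 1 - 2 * \<epsilon>\<close>;
    the other half forces \<open>M\<close> to be at most a constant times
    \<open>exp (n * C + K * sqrt n)\<close>. The \<open>+ 1\<close> keeps \<open>K\<close>
    positive.\<close>
  define K where "K = sqrt (2 * sqbound / d) + 1"
  have K: "0 < K" using B0 d by (simp add: K_def add_nonneg_pos)
  have KB: "sqbound / K\<^sup>2 \<le> d / 2"
  proof -
    have "2 * sqbound / d = (sqrt (2 * sqbound / d))\<^sup>2" using B0 d by simp
    also have "\<dots> \<le> K\<^sup>2" unfolding K_def using B0 d by (intro power_mono) auto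
    finally show ?thesis using K d by (simp add: field_simps)
  qed
  have "ln (real M) \<le> real n * C + (K + \<bar>ln (4 / d)\<bar>) * sqrt (real n)"
    if n: "1 \<le> n" and code: "is_flf_code W1 W2 n M \<epsilon> f g1 g2" for n M f g1 g2
  proof -
    let ?g = "exp (real n * C + K * sqrt (real n))"
    have M: "0 < real M" using code by (simp add: is_flf_code_def)
    have "(1 - a) / 2 \<le> X" if "1 \<le> a + X + Y" "Y \<le> (1 - a) / 2" for a X Y :: real
      using that by (simp add: field_simps)
    from this[OF converse_bound[OF code n K] KB[unfolded d_def]]
    have "d / 2 \<le> 2 * ?g / real M" unfolding d_def .
    then have "real M \<le> 4 / d * ?g" using M d by (simp add: field_simps)
    then have "ln (real M) \<le> ln (4 / d * ?g)" using M by (intro ln_mono) auto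
    also have "\<dots> = ln (4 / d) + (real n * C + K * sqrt (real n))"
      using d by (subst ln_mult_pos) auto
    also have "ln (4 / d) \<le> \<bar>ln (4 / d)\<bar> * sqrt (real n)"
    proof -
      have "1 \<le> sqrt (real n)" using n by simp
      then have "\<bar>ln (4 / d)\<bar> * 1 \<le> \<bar>ln (4 / d)\<bar> * sqrt (real n)" by (intro mult_left_mono) auto
      then show ?thesis by linarith
    qed
    finally show ?thesis by (simp add: algebra_simps)
  qed
  then show ?thesis by blast
qed

theorem theorem4:
  fixes W1 W2 :: "'x::finite \<Rightarrow> 'y::finite \<Rightarrow> real" and \<epsilon> :: real
  assumes W1: "stochastic W1" and W2: "stochastic W2"
    and uniq: "\<exists>!P. P \<in> prob_simplex \<and> min (mutinf P W1) (mutinf P W2) = common_cap W1 W2"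
    and supp: "\<forall>x. 0 < opt_input W1 W2 x"
    and V1: "0 < dispersion (opt_input W1 W2) W1"
    and V2: "0 < dispersion (opt_input W1 W2) W2"
    and C1: "capacity W1 > common_cap W1 W2"
    and C2: "capacity W2 > common_cap W1 W2"
    and eta: "\<exists>!\<eta>. eta_cond W1 W2 \<eta>"
    and eps: "0 < \<epsilon>" "\<epsilon> < 1/2"
  shows "\<exists>K1 K2 (n0::nat). \<forall>n\<ge>n0.
     ln (real (Mstar_f W1 W2 n \<epsilon>)) \<ge> real n * common_cap W1 W2
        - sqrt (real n * Vdisp W1 W2) * Qinv (2 * \<epsilon>) - K1 * real n powr (1/3) * ln (real n)
   \<and> ln (real (Mstar_f W1 W2 n \<epsilon>)) \<le> real n * common_cap W1 W2 + K2 * sqrt (real n)"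
proof -
  define P where "P = opt_input W1 W2"
  define h where "h = eta W1 W2"
  define C where "C = common_cap W1 W2"
  have P: "P \<in> prob_simplex \<and> min (mutinf P W1) (mutinf P W2) = C"
    unfolding P_def C_def opt_input_def by (rule theI'[OF uniq])
  have pos: "\<And>x. 0 < P x" using supp by (simp add: P_def)
  have h: "eta_cond W1 W2 h" unfolding h_def eta_def by (rule theI'[OF eta])
  then have h01: "0 < h" "h < 1"
    and hd: "\<And>v. sum v UNIV = 0 \<Longrightarrow> h * dI W1 P v + (1 - h) * dI W2 P v = 0"
    by (auto simp: eta_cond_def P_def)
  have m1: "mutinf P W1 = C" unfolding C_def
    by (rule mutinf_opt_eq[OF W1 W2]) (use P pos C2 in \<open>auto simp: C_def\<close>)
  have m2: "mutinf P W2 = C" unfolding C_def common_cap_commute[of W1]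
    by (rule mutinf_opt_eq[OF W2 W1]) (use P pos C1 in \<open>auto simp: C_def min.commute common_cap_commute\<close>)
  have bal: "h * kl_row W1 x (outdist P W1) + (1 - h) * kl_row W2 x (outdist P W2) = C" for x
  proof -
    \<comment> \<open>The direction from \<open>P\<close> to the point mass at \<open>x\<close>: its
      derivative is the row divergence minus \<open>mutinf P W\<close>, so the defining property of
      \<open>\<eta>\<close> becomes the balance equation at \<open>x\<close>.\<close>
    define v where "v x' = of_bool (x' = x) - P x'" for x'
    have v0: "sum v UNIV = 0" using prob_simplexD(2)[of P] P by (simp add: v_def sum_subtractf of_bool_def)
    have dv: "dI W P v = kl_row W x (outdist P W) - mutinf P W" for W :: "'x \<Rightarrow> 'y \<Rightarrow> real"
      unfolding dI_def v_def left_diff_distrib sum_subtractf mutinf_def by simp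
    show ?thesis using hd[OF v0] unfolding dv m1 m2 by (simp add: algebra_simps)
  qed
  interpret balanced_bc W1 W2 P h C
    by unfold_locales (use W1 W2 P pos h01 bal in auto)
  obtain v s0 R Kq where "steerable_bc W1 W2 P h C v s0 R Kq"
    by (rule exists_steerable[OF m1 m2]) (use C1 in \<open>auto simp: C_def\<close>)
  then interpret steerable_bc W1 W2 P h C v s0 R Kq .
  have V: "Vmix = Vdisp W1 W2" unfolding Vmix_def by (simp add: Vdisp_def P_def h_def)
  have Vp: "0 < Vmix" unfolding Vmix_def using V1 V2 h01 by (intro add_pos_pos mult_pos_pos) (auto simp: P_def)
  obtain K1 n1 where ach: "\<And>n. n1 \<le> n \<Longrightarrow> \<exists>M f g1 g2. is_flf_code W1 W2 n M \<epsilon> f g1 g2 \<and>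
     real n * C - sqrt (real n * Vmix) * Qinv (2 * \<epsilon>) - K1 * real n powr (1/3) * ln (real n) \<le> ln (real M)"
    using achievability[OF Vp eps] by blast
  obtain K2 where con: "\<And>n M f g1 g2. 1 \<le> n \<Longrightarrow> is_flf_code W1 W2 n M \<epsilon> f g1 g2 \<Longrightarrow>
      ln (real M) \<le> real n * C + K2 * sqrt (real n)"
    using converse[OF eps(2)] by blast
  have "real n * C - sqrt (real n * Vmix) * Qinv (2 * \<epsilon>) - K1 * real n powr (1/3) * ln (real n) \<le> ln (real (Mstar_f W1 W2 n \<epsilon>))
     \<and> ln (real (Mstar_f W1 W2 n \<epsilon>)) \<le> real n * C + K2 * sqrt (real n)" if n: "max n1 1 \<le> n" for n
  proof -
    let ?A = "\<lambda>M. \<exists>f g1 g2. is_flf_code W1 W2 n M \<epsilon> f g1 g2"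
    obtain M where M: "?A M" "real n * C - sqrt (real n * Vmix) * Qinv (2 * \<epsilon>) - K1 * real n powr (1/3) * ln (real n) \<le> ln (real M)"
      using ach[of n] n by auto
    \<comment> \<open>The converse has a second use here: it bounds the set of achievable
      \<open>M\<close>, so that \<open>GREATEST\<close> is attained and really is the
      maximum.\<close>
    have bnd: "M' \<le> nat \<lceil>exp (real n * C + K2 * sqrt (real n))\<rceil>" if M': "?A M'" for M'
    proof -
      have "0 < real M'" using M' by (auto simp: is_flf_code_def)
      moreover have "ln (real M') \<le> real n * C + K2 * sqrt (real n)" using con n M' by auto
      ultimately have "real M' \<le> exp (real n * C + K2 * sqrt (real n))" by (metis exp_le_cancel_iff exp_ln)
      then show ?thesis by linarith
    qed
    have G: "?A (Mstar_f W1 W2 n \<epsilon>)" unfolding Mstar_f_def by (rule GreatestI_nat[where P = ?A, OF M(1) bnd])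
    have "M \<le> Mstar_f W1 W2 n \<epsilon>" unfolding Mstar_f_def by (rule Greatest_le_nat[where P = ?A, OF M(1) bnd])
    moreover have "0 < real M" using M(1) by (auto simp: is_flf_code_def)
    ultimately have "ln (real M) \<le> ln (real (Mstar_f W1 W2 n \<epsilon>))" by (intro ln_mono) auto
    moreover have "ln (real (Mstar_f W1 W2 n \<epsilon>)) \<le> real n * C + K2 * sqrt (real n)" using con n G by auto
    ultimately show ?thesis using M(2) by linarith
  qed
  then show ?thesis unfolding V C_def by blast
qed

end
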